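(* Let $F=F_p(d)$ be the free pro-$p$-group of rank $d\geq 2$, let $r=w^{p^l}\in F$ be a $p^l$-th power of an element $w\in F$, and fix $n\in\mathbb{N}$. Then there exist elements $z_n\in F$ such that: (a) for every unipotent representation $\phi:F\to GL_n(\mathbb{Q}_p)$ and every unipotent representation $\psi:F\to GL_n(\mathbb{F}_p)$ one has $\phi(z_n)=1$ and $\psi(z_n)=1$; (b) $r\cdot z_n^p$ is not a $p$-th power in $F$.
   Context: Representations are continuous homomorphisms; a representation is unipotent if its image is contained in a unipotent subgroup (e.g. is conjugate into the upper unitriangular matrices). Elements $z_n$ with these properties are called "conjurings" in the paper.
   Formalization: The element w is assumed nontrivial: if w = 1 then r = 1 and r·z^p = z^p is a p-th power for every z, so (b) fails. *)

theory Defs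
  imports "HOL-Analysis.Analysis" "HOL-Number_Theory.Residues" "HOL-Algebra.Coset"
begin

definition totally_disconnected_top :: "'a topology \<Rightarrow> bool" where
  "totally_disconnected_top T \<longleftrightarrow> (\<forall>S. connectedin T S \<longrightarrow> (\<exists>a. S \<subseteq> {a}))"

definition topological_group :: "('a, 'm) monoid_scheme \<Rightarrow> 'a topology \<Rightarrow> bool" where
  "topological_group G T \<longleftrightarrow> group G \<and> topspace T = carrier G \<and>
     continuous_map (prod_topology T T) T (\<lambda>(x, y). x \<otimes>\<^bsub>G\<^esub> y) \<and>
     continuous_map T T (\<lambda>x. inv\<^bsub>G\<^esub> x)"

definition pro_p_group :: "nat \<Rightarrow> ('a, 'm) monoid_scheme \<Rightarrow> 'a topology \<Rightarrow> bool" where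
  "pro_p_group p G T \<longleftrightarrow> topological_group G T \<and> compact_space T \<and> Hausdorff_space T \<and>
     totally_disconnected_top T \<and>
     (\<forall>N. N \<lhd> G \<and> openin T N \<longrightarrow> (\<exists>k. card (rcosets\<^bsub>G\<^esub> N) = p ^ k))"

text \<open>Free pro-p group of rank d on generators x 0, ..., x (d-1): universal property
  with respect to finite p-groups (which determines a free pro-p group up to
  isomorphism). Finite groups are taken with carrier in nat, which covers all finite
  groups up to isomorphism; continuity into a finite discrete group means that all
  fibres are open.\<close>
definition free_pro_p_group ::
  "nat \<Rightarrow> nat \<Rightarrow> ('a, 'm) monoid_scheme \<Rightarrow> 'a topology \<Rightarrow> (nat \<Rightarrow> 'a) \<Rightarrow> bool" where
  "free_pro_p_group p d G T x \<longleftrightarrow> pro_p_group p G T \<and> (\<forall>i<d. x i \<in> carrier G) \<and>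
     (\<forall>(H :: nat monoid) y. group H \<and> finite (carrier H) \<and> (\<exists>k. card (carrier H) = p ^ k) \<and>
        (\<forall>i<d. y i \<in> carrier H) \<longrightarrow>
        (\<exists>!f. f \<in> hom G H \<and> f \<in> extensional (carrier G) \<and>
              (\<forall>h\<in>carrier H. openin T {g \<in> carrier G. f g = h}) \<and>
              (\<forall>i<d. f (x i) = y i)))"

definition padic_val_rat :: "nat \<Rightarrow> rat \<Rightarrow> int" where
  "padic_val_rat p q = (case quotient_of q of (a, b) \<Rightarrow>
      int (multiplicity (int p) a) - int (multiplicity (int p) b))"

definition padic_abs :: "nat \<Rightarrow> rat \<Rightarrow> real" where
  "padic_abs p q = (if q = 0 then 0 else real p powr (- real_of_int (padic_val_rat p q)))"

definition padic_cauchy :: "nat \<Rightarrow> (nat \<Rightarrow> rat) \<Rightarrow> bool" where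
  "padic_cauchy p X \<longleftrightarrow> (\<forall>e>0. \<exists>N. \<forall>m\<ge>N. \<forall>k\<ge>N. padic_abs p (X m - X k) < e)"

definition padic_equiv :: "nat \<Rightarrow> (nat \<Rightarrow> rat) \<Rightarrow> (nat \<Rightarrow> rat) \<Rightarrow> bool" where
  "padic_equiv p X Y \<longleftrightarrow> padic_cauchy p X \<and> padic_cauchy p Y \<and>
     (\<lambda>n. padic_abs p (X n - Y n)) \<longlonglongrightarrow> 0"

definition qp_class :: "nat \<Rightarrow> (nat \<Rightarrow> rat) \<Rightarrow> (nat \<Rightarrow> rat) set" where
  "qp_class p X = {Y. padic_equiv p X Y}"

definition qp_rep :: "(nat \<Rightarrow> rat) set \<Rightarrow> nat \<Rightarrow> rat" where
  "qp_rep A = (SOME X. X \<in> A)"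

definition Qp :: "nat \<Rightarrow> (nat \<Rightarrow> rat) set ring" where
  "Qp p = \<lparr>carrier = qp_class p ` {X. padic_cauchy p X},
           monoid.mult = (\<lambda>A B. qp_class p (\<lambda>n. qp_rep A n * qp_rep B n)),
           one = qp_class p (\<lambda>_. 1),
           zero = qp_class p (\<lambda>_. 0),
           add = (\<lambda>A B. qp_class p (\<lambda>n. qp_rep A n + qp_rep B n))\<rparr>"

definition qp_dist :: "nat \<Rightarrow> (nat \<Rightarrow> rat) set \<Rightarrow> (nat \<Rightarrow> rat) set \<Rightarrow> real" where
  "qp_dist p A B = lim (\<lambda>n. padic_abs p (qp_rep A n - qp_rep B n))"

definition Fp :: "nat \<Rightarrow> int ring" where
  "Fp p = residue_ring (int p)"

definition discrete_dist :: "'b \<Rightarrow> 'b \<Rightarrow> real" where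
  "discrete_dist a b = (if a = b then 0 else 1)"

definition mat_mul :: "('b, 'c) ring_scheme \<Rightarrow> nat \<Rightarrow> (nat \<Rightarrow> nat \<Rightarrow> 'b) \<Rightarrow> (nat \<Rightarrow> nat \<Rightarrow> 'b) \<Rightarrow> nat \<Rightarrow> nat \<Rightarrow> 'b" where
  "mat_mul R n A B = (\<lambda>i j. foldr (\<lambda>k acc. (A i k \<otimes>\<^bsub>R\<^esub> B k j) \<oplus>\<^bsub>R\<^esub> acc) [0..<n] \<zero>\<^bsub>R\<^esub>)"

definition mat_one :: "('b, 'c) ring_scheme \<Rightarrow> nat \<Rightarrow> nat \<Rightarrow> 'b" where
  "mat_one R = (\<lambda>i j. if i = j then \<one>\<^bsub>R\<^esub> else \<zero>\<^bsub>R\<^esub>)"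

definition mat_eq :: "nat \<Rightarrow> (nat \<Rightarrow> nat \<Rightarrow> 'b) \<Rightarrow> (nat \<Rightarrow> nat \<Rightarrow> 'b) \<Rightarrow> bool" where
  "mat_eq n A B \<longleftrightarrow> (\<forall>i<n. \<forall>j<n. A i j = B i j)"

definition in_mat :: "('b, 'c) ring_scheme \<Rightarrow> nat \<Rightarrow> (nat \<Rightarrow> nat \<Rightarrow> 'b) \<Rightarrow> bool" where
  "in_mat R n A \<longleftrightarrow> (\<forall>i<n. \<forall>j<n. A i j \<in> carrier R)"

definition mat_inverse_pair :: "('b, 'c) ring_scheme \<Rightarrow> nat \<Rightarrow> (nat \<Rightarrow> nat \<Rightarrow> 'b) \<Rightarrow> (nat \<Rightarrow> nat \<Rightarrow> 'b) \<Rightarrow> bool" where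
  "mat_inverse_pair R n A B \<longleftrightarrow> in_mat R n A \<and> in_mat R n B \<and>
     mat_eq n (mat_mul R n A B) (mat_one R) \<and> mat_eq n (mat_mul R n B A) (mat_one R)"

definition in_GL :: "('b, 'c) ring_scheme \<Rightarrow> nat \<Rightarrow> (nat \<Rightarrow> nat \<Rightarrow> 'b) \<Rightarrow> bool" where
  "in_GL R n A \<longleftrightarrow> (\<exists>B. mat_inverse_pair R n A B)"

definition upper_unitriangular :: "('b, 'c) ring_scheme \<Rightarrow> nat \<Rightarrow> (nat \<Rightarrow> nat \<Rightarrow> 'b) \<Rightarrow> bool" where
  "upper_unitriangular R n A \<longleftrightarrow> in_mat R n A \<and>
     (\<forall>i<n. A i i = \<one>\<^bsub>R\<^esub>) \<and> (\<forall>i<n. \<forall>j<i. A i j = \<zero>\<^bsub>R\<^esub>)"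

text \<open>Continuous homomorphism G -> GL_n(R), where R carries the topology of the
  distance D (p-adic for Q_p, discrete for F_p).\<close>
definition representation ::
  "('a, 'm) monoid_scheme \<Rightarrow> 'a topology \<Rightarrow> ('b, 'c) ring_scheme \<Rightarrow> ('b \<Rightarrow> 'b \<Rightarrow> real) \<Rightarrow> nat
     \<Rightarrow> ('a \<Rightarrow> nat \<Rightarrow> nat \<Rightarrow> 'b) \<Rightarrow> bool" where
  "representation G T R D n \<phi> \<longleftrightarrow>
     (\<forall>g\<in>carrier G. in_GL R n (\<phi> g)) \<and>
     (\<forall>g\<in>carrier G. \<forall>h\<in>carrier G. mat_eq n (\<phi> (g \<otimes>\<^bsub>G\<^esub> h)) (mat_mul R n (\<phi> g) (\<phi> h))) \<and>
     (\<forall>i<n. \<forall>j<n. \<forall>g\<in>carrier G. \<forall>e>0. \<exists>U. openin T U \<and> g \<in> U \<and>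
         (\<forall>h\<in>U. D (\<phi> h i j) (\<phi> g i j) < e))"

definition unipotent_representation ::
  "('a, 'm) monoid_scheme \<Rightarrow> 'a topology \<Rightarrow> ('b, 'c) ring_scheme \<Rightarrow> ('b \<Rightarrow> 'b \<Rightarrow> real) \<Rightarrow> nat
     \<Rightarrow> ('a \<Rightarrow> nat \<Rightarrow> nat \<Rightarrow> 'b) \<Rightarrow> bool" where
  "unipotent_representation G T R D n \<phi> \<longleftrightarrow> representation G T R D n \<phi> \<and>
     (\<exists>P Q. mat_inverse_pair R n P Q \<and>
        (\<forall>g\<in>carrier G. upper_unitriangular R n (mat_mul R n (mat_mul R n P (\<phi> g)) Q)))"

end

theory Submission
  imports Defs
    "HOL-Algebra.Weak_Morphisms" "HOL-Algebra.Group_Action" "HOL-Computational_Algebra.Squarefree"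
begin

text \<open>
  If \<open>r\<close> is not a \<open>p\<close>-th power, \<open>z = 1\<close> works. Otherwise \<open>r = v\<^sup>p\<close> with \<open>v \<noteq> 1\<close>, and \<open>z\<close> is a left-normed
  commutator \<open>[x\<^sub>0, x\<^sub>1, \<dots>, x\<^sub>1]\<close> of large weight, which dies in every unitriangular group of size \<open>n\<close>.

  Suppose \<open>v\<^sup>p z\<^sup>p = y\<^sup>p\<close> and map this equation by the Magnus representation \<open>x\<^sub>i \<mapsto> 1 + X\<^sub>i\<close> to power
  series in noncommuting variables with coefficients in \<open>\<int>\<close> modulo a high power of the ideal
  \<open>(p, X\<^sub>0, X\<^sub>1, \<dots>)\<close>; the quotient is a finite ring, so that its group of series with constant term 1 is a
  finite \<open>p\<close>-group and the universal property of \<open>F\<close> applies. Let \<open>V\<close>, \<open>Z\<close>, \<open>Y\<close> be the images of \<open>v\<close>, \<open>z\<close>,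
  \<open>y\<close> and let \<open>\<beta>\<close> be the lowest form of \<open>Z - 1\<close>. As \<open>p\<close>-th roots are unique in characteristic 0,
  \<open>u = Y - V\<close> has lowest form \<open>\<beta>\<close>. Modulo \<open>p\<close>, with \<open>a = V - 1\<close>, the equation says that \<open>(a + u)\<^sup>p - a\<^sup>p\<close>
  is small, and its part linear in \<open>u\<close> forces \<open>a\<^sup>p\<close> to commute with \<open>\<beta>\<close> in lowest degree. For the
  iterated commutator \<open>\<beta>\<close> of degree larger than the lowest form of \<open>a\<^sup>p\<close> this is impossible.

  That \<open>a \<noteq> 0\<close> modulo \<open>p\<close>, with a bound on the degree of its lowest form, follows from the nilpotency
  of the augmentation ideal of the group ring over \<open>\<int>/p\<close> of a finite \<open>p\<close>-group in which \<open>v\<close> survives.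
\<close>

section \<open>Power series in noncommuting variables\<close>

text \<open>Words are lists of variable indices, and all natural numbers serve as variables, so that
  the type does not depend on \<open>d\<close>; the rank enters only through the filtrations below,
  which look at words over \<open>{..<d}\<close>. Coefficients are integers, since the argument
  divides by \<open>p\<close> before it reduces modulo \<open>p\<close>.\<close>

typedef ncps = "UNIV :: (nat list \<Rightarrow> int) set"
  morphisms ncoeff Ncps by simp

setup_lifting type_definition_ncps

lemma ncps_eqI: "(\<And>w. ncoeff f w = ncoeff g w) \<Longrightarrow> f = g"
  by transfer auto

text \<open>Recursion on the word makes associativity a direct induction; \<open>ncoeff_mult\<close> is the usual
  sum over all factorisations of the word.\<close>
fun word_conv :: "(nat list \<Rightarrow> int) \<Rightarrow> (nat list \<Rightarrow> int) \<Rightarrow> nat list \<Rightarrow> int" where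
  "word_conv f g [] = f [] * g []"
| "word_conv f g (x # w) = f [] * g (x # w) + word_conv (\<lambda>u. f (x # u)) g w"

lemma word_conv_add_left: "word_conv (\<lambda>u. f u + g u) h w = word_conv f h w + word_conv g h w"
  by (induction w arbitrary: f g) (simp_all add: algebra_simps)

lemma word_conv_add_right: "word_conv f (\<lambda>u. g u + h u) w = word_conv f g w + word_conv f h w"
  by (induction w arbitrary: f) (simp_all add: algebra_simps)

lemma word_conv_scale_left: "word_conv (\<lambda>u. c * f u) h w = c * word_conv f h w"
  by (induction w arbitrary: f) (simp_all add: algebra_simps)

lemma word_conv_zero_left: "word_conv (\<lambda>u. 0) h w = 0"
  by (induction w) simp_all

lemma word_conv_assoc:
  "word_conv (word_conv f g) h w = word_conv f (word_conv g h) w"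
  by (induction w arbitrary: f g)
    (simp_all add: algebra_simps word_conv_add_left word_conv_scale_left)

lemma word_conv_sum:
  "word_conv f g w = (\<Sum>i\<le>length w. f (take i w) * g (drop i w))"
proof (induction w arbitrary: f)
  case (Cons x w)
  have "(\<Sum>i\<le>length (x # w). f (take i (x # w)) * g (drop i (x # w)))
      = f [] * g (x # w) + (\<Sum>i\<le>length w. f (x # take i w) * g (drop i w))"
    by (simp add: sum.atMost_Suc_shift del: sum.atMost_Suc)
  then show ?case using Cons by simp
qed simp

instantiation ncps :: ring_1
begin

lift_definition zero_ncps :: ncps is "\<lambda>_. 0" .
lift_definition one_ncps :: ncps is "\<lambda>w. if w = [] then 1 else 0" .
lift_definition plus_ncps :: "ncps \<Rightarrow> ncps \<Rightarrow> ncps" is "\<lambda>f g w. f w + g w" .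
lift_definition minus_ncps :: "ncps \<Rightarrow> ncps \<Rightarrow> ncps" is "\<lambda>f g w. f w - g w" .
lift_definition uminus_ncps :: "ncps \<Rightarrow> ncps" is "\<lambda>f w. - f w" .
lift_definition times_ncps :: "ncps \<Rightarrow> ncps \<Rightarrow> ncps" is word_conv .

instance
proof
  fix a b c :: ncps
  show "1 * a = a"
  proof (transfer, rule ext)
    fix a :: "nat list \<Rightarrow> int" and w
    show "word_conv (\<lambda>w. if w = [] then 1 else 0) a w = a w"
      by (cases w) (simp_all add: word_conv_zero_left)
  qed
  show "a * 1 = a"
  proof (transfer, rule ext)
    fix a :: "nat list \<Rightarrow> int" and w
    show "word_conv a (\<lambda>w. if w = [] then 1 else 0) w = a w"
      by (induction w arbitrary: a) simp_all
  qed
  show "(0::ncps) \<noteq> 1" by transfer (metis zero_neq_one)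
qed (transfer; auto simp: word_conv_assoc word_conv_add_left word_conv_add_right)+

end

lemma ncoeff_simps [simp]:
  "ncoeff 0 w = 0" "ncoeff 1 w = (if w = [] then 1 else 0)"
  "ncoeff (f + g) w = ncoeff f w + ncoeff g w"
  "ncoeff (f - g) w = ncoeff f w - ncoeff g w"
  "ncoeff (- f) w = - ncoeff f w"
  by (transfer; simp)+

lemma ncoeff_mult: "ncoeff (f * g) w = (\<Sum>i\<le>length w. ncoeff f (take i w) * ncoeff g (drop i w))"
  by transfer (rule word_conv_sum)

lemma ncoeff_mult_Nil [simp]: "ncoeff (f * g) [] = ncoeff f [] * ncoeff g []"
  by transfer simp

lemma ncoeff_of_nat_mult [simp]: "ncoeff (of_nat k * f) w = int k * ncoeff f w"
  by (induction k) (simp_all add: algebra_simps)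

lemma ncoeff_power_Nil [simp]: "ncoeff (f ^ k) [] = ncoeff f [] ^ k"
  by (induction k) simp_all

lift_definition nvar :: "nat \<Rightarrow> ncps" is "\<lambda>x w. if w = [x] then 1 else 0" .

lemma ncoeff_nvar [simp]: "ncoeff (nvar x) w = (if w = [x] then 1 else 0)"
  by transfer simp

lemma ncoeff_mult_nvar_right:
  "ncoeff (f * nvar x) w = (if w \<noteq> [] \<and> last w = x then ncoeff f (butlast w) else 0)"
proof (cases w rule: rev_cases)
  case (snoc u y)
  have "ncoeff (f * nvar x) w = (\<Sum>i\<le>length w. if i = length u then (if y = x then ncoeff f u else 0) else 0)"
    unfolding ncoeff_mult
  proof (rule sum.cong)
    fix i assume "i \<in> {..length w}"
    then have "i \<le> length u \<or> i = Suc (length u)" using snoc by auto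
    then show "ncoeff f (take i w) * ncoeff (nvar x) (drop i w)
      = (if i = length u then (if y = x then ncoeff f u else 0) else 0)"
      using snoc by (auto simp: append_eq_Cons_conv)
  qed simp
  then show ?thesis using snoc by (simp add: sum.delta)
qed (simp add: ncoeff_mult)

lemma ncoeff_mult_nvar_left:
  "ncoeff (nvar x * f) w = (if w \<noteq> [] \<and> hd w = x then ncoeff f (tl w) else 0)"
proof (cases w)
  case (Cons y u)
  have "ncoeff (nvar x * f) w = word_conv (\<lambda>v. if y # v = [x] then 1 else 0) (ncoeff f) u"
    using Cons by (simp add: times_ncps.rep_eq nvar.rep_eq)
  also have "\<dots> = (if y = x then ncoeff f u else 0)"
    by (cases u) (auto simp: word_conv_zero_left)
  finally show ?thesis using Cons by simp
qed (simp add: ncoeff_mult)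

text \<open>The inverse is the geometric series in \<open>a = 1 - f\<close>. Since \<open>a\<close>
  has constant term 0, \<open>a ^ k\<close> has no terms of degree below \<open>k\<close>, so each
  coefficient of the series is a finite sum.\<close>

lemma ncps_right_inverse:
  assumes "ncoeff f [] = 1"
  shows "\<exists>g. f * g = 1 \<and> ncoeff g [] = 1"
proof -
  define a where "a = 1 - f"
  have a0: "ncoeff a [] = 0" using assms by (simp add: a_def)
  have a_pow: "ncoeff (a ^ k) w = 0" if "length w < k" for k w
    using that
  proof (induction k arbitrary: w)
    case (Suc k)
    show ?case unfolding power_Suc ncoeff_mult
    proof (rule sum.neutral, rule ballI)
      fix i assume "i \<in> {..length w}"
      then show "ncoeff a (take i w) * ncoeff (a ^ k) (drop i w) = 0"
        using a0 Suc by (cases "i = 0") auto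
    qed
  qed simp
  define S where "S N = (\<Sum>k<N. a ^ k)" for N
  have S: "ncoeff (S N) w = (\<Sum>k<N. ncoeff (a ^ k) w)" for N w
    unfolding S_def by (induction N) simp_all
  have stable: "ncoeff (S N) w = ncoeff (S (Suc (length w))) w" if "length w < N" for N w
    unfolding S using that by (intro sum.mono_neutral_right) (auto simp: a_pow)
  define g where "g = Ncps (\<lambda>w. ncoeff (S (Suc (length w))) w)"
  have g: "ncoeff g w = ncoeff (S N) w" if "length w < N" for N w
    using stable[OF that] by (simp add: g_def Ncps_inverse)
  have fS: "f * S N = 1 - a ^ N" for N
    unfolding S_def by (induction N) (simp_all add: a_def algebra_simps)
  have "f * g = 1"
  proof (rule ncps_eqI)
    fix w
    \<comment> \<open>The coefficient of \<open>f * g\<close> at \<open>w\<close> involves only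
      coefficients of \<open>g\<close> at suffixes of \<open>w\<close>, where \<open>g\<close> may
      be replaced by one partial sum.\<close>
    have "ncoeff (f * g) w = ncoeff (f * S (Suc (length w))) w"
      unfolding ncoeff_mult by (intro sum.cong refl arg_cong2[where f = "(*)"] g) auto
    then show "ncoeff (f * g) w = ncoeff 1 w" by (simp only: fS) (simp add: a_pow del: power_Suc)
  qed
  then have "ncoeff f [] * ncoeff g [] = 1" by (metis ncoeff_mult_Nil ncoeff_simps(2))
  then show ?thesis using \<open>f * g = 1\<close> assms by auto
qed

text \<open>A right inverse that itself has a right inverse is two-sided.\<close>

lemma ncps_inverse:
  assumes "ncoeff f [] = 1"
  shows "\<exists>g. f * g = 1 \<and> g * f = 1 \<and> ncoeff g [] = 1"
proof -
  obtain g where g: "f * g = 1" "ncoeff g [] = 1" using ncps_right_inverse[OF assms] by blast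
  obtain h where h: "g * h = 1" using ncps_right_inverse[OF g(2)] by blast
  have "f = h" using g(1) h by (metis mult.assoc mult_1_left mult_1_right)
  then show ?thesis using g h by blast
qed

subsection \<open>The filtration by the powers of the ideal generated by p and the variables\<close>

text \<open>\<open>npow_ideal p d e K\<close> consists of the series that, restricted to the first \<open>d\<close> variables and
  up to terms of degree at least \<open>e\<close>, lie in the \<open>K\<close>-th power of the ideal generated by \<open>p\<close> and
  the variables.\<close>
definition npow_ideal :: "nat \<Rightarrow> nat \<Rightarrow> nat \<Rightarrow> nat \<Rightarrow> ncps set" where
  "npow_ideal p d e K =
     {f. \<forall>w\<in>lists {..<d}. length w < e \<longrightarrow> int p ^ (K - length w) dvd ncoeff f w}"

text \<open>The reduction modulo \<open>p\<close> has order at least \<open>e\<close> in the first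
  \<open>d\<close> variables. This is the filtration in which lowest forms over the field with
  \<open>p\<close> elements are compared.\<close>

definition nmod :: "nat \<Rightarrow> nat \<Rightarrow> nat \<Rightarrow> ncps set" where
  "nmod p d e = {f. \<forall>w\<in>lists {..<d}. length w < e \<longrightarrow> int p dvd ncoeff f w}"

lemma take_in_lists [simp]: "w \<in> lists A \<Longrightarrow> take i w \<in> lists A"
  by (auto dest: in_set_takeD)

lemma drop_in_lists [simp]: "w \<in> lists A \<Longrightarrow> drop i w \<in> lists A"
  by (auto dest: in_set_dropD)

lemma npow_idealI:
  "(\<And>w. w \<in> lists {..<d} \<Longrightarrow> length w < e \<Longrightarrow> int p ^ (K - length w) dvd ncoeff f w)
    \<Longrightarrow> f \<in> npow_ideal p d e K"
  by (simp add: npow_ideal_def)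

lemma npow_idealD:
  "f \<in> npow_ideal p d e K \<Longrightarrow> w \<in> lists {..<d} \<Longrightarrow> length w < e \<Longrightarrow> K' \<le> K - length w
    \<Longrightarrow> int p ^ K' dvd ncoeff f w"
  unfolding npow_ideal_def by (blast intro: dvd_trans le_imp_power_dvd)

lemma nmodI:
  "(\<And>w. w \<in> lists {..<d} \<Longrightarrow> length w < e \<Longrightarrow> int p dvd ncoeff f w) \<Longrightarrow> f \<in> nmod p d e"
  by (simp add: nmod_def)

lemma nmodD:
  "f \<in> nmod p d e \<Longrightarrow> w \<in> lists {..<d} \<Longrightarrow> length w < e \<Longrightarrow> int p dvd ncoeff f w"
  unfolding nmod_def by blast

lemma npow_ideal_add: "f \<in> npow_ideal p d e K \<Longrightarrow> g \<in> npow_ideal p d e K \<Longrightarrow> f + g \<in> npow_ideal p d e K"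
  by (auto simp: npow_ideal_def)

lemma npow_ideal_diff: "f \<in> npow_ideal p d e K \<Longrightarrow> g \<in> npow_ideal p d e K \<Longrightarrow> f - g \<in> npow_ideal p d e K"
  by (auto simp: npow_ideal_def)

lemma npow_ideal_zero [simp]: "0 \<in> npow_ideal p d e K"
  by (auto simp: npow_ideal_def)

lemma npow_ideal_mono:
  "f \<in> npow_ideal p d e K \<Longrightarrow> e' \<le> e \<Longrightarrow> K' \<le> K \<Longrightarrow> f \<in> npow_ideal p d e' K'"
  by (rule npow_idealI, erule npow_idealD) (auto intro: diff_le_mono)

lemma npow_ideal_mult_left: "g \<in> npow_ideal p d e K \<Longrightarrow> f * g \<in> npow_ideal p d e K"
  by (rule npow_idealI, unfold ncoeff_mult, rule dvd_sum, rule dvd_mult, erule npow_idealD) auto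

lemma npow_ideal_mult_right: "g \<in> npow_ideal p d e K \<Longrightarrow> g * f \<in> npow_ideal p d e K"
  by (rule npow_idealI, unfold ncoeff_mult, rule dvd_sum, rule dvd_mult2, erule npow_idealD) auto

text \<open>In each factorisation that contributes, the part in \<open>f\<close> is nonempty, so the
  part in \<open>g\<close> is shorter than the whole word: both the degree bound and the exponent
  gain one.\<close>

lemma npow_ideal_aug_mult_left:
  assumes g: "g \<in> npow_ideal p d e K" and f: "ncoeff f [] = 0"
  shows "f * g \<in> npow_ideal p d (Suc e) (Suc K)"
proof (rule npow_idealI)
  fix w assume w: "w \<in> lists {..<d}" "length w < Suc e"
  show "int p ^ (Suc K - length w) dvd ncoeff (f * g) w"
    unfolding ncoeff_mult
  proof (rule dvd_sum)
    fix i assume i: "i \<in> {..length w}"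
    show "int p ^ (Suc K - length w) dvd ncoeff f (take i w) * ncoeff g (drop i w)"
    proof (cases "i = 0")
      case False
      then show ?thesis
        using w i by (intro dvd_mult npow_idealD[OF g]) auto
    qed (simp add: f)
  qed
qed

lemma npow_ideal_aug_mult_right:
  assumes g: "g \<in> npow_ideal p d e K" and f: "ncoeff f [] = 0"
  shows "g * f \<in> npow_ideal p d (Suc e) (Suc K)"
proof (rule npow_idealI)
  fix w assume w: "w \<in> lists {..<d}" "length w < Suc e"
  show "int p ^ (Suc K - length w) dvd ncoeff (g * f) w"
    unfolding ncoeff_mult
  proof (rule dvd_sum)
    fix i assume i: "i \<in> {..length w}"
    show "int p ^ (Suc K - length w) dvd ncoeff g (take i w) * ncoeff f (drop i w)"
    proof (cases "i = length w")
      case False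
      then show ?thesis
        using w i by (intro dvd_mult2 npow_idealD[OF g]) auto
    qed (simp add: f)
  qed
qed

text \<open>Characteristic 0 enters here: \<open>p\<close> cancels in the coefficients at the cost
  of one step in the exponent. Words longer than \<open>K\<close> carry no condition.\<close>

lemma npow_ideal_cancel_p:
  assumes "of_nat p * u \<in> npow_ideal p d e (Suc K)" and "p > 0"
  shows "u \<in> npow_ideal p d e K"
proof (rule npow_idealI)
  fix w assume w: "w \<in> lists {..<d}" "length w < e"
  have *: "int p ^ (Suc K - length w) dvd int p * ncoeff u w"
    using npow_idealD[OF assms(1) w order_refl] by simp
  show "int p ^ (K - length w) dvd ncoeff u w"
  proof (cases "length w \<le> K")
    case True
    then show ?thesis using * \<open>p > 0\<close> by (simp add: Suc_diff_le)
  qed simp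
qed

lemma npow_ideal_subset_nmod: "e \<le> K \<Longrightarrow> e \<le> e' \<Longrightarrow> f \<in> npow_ideal p d e' K \<Longrightarrow> f \<in> nmod p d e"
  by (rule nmodI, frule npow_idealD[where K' = 1]) auto

lemma nmod_add: "f \<in> nmod p d e \<Longrightarrow> g \<in> nmod p d e \<Longrightarrow> f + g \<in> nmod p d e"
  by (auto simp: nmod_def)

lemma nmod_diff: "f \<in> nmod p d e \<Longrightarrow> g \<in> nmod p d e \<Longrightarrow> f - g \<in> nmod p d e"
  by (auto simp: nmod_def)

lemma nmod_mono: "f \<in> nmod p d e \<Longrightarrow> e' \<le> e \<Longrightarrow> f \<in> nmod p d e'"
  by (auto simp: nmod_def)

lemma nmod_0 [simp]: "f \<in> nmod p d 0"
  by (auto simp: nmod_def)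

lemma nmod_mult:
  assumes f: "f \<in> nmod p d a" and g: "g \<in> nmod p d b"
  shows "f * g \<in> nmod p d (a + b)"
proof (rule nmodI)
  fix w assume w: "w \<in> lists {..<d}" "length w < a + b"
  show "int p dvd ncoeff (f * g) w"
    unfolding ncoeff_mult
  proof (rule dvd_sum)
    fix i assume i: "i \<in> {..length w}"
    then consider "length (take i w) < a" | "length (drop i w) < b" using w by force
    then show "int p dvd ncoeff f (take i w) * ncoeff g (drop i w)"
      using nmodD[OF f, of "take i w"] nmodD[OF g, of "drop i w"] w by cases auto
  qed
qed

lemma nmod_mult_left: "g \<in> nmod p d b \<Longrightarrow> f * g \<in> nmod p d b"
  using nmod_mult[of f p d 0 g b] by simp

lemma nmod_mult_right: "g \<in> nmod p d b \<Longrightarrow> g * f \<in> nmod p d b"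
  using nmod_mult[of g p d b f 0] by simp

lemma nmod_power: "f \<in> nmod p d a \<Longrightarrow> f ^ k \<in> nmod p d (k * a)"
  by (induction k) (auto intro: nmod_mult)

text \<open>Modulo \<open>p\<close>, the lowest form of a product is the product of the lowest
  forms: in degree \<open>a + b\<close> every cut other than the one at \<open>a\<close> leaves one
  factor below its order.\<close>

lemma ncoeff_mult_lowest:
  assumes f: "f \<in> nmod p d a" and g: "g \<in> nmod p d b"
    and w: "w \<in> lists {..<d}" "length w = a + b"
  shows "int p dvd ncoeff (f * g) w - ncoeff f (take a w) * ncoeff g (drop a w)"
proof -
  have "ncoeff (f * g) w - ncoeff f (take a w) * ncoeff g (drop a w)
      = (\<Sum>i\<in>{..length w} - {a}. ncoeff f (take i w) * ncoeff g (drop i w))"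
    unfolding ncoeff_mult using w by (subst sum.remove[of _ a]) auto
  also have "int p dvd \<dots>"
  proof (rule dvd_sum)
    fix i assume i: "i \<in> {..length w} - {a}"
    then consider "length (take i w) < a" | "length (drop i w) < b" using w by force
    then show "int p dvd ncoeff f (take i w) * ncoeff g (drop i w)"
      using nmodD[OF f, of "take i w"] nmodD[OF g, of "drop i w"] w by cases auto
  qed
  finally show ?thesis .
qed

text \<open>Modulo \<open>p\<close>, the coefficient at the \<open>k\<close>-fold concatenation of
  \<open>w\<close> is the \<open>k\<close>-th power of the one at \<open>w\<close>, and a field has
  no zero divisors.\<close>

lemma ncoeff_power_lowest:
  assumes f: "f \<in> nmod p d s" and w: "w \<in> lists {..<d}" "length w = s" and p: "prime p"
    and nz: "\<not> int p dvd ncoeff f w"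
  shows "\<not> int p dvd ncoeff (f ^ k) (concat (replicate k w))"
proof (induction k)
  case 0
  then show ?case using p by (simp add: prime_nat_iff)
next
  case (Suc k)
  have len: "length (concat (replicate k w)) = k * s" using w by (induction k) auto
  have lst: "concat (replicate k w) \<in> lists {..<d}" using w by (induction k) auto
  have "int p dvd ncoeff (f * f ^ k) (w @ concat (replicate k w))
      - ncoeff f (take s (w @ concat (replicate k w))) * ncoeff (f ^ k) (drop s (w @ concat (replicate k w)))"
    using w len lst by (intro ncoeff_mult_lowest[OF f nmod_power[OF f]]) auto
  then have *: "int p dvd ncoeff (f * f ^ k) (w @ concat (replicate k w))
      - ncoeff f w * ncoeff (f ^ k) (concat (replicate k w))"
    using w by simp
  show ?case
  proof
    assume "int p dvd ncoeff (f ^ Suc k) (concat (replicate (Suc k) w))"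
    then have "int p dvd ncoeff f w * ncoeff (f ^ k) (concat (replicate k w))"
      using * by (simp add: dvd_diff_right_iff)
    then show False using Suc nz p by (simp add: prime_dvd_mult_iff)
  qed
qed

section \<open>Differences of powers, and powers modulo p\<close>

lemma power_diff_in_npow_ideal:
  assumes "Y - V \<in> npow_ideal p d e K"
  shows "Y ^ j - V ^ j \<in> npow_ideal p d e K"
proof (induction j)
  case (Suc j)
  have "Y ^ Suc j - V ^ Suc j = Y * (Y ^ j - V ^ j) + (Y - V) * V ^ j"
    by (simp add: algebra_simps)
  then show ?case
    using Suc assms by (metis npow_ideal_add npow_ideal_mult_left npow_ideal_mult_right)
qed simp

text \<open>As \<open>V\<close> and \<open>Y\<close> have constant term 1, replacing factors by 1 in
  the expansion of \<open>Y ^ j - V ^ j\<close> changes it only by terms one step deeper in the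
  filtration; what remains is \<open>j\<close> copies of \<open>Y - V\<close>.\<close>

lemma power_diff_linear:
  assumes "ncoeff V [] = 1" "ncoeff Y [] = 1" and u: "Y - V \<in> npow_ideal p d e K"
  shows "Y ^ j - V ^ j - of_nat j * (Y - V) \<in> npow_ideal p d (Suc e) (Suc K)"
proof (induction j)
  case (Suc j)
  have "Y ^ Suc j - V ^ Suc j - of_nat (Suc j) * (Y - V)
      = (Y ^ j - V ^ j - of_nat j * (Y - V)) + (Y - 1) * (Y ^ j - V ^ j) + (Y - V) * (V ^ j - 1)"
    by (simp add: algebra_simps)
  moreover have "(Y - 1) * (Y ^ j - V ^ j) \<in> npow_ideal p d (Suc e) (Suc K)"
    using assms by (intro npow_ideal_aug_mult_left power_diff_in_npow_ideal) auto
  moreover have "(Y - V) * (V ^ j - 1) \<in> npow_ideal p d (Suc e) (Suc K)"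
    using assms by (intro npow_ideal_aug_mult_right) auto
  ultimately show ?case using Suc by (metis npow_ideal_add)
qed simp

text \<open>The binomial expansion is available since 1 commutes with \<open>f\<close>; the inner
  binomial coefficients are divisible by the prime \<open>p\<close>.\<close>

lemma freshman_dream:
  assumes "prime p"
  shows "(1 + f) ^ p - 1 - f ^ p \<in> nmod p d e"
proof (rule nmodI)
  fix w :: "nat list"
  have fin: "ncoeff (\<Sum>k\<in>A. g k) w = (\<Sum>k\<in>A. ncoeff (g k) w)" if "finite A" for A :: "nat set" and g
    using that by induction auto
  have p: "p > 0" using assms prime_gt_0_nat by blast
  have "(1 + f) ^ k = (\<Sum>i\<le>k. of_nat (k choose i) * f ^ i)" for k
  proof (induction k)
    case (Suc k)
    have "(1 + f) ^ Suc k = (\<Sum>i\<le>k. of_nat (k choose i) * f ^ i) + (\<Sum>i\<le>k. of_nat (k choose i) * f ^ Suc i)"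
      unfolding power_Suc2 Suc by (simp add: distrib_left sum_distrib_right mult.assoc power_commutes)
    also have "(\<Sum>i\<le>k. of_nat (k choose i) * f ^ i) = 1 + (\<Sum>i\<le>k. of_nat (k choose Suc i) * f ^ Suc i)"
      using sum.atMost_Suc_shift[of "\<lambda>i. of_nat (k choose i) * f ^ i" k]
      by (simp add: binomial_eq_0)
    also have "1 + (\<Sum>i\<le>k. of_nat (k choose Suc i) * f ^ Suc i) + (\<Sum>i\<le>k. of_nat (k choose i) * f ^ Suc i)
       = 1 + (\<Sum>i\<le>k. of_nat (Suc k choose Suc i) * f ^ Suc i)"
      by (simp add: sum.distrib[symmetric] algebra_simps)
    also have "\<dots> = (\<Sum>i\<le>Suc k. of_nat (Suc k choose i) * f ^ i)"
      by (simp only: sum.atMost_Suc_shift) simp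
    finally show ?case .
  qed simp
  then have "(1 + f) ^ p = (\<Sum>i\<in>{0, p} \<union> {1..<p}. of_nat (p choose i) * f ^ i)"
    using p by (simp only:) (rule sum.cong, auto)
  also have "\<dots> = 1 + f ^ p + (\<Sum>i=1..<p. of_nat (p choose i) * f ^ i)"
    using p by (subst sum.union_disjoint) auto
  finally have eq: "(1 + f) ^ p - 1 - f ^ p = (\<Sum>i=1..<p. of_nat (p choose i) * f ^ i)" by simp
  show "int p dvd ncoeff ((1 + f) ^ p - 1 - f ^ p) w"
    unfolding eq fin[OF finite_atLeastLessThan]
    using assms by (intro dvd_sum) (auto simp: dvd_choose_prime)
qed

text \<open>This is the sum of \<open>a ^ i * u * a ^ (j - 1 - i)\<close> over \<open>i < j\<close>,
  the part of \<open>(a + u) ^ j\<close> that is linear in \<open>u\<close>.\<close>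

fun derivation_sum :: "nat \<Rightarrow> 'a :: ring_1 \<Rightarrow> 'a \<Rightarrow> 'a" where
  "derivation_sum 0 a u = 0"
| "derivation_sum (Suc j) a u = derivation_sum j a u * a + a ^ j * u"

text \<open>The sum telescopes. This turns smallness of the linear part of a \<open>p\<close>-th
  power into commutation of \<open>a ^ p\<close> with \<open>u\<close>.\<close>

lemma derivation_sum_commutator:
  "a * derivation_sum j a u - derivation_sum j a u * a = a ^ j * u - u * a ^ j"
proof (induction j)
  case (Suc j)
  have "a * derivation_sum (Suc j) a u - derivation_sum (Suc j) a u * a
     = (a * derivation_sum j a u - derivation_sum j a u * a) * a + a * a ^ j * u - a ^ j * u * a"
    by (simp add: algebra_simps)
  also have "\<dots> = a ^ Suc j * u - u * a ^ Suc j"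
    unfolding Suc by (simp add: algebra_simps power_commutes)
  finally show ?case .
qed simp

lemma derivation_sum_nmod: "u \<in> nmod p d t \<Longrightarrow> derivation_sum j a u \<in> nmod p d t"
proof (induction j)
  case 0
  then show ?case by (simp add: nmod_def)
qed (simp add: nmod_add nmod_mult_left nmod_mult_right)

text \<open>All other terms of the expansion contain \<open>u\<close> at least twice.\<close>

lemma power_add_expansion:
  assumes "u \<in> nmod p d t"
  shows "(a + u) ^ j - a ^ j - derivation_sum j a u \<in> nmod p d (t + t)"
proof (induction j)
  case (Suc j)
  have "(a + u) ^ Suc j - a ^ Suc j - derivation_sum (Suc j) a u
     = ((a + u) ^ j - a ^ j - derivation_sum j a u) * (a + u) + derivation_sum j a u * u"
    unfolding power_Suc2 by (simp add: algebra_simps)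
  then show ?case
    using Suc assms by (metis nmod_add nmod_mult nmod_mult_right derivation_sum_nmod)
qed (simp add: nmod_def)

lemma lowest_term_exists:
  assumes "a \<notin> nmod p d m"
  obtains w where "w \<in> lists {..<d}" "length w < m" "\<not> int p dvd ncoeff a w"
    "a \<in> nmod p d (length w)"
proof -
  define P where "P w \<longleftrightarrow> w \<in> lists {..<d} \<and> \<not> int p dvd ncoeff a w" for w
  obtain v where v: "P v" "length v < m" using assms unfolding nmod_def P_def by auto
  define w where "w = arg_min length P"
  have w: "P w" "length w \<le> length v" "\<And>u. P u \<Longrightarrow> length w \<le> length u"
    unfolding w_def using arg_min_nat_lemma[of P v length] v by auto
  have "a \<in> nmod p d (length w)"
    using w(3) unfolding P_def by (intro nmodI) (metis leD)
  then show ?thesis using that[of w] w v unfolding P_def by simp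
qed

subsection \<open>Left-normed commutators\<close>

text \<open>The Lie element \<open>[X0, X1, ..., X1]\<close> with \<open>k\<close> entries
  \<open>X1\<close>, homogeneous of degree \<open>k + 1\<close>. It will be the lowest form of the
  corresponding iterated commutator in the group of series.\<close>

fun lie_word :: "nat \<Rightarrow> ncps" where
  "lie_word 0 = nvar 0"
| "lie_word (Suc k) = lie_word k * nvar 1 - nvar 1 * lie_word k"

lemma lie_word_support:
  "ncoeff (lie_word k) w \<noteq> 0 \<Longrightarrow> length w = Suc k \<and> count_list w 0 = 1"
proof (induction k arbitrary: w)
  case (Suc k)
  then consider "w \<noteq> []" "last w = 1" "ncoeff (lie_word k) (butlast w) \<noteq> 0"
    | "w \<noteq> []" "hd w = 1" "ncoeff (lie_word k) (tl w) \<noteq> 0"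
    by (fastforce simp: ncoeff_mult_nvar_left ncoeff_mult_nvar_right split: if_splits)
  then show ?case
  proof cases
    case 1
    then show ?thesis using Suc.IH[of "butlast w"] by (cases w rule: rev_cases) auto
  next
    case 2
    then show ?thesis using Suc.IH[of "tl w"] by (cases w) auto
  qed
qed (simp split: if_splits)

lemma lie_word_in_npow_ideal: "lie_word k \<in> npow_ideal p d (Suc k) L"
  by (rule npow_idealI) (metis dvd_0_right less_not_refl lie_word_support)

text \<open>This word and the one of the next lemma, with the letter 0 at opposite ends, are the
  test words for noncommutation.\<close>

lemma lie_word_coeff_first: "ncoeff (lie_word k) (0 # replicate k 1) = 1"
proof (induction k)
  case (Suc k)
  have "butlast (0 # replicate (Suc k) 1) = 0 # replicate k (1::nat)"
    by (simp add: replicate_append_same[symmetric] butlast_append del: replicate_Suc) 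
       (simp add: butlast_append replicate_append_same[symmetric])
  then show ?case using Suc
    by (simp add: ncoeff_mult_nvar_left ncoeff_mult_nvar_right)
qed simp

lemma lie_word_coeff_last: "ncoeff (lie_word k) (replicate k 1 @ [0]) = (-1) ^ k"
  by (induction k) (simp_all add: ncoeff_mult_nvar_left ncoeff_mult_nvar_right)

text \<open>Compare coefficients at \<open>w0 @ v\<close>, where \<open>lie_word k\<close> has
  coefficient 1 or -1 at \<open>v\<close>. Commutation in lowest degree forces the first
  \<open>k + 1\<close> letters of \<open>w0 @ v\<close> to form again a word of
  \<open>lie_word k\<close>, thus to contain exactly one 0. Moving the 0 of \<open>v\<close> from
  the last to the first place changes this count.\<close>

lemma lowest_form_not_commuting:
  assumes A: "w0 \<in> lists {..<d}" "length w0 = q" "\<not> int p dvd ncoeff A w0"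
    and q: "0 < q" "q \<le> k" and d: "d \<ge> 2"
    and A_low: "A \<in> nmod p d q" and u: "u \<in> nmod p d (Suc k)"
    and u_lie: "u - lie_word k \<in> nmod p d (Suc (Suc k))" and p: "prime p"
  shows "A * u - u * A \<notin> nmod p d (Suc k + Suc k)"
proof
  assume comm: "A * u - u * A \<in> nmod p d (Suc k + Suc k)"
  have key: "count_list (take (Suc k) (w0 @ v)) 0 = 1"
    if v: "v \<in> lists {..<d}" "length v = Suc k" "\<bar>ncoeff (lie_word k) v\<bar> = 1" for v
  proof -
    let ?w = "w0 @ v"
    have w: "?w \<in> lists {..<d}" "length ?w = q + Suc k" using v A by auto
    have 1: "int p dvd ncoeff (A * u) ?w - ncoeff A w0 * ncoeff u v"
      using ncoeff_mult_lowest[OF A_low u w] A by simp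
    have 2: "int p dvd ncoeff (u * A) ?w - ncoeff u (take (Suc k) ?w) * ncoeff A (drop (Suc k) ?w)"
      using w by (intro ncoeff_mult_lowest[OF u A_low]) auto
    have 3: "int p dvd ncoeff (A * u) ?w - ncoeff (u * A) ?w"
      using nmodD[OF comm w(1)] w q by simp
    have 4: "int p dvd ncoeff u v - ncoeff (lie_word k) v"
      using nmodD[OF u_lie v(1)] v by simp
    have 5: "int p dvd ncoeff u (take (Suc k) ?w) - ncoeff (lie_word k) (take (Suc k) ?w)"
      using nmodD[OF u_lie take_in_lists[OF w(1)], of "Suc k"] w by simp
    have nd: "\<not> int p dvd ncoeff (lie_word k) v"
      using v(3) p by (metis abs_dvd_iff dvd_abs_iff not_prime_unit prime_nat_int_transfer zdvd1_eq)
    then have "\<not> int p dvd ncoeff u v" using 4 by (metis dvd_diff_right_iff)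
    then have "\<not> int p dvd ncoeff A w0 * ncoeff u v"
      using A(3) p by (simp add: prime_dvd_mult_iff)
    then have "\<not> int p dvd ncoeff u (take (Suc k) ?w) * ncoeff A (drop (Suc k) ?w)"
      using 1 2 3 by (smt (verit) dvd_add dvd_diff)
    then have "\<not> int p dvd ncoeff u (take (Suc k) ?w)" by auto
    then have "ncoeff (lie_word k) (take (Suc k) ?w) \<noteq> 0" using 5 by (metis diff_zero)
    then show ?thesis using lie_word_support by blast
  qed
  \<comment> \<open>The prefix of length \<open>k + 1\<close> cuts off the final 0 because
    \<open>w0\<close> is nonempty, so the single 0 lies in \<open>w0\<close>.\<close>
  have "count_list (take (Suc k) (w0 @ replicate k 1 @ [0])) 0 = 1"
    using d lie_word_coeff_last[of k] by (intro key) (auto simp: power_abs)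
  then have c1: "count_list w0 0 = 1" using A q by (simp add: min_def count_list_0_iff split: if_splits)
  \<comment> \<open>Now the prefix reaches the 0 right after \<open>w0\<close> because
    \<open>q <= k\<close>, which leaves no 0 for \<open>w0\<close>.\<close>
  have "count_list (take (Suc k) (w0 @ 0 # replicate k 1)) 0 = 1"
    using d lie_word_coeff_first[of k] by (intro key) auto
  then have "count_list w0 0 = 0" using A q by (auto simp: Suc_diff_le take_Cons')
  then show False using c1 by simp
qed

subsection \<open>The key computation\<close>

text \<open>The equation is read twice. Over the integers it determines \<open>u = Y - V\<close> up
  to degree \<open>k + 1\<close>, at the cost of one power of \<open>p\<close>. Modulo
  \<open>p\<close> it is then read up to degree \<open>2 * k + 1\<close>, below the terms quadratic
  in \<open>u\<close>; hence the bound on \<open>K\<close>.\<close>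

lemma no_pth_root:
  assumes p: "prime p" and d: "d \<ge> 2"
    and one: "ncoeff V [] = 1" "ncoeff Y [] = 1" "ncoeff Z [] = 1"
    and V: "V - 1 \<notin> nmod p d m" and m: "p * m \<le> k"
    and Z: "Z - 1 - lie_word k \<in> npow_ideal p d (Suc (Suc k)) K"
    and K: "K \<ge> 2 * Suc k"
  shows "\<exists>e. Y ^ p - V ^ p * Z ^ p \<notin> npow_ideal p d e K"
proof (rule ccontr)
  assume "\<not> ?thesis"
  then have eq: "Y ^ p - V ^ p * Z ^ p \<in> npow_ideal p d e K" for e by blast
  \<comment> \<open>\<open>K'\<close> is the exponent left after one division by
    \<open>p\<close>.\<close>
  obtain K' where K': "K = Suc K'" using K by (cases K) auto
  have p0: "p > 0" using p prime_gt_0_nat by blast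
  have b_in: "Z - 1 \<in> npow_ideal p d (Suc k) K"
    using npow_ideal_add[OF npow_ideal_mono[OF Z, of "Suc k" K] lie_word_in_npow_ideal] by simp
  \<comment> \<open>\<open>R\<close> is the part of \<open>V ^ p * Z ^ p\<close> beyond
    \<open>V ^ p\<close>.\<close>
  define R where "R = V ^ p * (Z ^ p - 1)"
  have R_in: "R \<in> npow_ideal p d (Suc k) K"
    unfolding R_def using power_diff_in_npow_ideal[OF b_in, of p] by (auto intro: npow_ideal_mult_left)
  have eqR: "Y ^ p - V ^ p - R \<in> npow_ideal p d e K" for e
    using eq by (simp add: R_def algebra_simps)
  \<comment> \<open>The order of \<open>Y - V\<close> is raised one degree at a time:
    \<open>p * (Y - V)\<close> agrees with \<open>Y ^ p - V ^ p\<close>, thus with \<open>R\<close>,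
    one degree further, and \<open>p\<close> cancels.\<close>
  have u_in: "Y - V \<in> npow_ideal p d e K'" if "e \<le> Suc k" for e
    using that
  proof (induction e)
    case 0
    then show ?case by (simp add: npow_ideal_def)
  next
    case (Suc e)
    then have "Y - V \<in> npow_ideal p d e K'" by simp
    from power_diff_linear[OF one(1,2) this, of p]
    have "Y ^ p - V ^ p - of_nat p * (Y - V) \<in> npow_ideal p d (Suc e) K" by (simp add: K')
    moreover have "Y ^ p - V ^ p \<in> npow_ideal p d (Suc e) K"
      using npow_ideal_add[OF eqR npow_ideal_mono[OF R_in, of "Suc e" K]] Suc by simp
    ultimately have "of_nat p * (Y - V) \<in> npow_ideal p d (Suc e) K"
      using npow_ideal_diff by fastforce
    then show ?case using npow_ideal_cancel_p p0 K' by blast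
  qed
  \<comment> \<open>The same division one degree beyond: there \<open>R\<close> agrees with
    \<open>Z ^ p - 1\<close>, and so with \<open>p * (Z - 1)\<close>.\<close>
  have "Y - V - (Z - 1) \<in> npow_ideal p d (Suc (Suc k)) K'"
  proof (rule npow_ideal_cancel_p)
    have 1: "Y ^ p - V ^ p - of_nat p * (Y - V) \<in> npow_ideal p d (Suc (Suc k)) K"
      using power_diff_linear[OF one(1,2) u_in[OF order_refl], of p] by (simp add: K')
    have 2: "Z ^ p - 1 - of_nat p * (Z - 1) \<in> npow_ideal p d (Suc (Suc k)) K"
      using power_diff_linear[of 1 Z p d "Suc k" K' p] one npow_ideal_mono[OF b_in, of "Suc k" K']
      by (simp add: K')
    have 3: "(V ^ p - 1) * (Z ^ p - 1) \<in> npow_ideal p d (Suc (Suc k)) K"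
      unfolding K' using one power_diff_in_npow_ideal[OF npow_ideal_mono[OF b_in, of "Suc k" K'], of p] K'
      by (intro npow_ideal_aug_mult_left) auto
    have "of_nat p * (Y - V - (Z - 1)) = (Y ^ p - V ^ p - R) + (V ^ p - 1) * (Z ^ p - 1)
        + (Z ^ p - 1 - of_nat p * (Z - 1)) - (Y ^ p - V ^ p - of_nat p * (Y - V))"
      by (simp add: R_def algebra_simps)
    then show "of_nat p * (Y - V - (Z - 1)) \<in> npow_ideal p d (Suc (Suc k)) (Suc K')"
      using 1 2 3 eqR K' by (metis npow_ideal_add npow_ideal_diff)
  qed (rule p0)
  \<comment> \<open>The bound \<open>k + 2 <= K'\<close> requires \<open>k >= 1\<close>; this holds
    because \<open>m = 0\<close> is impossible, every series being in
    \<open>nmod p d 0\<close>.\<close>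
  then have "Y - V - (Z - 1) \<in> nmod p d (Suc (Suc k))"
    using K K' m p0 V by (intro npow_ideal_subset_nmod[of "Suc (Suc k)" K']) (cases m; auto)+
  moreover have "Z - 1 - lie_word k \<in> nmod p d (Suc (Suc k))"
    using Z K by (intro npow_ideal_subset_nmod[of "Suc (Suc k)" K]) auto
  ultimately have "Y - V - lie_word k \<in> nmod p d (Suc (Suc k))"
    using nmod_add by fastforce
  define a u where "a = V - 1" and "u = Y - V"
  have u_lie: "u - lie_word k \<in> nmod p d (Suc (Suc k))" using \<open>Y - V - lie_word k \<in> _\<close> u_def by simp
  have u_mod: "u \<in> nmod p d (Suc k)"
    using npow_ideal_subset_nmod[OF _ _ u_in[OF order_refl]] K K' by (simp add: u_def)
  obtain w where w: "w \<in> lists {..<d}" "length w < m" "\<not> int p dvd ncoeff a w"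
    and a_mod: "a \<in> nmod p d (length w)"
    using lowest_term_exists V unfolding a_def by blast
  define s where "s = length w"
  have s0: "s > 0" using w one by (cases w) (auto simp: a_def s_def)
  \<comment> \<open>Modulo \<open>p\<close> the equation says that
    \<open>(a + u) ^ p - a ^ p\<close> agrees with \<open>R\<close>, and \<open>R\<close> is small
    because \<open>Z ^ p - 1\<close> agrees with \<open>(Z - 1) ^ p\<close>, of order at least
    \<open>p * (k + 1)\<close> with \<open>p >= 2\<close>.\<close>
  have 1: "(a + u) ^ p - a ^ p \<in> nmod p d (Suc k + Suc k)"
  proof -
    have y: "Y ^ p - 1 - (a + u) ^ p \<in> nmod p d (Suc k + Suc k)"
      using freshman_dream[OF p, of "a + u"] by (simp add: a_def u_def)
    have v: "V ^ p - 1 - a ^ p \<in> nmod p d (Suc k + Suc k)"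
      using freshman_dream[OF p, of a] by (simp add: a_def)
    have z1: "Z ^ p - 1 - (Z - 1) ^ p \<in> nmod p d (Suc k + Suc k)"
      using freshman_dream[OF p, of "Z - 1"] by simp
    have "(Z - 1) ^ p \<in> nmod p d (p * Suc k)"
      using K by (intro nmod_power npow_ideal_subset_nmod[OF _ _ b_in]) auto
    moreover have "Suc k + Suc k \<le> p * Suc k"
      using prime_ge_2_nat[OF p] mult_le_mono1[of 2 p "Suc k"] by simp
    ultimately have z2: "(Z - 1) ^ p \<in> nmod p d (Suc k + Suc k)" using nmod_mono by blast
    have r: "R \<in> nmod p d (Suc k + Suc k)"
      unfolding R_def using nmod_add[OF z1 z2] by (auto intro: nmod_mult_left)
    have q: "Y ^ p - V ^ p - R \<in> nmod p d (Suc k + Suc k)"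
      using K by (intro npow_ideal_subset_nmod[OF _ order_refl eqR]) simp
    have "(a + u) ^ p - a ^ p = (Y ^ p - V ^ p - R) + R - (Y ^ p - 1 - (a + u) ^ p) + (V ^ p - 1 - a ^ p)"
      by simp
    then show ?thesis using y v r q by (metis nmod_add nmod_diff)
  qed
  \<comment> \<open>Removing the terms at least quadratic in \<open>u\<close> leaves the linear
    part; its commutator with \<open>a\<close> is that of \<open>a ^ p\<close> with
    \<open>u\<close>.\<close>
  have "derivation_sum p a u \<in> nmod p d (Suc k + Suc k)"
    using nmod_diff[OF 1 power_add_expansion[OF u_mod, of a p]] by simp
  then have comm: "a ^ p * u - u * a ^ p \<in> nmod p d (Suc k + Suc k)"
    unfolding derivation_sum_commutator[symmetric]
    by (intro nmod_diff nmod_mult_left nmod_mult_right)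
  have "\<not> int p dvd ncoeff (a ^ p) (concat (replicate p w))"
    using ncoeff_power_lowest[OF a_mod w(1) refl p w(3)] .
  moreover have "concat (replicate p w) \<in> lists {..<d}" using w by auto
  moreover have "length (concat (replicate p w)) = p * s"
    by (simp add: length_concat sum_list_replicate s_def)
  \<comment> \<open>From \<open>s < m\<close> and \<open>p * m <= k\<close>, the lowest form of
    \<open>a ^ p\<close> has degree at most \<open>k\<close>, as
    \<open>lowest_form_not_commuting\<close> requires.\<close>
  moreover have "p * s \<le> k" using w(2) m by (metis mult_le_mono2 less_imp_le order_trans s_def)
  ultimately show False
    using lowest_form_not_commuting[OF _ _ _ _ _ d nmod_power[OF a_mod, folded s_def] u_mod u_lie p] comm s0 p0
    by (metis nat_0_less_mult_iff)
qed

text \<open>Modulo \<open>p\<close>, \<open>V ^ p - 1\<close> is \<open>(V - 1) ^ p\<close>, whose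
  lowest degree is \<open>p\<close> times that of \<open>V - 1\<close>. This yields torsion-freeness
  below.\<close>

lemma pth_power_nontrivial:
  assumes p: "prime p" and V: "V - 1 \<notin> nmod p d m"
  shows "V ^ p - 1 \<notin> nmod p d (p * m)"
proof -
  define a where "a = V - 1"
  obtain w where w: "w \<in> lists {..<d}" "length w < m" "\<not> int p dvd ncoeff a w"
    and a_mod: "a \<in> nmod p d (length w)"
    using lowest_term_exists V unfolding a_def by blast
  let ?v = "concat (replicate p w)"
  have p0: "p > 0" using p prime_gt_0_nat by blast
  have v: "?v \<in> lists {..<d}" "length ?v < p * m"
    using w p0 by (auto simp: length_concat sum_list_replicate)
  have 1: "\<not> int p dvd ncoeff (a ^ p) ?v"
    using ncoeff_power_lowest[OF a_mod w(1) refl p w(3)] .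
  have "V ^ p - 1 - a ^ p \<in> nmod p d (p * m)"
    using freshman_dream[OF p, of a] by (simp add: a_def)
  from nmodD[OF this v] have 2: "int p dvd ncoeff (V ^ p - 1) ?v - ncoeff (a ^ p) ?v" by simp
  show ?thesis
  proof
    assume "V ^ p - 1 \<in> nmod p d (p * m)"
    from nmodD[OF this v] show False using 1 2 by (metis dvd_diff_right_iff)
  qed
qed

section \<open>Open normal subgroups and the universal property\<close>

text \<open>In a compact Hausdorff space components and quasi-components coincide, and total
  disconnectedness makes them points.\<close>

lemma totally_disconnected_clopen_separation:
  assumes "compact_space X" "Hausdorff_space X" "totally_disconnected_top X"
    and "a \<in> topspace X" "b \<in> topspace X" "a \<noteq> b"
  obtains U where "closedin X U" "openin X U" "a \<in> U" "b \<notin> U"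
proof -
  have "quasi_component_of X a = connected_component_of X a"
    using assms by (intro quasi_eq_connected_component_of) auto
  moreover have "\<not> connected_component_of X a b"
  proof
    assume "connected_component_of X a b"
    then obtain S where "connectedin X S" "a \<in> S" "b \<in> S" by (auto simp: connected_component_of_def)
    then show False using assms(3,6) unfolding totally_disconnected_top_def by blast
  qed
  ultimately have "\<not> quasi_component_of X a b" by simp
  then show ?thesis
    using assms(4,5) that unfolding quasi_component_of by blast
qed

text \<open>\<open>{g. \<forall>a b. a g b \<in> U \<longleftrightarrow> a b \<in> U}\<close> is the largest normal subgroup \<open>N\<close> such that \<open>U\<close> is a union of
  cosets of \<open>N\<close>. For clopen \<open>U\<close> it is open since its complement is the image of a closed set under
  the projection along a compact factor.\<close>
lemma pro_p_group_separation:
  fixes G (structure)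
  assumes "pro_p_group p G T" "v \<in> carrier G" "v \<noteq> \<one>"
  obtains N where "N \<lhd> G" "openin T N" "v \<notin> N"
proof -
  have top: "topological_group G T" and cpt: "compact_space T" and T2: "Hausdorff_space T"
    and td: "totally_disconnected_top T"
    using assms(1) by (auto simp: pro_p_group_def)
  interpret group G using top by (simp add: topological_group_def)
  have ts: "topspace T = carrier G" using top by (simp add: topological_group_def)
  obtain U where U: "closedin T U" "openin T U" "\<one> \<in> U" "v \<notin> U"
    using totally_disconnected_clopen_separation[OF cpt T2 td, of \<one> v] assms(2,3) ts by auto
  define N where "N = {g \<in> carrier G. \<forall>a\<in>carrier G. \<forall>b\<in>carrier G. a \<otimes> g \<otimes> b \<in> U \<longleftrightarrow> a \<otimes> b \<in> U}"
  have sub: "subgroup N G"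
  proof (rule subgroupI)
    show "N \<subseteq> carrier G" "N \<noteq> {}" by (auto simp: N_def)
  next
    fix g assume g: "g \<in> N"
    have "a \<otimes> inv g \<otimes> b \<in> U \<longleftrightarrow> a \<otimes> b \<in> U" if "a \<in> carrier G" "b \<in> carrier G" for a b
    proof -
      have gc: "g \<in> carrier G" using g by (simp add: N_def)
      \<comment> \<open>Invariance under \<open>g\<close> is applied with
        \<open>a \<otimes> inv g\<close> in place of \<open>a\<close>.\<close>
      have "a \<otimes> inv g \<otimes> g \<otimes> b \<in> U \<longleftrightarrow> a \<otimes> inv g \<otimes> b \<in> U"
        using g that gc unfolding N_def by auto
      then show ?thesis using gc that by (simp add: m_assoc)
    qed
    then show "inv g \<in> N" using g by (simp add: N_def)
  next
    fix g h assume g: "g \<in> N" and h: "h \<in> N"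
    have gc: "g \<in> carrier G" "h \<in> carrier G" using g h by (simp_all add: N_def)
    have "a \<otimes> (g \<otimes> h) \<otimes> b \<in> U \<longleftrightarrow> a \<otimes> b \<in> U" if "a \<in> carrier G" "b \<in> carrier G" for a b
    proof -
      have "a \<otimes> g \<otimes> (h \<otimes> b) \<in> U \<longleftrightarrow> a \<otimes> (h \<otimes> b) \<in> U" using g gc that by (simp add: N_def)
      moreover have "a \<otimes> h \<otimes> b \<in> U \<longleftrightarrow> a \<otimes> b \<in> U" using h that by (simp add: N_def)
      ultimately show ?thesis using gc that by (simp add: m_assoc)
    qed
    then show "g \<otimes> h \<in> N" using gc by (simp add: N_def)
  qed
  have "c \<otimes> g \<otimes> inv c \<in> N" if c: "c \<in> carrier G" and g: "g \<in> N" for c g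
  proof -
    have gc: "g \<in> carrier G" using g by (simp add: N_def)
    have "a \<otimes> (c \<otimes> g \<otimes> inv c) \<otimes> b \<in> U \<longleftrightarrow> a \<otimes> b \<in> U" if "a \<in> carrier G" "b \<in> carrier G" for a b
    proof -
      have "(a \<otimes> c) \<otimes> g \<otimes> (inv c \<otimes> b) \<in> U \<longleftrightarrow> (a \<otimes> c) \<otimes> (inv c \<otimes> b) \<in> U"
        using g c that by (simp add: N_def)
      moreover have "(a \<otimes> c) \<otimes> (inv c \<otimes> b) = a \<otimes> b"
        using c that by (simp add: m_assoc inv_solve_left' m_assoc[symmetric])
      moreover have "(a \<otimes> c) \<otimes> g \<otimes> (inv c \<otimes> b) = a \<otimes> (c \<otimes> g \<otimes> inv c) \<otimes> b"
        using c gc that by (simp add: m_assoc)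
      ultimately show ?thesis by simp
    qed
    then show ?thesis using c gc by (simp add: N_def)
  qed
  then have normal: "N \<lhd> G" using sub by (simp add: normal_inv_iff)
  have "openin T N"
  proof -
    let ?X = "prod_topology (prod_topology T T) T"
    let ?f = "\<lambda>z. fst (fst z) \<otimes> snd z \<otimes> snd (fst z)" and ?g = "\<lambda>z. fst (fst z) \<otimes> snd (fst z)"
    have c: "continuous_map ?X T (\<lambda>z. fst (fst z))" "continuous_map ?X T (\<lambda>z. snd (fst z))" "continuous_map ?X T snd"
      using continuous_map_fst_of[OF continuous_map_fst] continuous_map_snd_of[OF continuous_map_fst]
      by (simp_all add: o_def continuous_map_snd)
    have mult: "continuous_map ?X T (\<lambda>z. f z \<otimes> g z)"
      if "continuous_map ?X T f" "continuous_map ?X T g" for f g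
    proof -
      have "continuous_map (prod_topology T T) T (\<lambda>(x, y). x \<otimes>\<^bsub>G\<^esub> y)"
        using top by (simp add: topological_group_def)
      moreover have "continuous_map ?X (prod_topology T T) (\<lambda>z. (f z, g z))"
        using that by (simp add: continuous_map_pairwise o_def)
      ultimately have "continuous_map ?X T ((\<lambda>(x, y). x \<otimes>\<^bsub>G\<^esub> y) \<circ> (\<lambda>z. (f z, g z)))"
        using continuous_map_compose by blast
      then show ?thesis by (simp add: o_def)
    qed
    have f: "continuous_map ?X T ?f" and g: "continuous_map ?X T ?g"
      by (intro mult c)+
    let ?V = "topspace T - U"
    have V: "closedin T ?V" using U by blast
    \<comment> \<open>\<open>B\<close> collects the triples \<open>((a, b), g)\<close> on which
      \<open>g\<close> violates the condition that defines \<open>N\<close>.\<close>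
    define B where "B = ({z \<in> topspace ?X. ?f z \<in> U} \<inter> {z \<in> topspace ?X. ?g z \<in> ?V}) \<union>
       ({z \<in> topspace ?X. ?f z \<in> ?V} \<inter> {z \<in> topspace ?X. ?g z \<in> U})"
    have "closedin ?X B"
      unfolding B_def
      using closedin_continuous_map_preimage[OF f U(1)] closedin_continuous_map_preimage[OF f V]
        closedin_continuous_map_preimage[OF g U(1)] closedin_continuous_map_preimage[OF g V]
      by (intro closedin_Un closedin_Int) auto
    moreover have "closed_map ?X T snd"
      using cpt by (intro closed_map_snd) (simp add: compact_space_prod_topology)
    ultimately have "closedin T (snd ` B)" by (simp add: closed_map_def)
    moreover have "N = topspace T - snd ` B"
    proof (intro equalityI subsetI)
      fix g assume "g \<in> N"
      then show "g \<in> topspace T - snd ` B" by (auto simp: N_def B_def ts)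
    next
      fix g assume g: "g \<in> topspace T - snd ` B"
      have "a \<otimes> g \<otimes> b \<in> U \<longleftrightarrow> a \<otimes> b \<in> U" if "a \<in> carrier G" "b \<in> carrier G" for a b
      proof -
        have "((a, b), g) \<notin> B" using g by force
        then show ?thesis using that g ts by (auto simp: B_def)
      qed
      then show "g \<in> N" using g ts by (simp add: N_def)
    qed
    ultimately show ?thesis by blast
  qed
  moreover have "v \<notin> N"
  proof
    assume "v \<in> N"
    then have "\<one> \<otimes> v \<otimes> \<one> \<in> U \<longleftrightarrow> \<one> \<otimes> \<one> \<in> U" unfolding N_def by blast
    then show False using U assms(2) by simp
  qed
  ultimately show ?thesis using normal that by blast
qed

section \<open>The universal property for finite p-groups of arbitrary type\<close>

definition finite_p_group :: "nat \<Rightarrow> ('b, 'm) monoid_scheme \<Rightarrow> bool" where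
  "finite_p_group p H \<longleftrightarrow> group H \<and> finite (carrier H) \<and> (\<exists>k. card (carrier H) = p ^ k)"

text \<open>Continuity into a discrete group, expressed by open fibres as in
  \<open>free_pro_p_group\<close>, but for a target of any type.\<close>

definition open_hom :: "('a, 'm) monoid_scheme \<Rightarrow> 'a topology \<Rightarrow> ('b, 'c) monoid_scheme \<Rightarrow> ('a \<Rightarrow> 'b) \<Rightarrow> bool" where
  "open_hom G T H f \<longleftrightarrow> f \<in> hom G H \<and> (\<forall>h\<in>carrier H. openin T {g \<in> carrier G. f g = h})"

text \<open>The universal property speaks of groups carried by natural numbers; this copy transports
  it to the Magnus groups and the other targets below.\<close>

lemma finite_p_group_nat_copy:
  assumes "finite_p_group p H"
  obtains e and H' :: "nat monoid" where "finite_p_group p H'" "e \<in> iso H H'"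
proof -
  interpret group H using assms by (simp add: finite_p_group_def)
  obtain e :: "'a \<Rightarrow> nat" where e: "inj_on e (carrier H)"
    using finite_imp_inj_to_nat_seg[of "carrier H"] assms by (auto simp: finite_p_group_def)
  define H' where "H' = image_group e H"
  have iso: "e \<in> iso H H'" unfolding H'_def by (rule inj_imp_image_group_iso[OF e])
  have "group H'" unfolding H'_def by (rule inj_imp_image_group_is_group[OF e])
  moreover have "carrier H' = e ` carrier H" by (simp add: H'_def image_group_carrier)
  ultimately have "finite_p_group p H'"
    using assms e by (auto simp: finite_p_group_def card_image)
  then show ?thesis using iso that by blast
qed

text \<open>Every homomorphism out of a discrete group is continuous: fibres of the composite are
  unions of fibres of \<open>f\<close>.\<close>

lemma open_hom_compose:
  assumes "open_hom G T H f" "finite (carrier H)" "h \<in> hom H L" "topspace T = carrier G"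
  shows "open_hom G T L (\<lambda>x. h (f x))"
proof -
  have "openin T {g \<in> carrier G. h (f g) = l}" for l
  proof -
    have "{g \<in> carrier G. h (f g) = l} = (\<Union>k\<in>{k \<in> carrier H. h k = l}. {g \<in> carrier G. f g = k})"
      using assms(1) by (auto simp: open_hom_def hom_def)
    then show ?thesis using assms(1) by (auto simp: open_hom_def)
  qed
  then show ?thesis
    using assms by (auto simp: open_hom_def hom_def Pi_def)
qed

lemma free_pro_p_groupD:
  assumes "free_pro_p_group p d F T x"
  shows "pro_p_group p F T" "group F" "topspace T = carrier F" "\<And>i. i < d \<Longrightarrow> x i \<in> carrier F"
  using assms[unfolded free_pro_p_group_def, THEN conjunct1]
    assms[unfolded free_pro_p_group_def, THEN conjunct2, THEN conjunct1]
  by (simp_all add: pro_p_group_def topological_group_def)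

lemma free_pro_p_universal:
  fixes H :: "nat monoid"
  assumes F: "free_pro_p_group p d F T x" and H: "finite_p_group p H"
    and y: "\<forall>i<d. y i \<in> carrier H"
  shows "\<exists>!f. f \<in> hom F H \<and> f \<in> extensional (carrier F) \<and>
    (\<forall>h\<in>carrier H. openin T {g \<in> carrier F. f g = h}) \<and> (\<forall>i<d. f (x i) = y i)"
proof -
  note univ = F[unfolded free_pro_p_group_def, THEN conjunct2, THEN conjunct2]
  show ?thesis
    by (rule univ[THEN spec, THEN spec, THEN mp]) (use H y in \<open>simp add: finite_p_group_def\<close>)
qed

lemma free_pro_p_ex:
  assumes F: "free_pro_p_group p d F T x" and H: "finite_p_group p H"
    and y: "\<And>i. i < d \<Longrightarrow> y i \<in> carrier H"
  obtains f where "open_hom F T H f" "\<And>i. i < d \<Longrightarrow> f (x i) = y i"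
proof -
  interpret H: group H using H by (simp add: finite_p_group_def)
  obtain e and H' :: "nat monoid" where H': "finite_p_group p H'" and e: "e \<in> iso H H'"
    by (rule finite_p_group_nat_copy[OF H])
  note ts = free_pro_p_groupD(3)[OF F] and xc = free_pro_p_groupD(4)[OF F]
  have "\<forall>i<d. e (y i) \<in> carrier H'" using y e by (auto simp: iso_def hom_def)
  then have "\<exists>f. f \<in> hom F H' \<and> f \<in> extensional (carrier F) \<and>
              (\<forall>h\<in>carrier H'. openin T {g \<in> carrier F. f g = h}) \<and> (\<forall>i<d. f (x i) = e (y i))"
    by (intro ex1_implies_ex free_pro_p_universal[OF F H'])
  then obtain f where f: "open_hom F T H' f" "\<forall>i<d. f (x i) = e (y i)"
    by (auto simp: open_hom_def)
  have inv: "inv_into (carrier H) e \<in> iso H' H" using H.iso_set_sym[OF e] .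
  show ?thesis
  proof (rule that)
    show "open_hom F T H (\<lambda>g. inv_into (carrier H) e (f g))"
      by (rule open_hom_compose[where H = H']) (use f(1) H' inv ts in \<open>auto simp: finite_p_group_def iso_def\<close>)
    show "inv_into (carrier H) e (f (x i)) = y i" if "i < d" for i
      using f that y e by (simp add: iso_def bij_betw_def)
  qed
qed

lemma free_pro_p_unique:
  assumes F: "free_pro_p_group p d F T x" and H: "finite_p_group p H"
    and f: "open_hom F T H f" and g: "open_hom F T H g" and eq: "\<And>i. i < d \<Longrightarrow> f (x i) = g (x i)"
    and a: "a \<in> carrier F"
  shows "f a = g a"
proof -
  interpret H: group H using H by (simp add: finite_p_group_def)
  obtain e and H' :: "nat monoid" where H': "finite_p_group p H'" and e: "e \<in> iso H H'"
    by (rule finite_p_group_nat_copy[OF H])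
  note ts = free_pro_p_groupD(3)[OF F] and xc = free_pro_p_groupD(4)[OF F]
  interpret F: group F using free_pro_p_groupD(2)[OF F] .
  \<comment> \<open>Uniqueness holds among extensional functions, hence the restriction.\<close>
  define r where "r k = restrict (\<lambda>z. e (k z)) (carrier F)" for k
  have r: "r k \<in> hom F H' \<and> r k \<in> extensional (carrier F) \<and>
              (\<forall>h\<in>carrier H'. openin T {g \<in> carrier F. r k g = h})" if "open_hom F T H k" for k
  proof -
    have "open_hom F T H' (\<lambda>z. e (k z))"
      by (rule open_hom_compose[where H = H]) (use that H e ts in \<open>auto simp: finite_p_group_def iso_def\<close>)
    moreover have "{g \<in> carrier F. r k g = h} = {g \<in> carrier F. e (k g) = h}" for h by (auto simp: r_def)
    ultimately show ?thesis by (auto simp: open_hom_def r_def hom_def Pi_def)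
  qed
  have "\<forall>i<d. e (f (x i)) \<in> carrier H'"
    using f e xc by (auto simp: open_hom_def iso_def hom_def Pi_def)
  then have "\<exists>!k. k \<in> hom F H' \<and> k \<in> extensional (carrier F) \<and>
              (\<forall>h\<in>carrier H'. openin T {g \<in> carrier F. k g = h}) \<and> (\<forall>i<d. k (x i) = e (f (x i)))"
    by (rule free_pro_p_universal[OF F H'])
  moreover have "\<forall>i<d. r f (x i) = e (f (x i))" "\<forall>i<d. r g (x i) = e (f (x i))"
    using xc eq by (auto simp: r_def)
  ultimately have "r f = r g" using r[OF f] r[OF g] by blast
  then have "e (f a) = e (g a)" using a by (metis r_def restrict_apply')
  moreover have "f a \<in> carrier H" "g a \<in> carrier H" using f g a by (auto simp: open_hom_def hom_def)
  ultimately show ?thesis using e by (auto simp: iso_def bij_betw_def inj_on_def)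
qed

text \<open>This takes the place of topological generation by the \<open>x i\<close>: the universal
  property for the \<open>p\<close>-group \<open>B\<close> gives a map into \<open>B\<close>, which
  agrees with \<open>f\<close> by uniqueness in \<open>H\<close>.\<close>

lemma free_pro_p_image_in_subgroup:
  assumes F: "free_pro_p_group p d F T x" and p: "prime p" and H: "finite_p_group p H"
    and f: "open_hom F T H f" and B: "subgroup B H" and gen: "\<And>i. i < d \<Longrightarrow> f (x i) \<in> B"
    and a: "a \<in> carrier F"
  shows "f a \<in> B"
proof -
  interpret H: group H using H by (simp add: finite_p_group_def)
  note ts = free_pro_p_groupD(3)[OF F]
  have fin: "finite (carrier H)" using H by (simp add: finite_p_group_def)
  have "card (rcosets\<^bsub>H\<^esub> B) * card B = order H" using H.lagrange[OF B] .
  moreover obtain k where "order H = p ^ k" using H by (auto simp: finite_p_group_def order_def)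
  ultimately have "card B dvd p ^ k" by (metis dvd_triv_right)
  then obtain j where "card B = p ^ j" using p by (auto simp: divides_primepow_nat)
  then have HB: "finite_p_group p (H\<lparr>carrier := B\<rparr>)"
    using B fin H.subgroup_imp_group[OF B] finite_subset[OF subgroup.subset[OF B] fin]
    by (auto simp: finite_p_group_def)
  obtain g where g: "open_hom F T (H\<lparr>carrier := B\<rparr>) g" "\<And>i. i < d \<Longrightarrow> g (x i) = f (x i)"
    using free_pro_p_ex[OF F HB, of "\<lambda>i. f (x i)"] gen by auto
  have "open_hom F T H (\<lambda>z. id (g z))"
    by (rule open_hom_compose[where H = "H\<lparr>carrier := B\<rparr>"])
      (use g(1) HB ts subgroup.subset[OF B] in \<open>auto simp: finite_p_group_def hom_def\<close>)
  then have "f a = g a"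
    using free_pro_p_unique[OF F H f, of g a] g(2) a by simp
  then show ?thesis using g(1) a by (auto simp: open_hom_def hom_def)
qed

section \<open>Nilpotency of the augmentation ideal of a finite p-group\<close>

text \<open>Counting by orbits: their sizes are powers of \<open>p\<close>, so if \<open>x0\<close>
  were the only fixed point, \<open>card E\<close> would be 1 modulo \<open>p\<close>.\<close>

lemma p_group_second_fixed_point:
  assumes act: "group_action H E \<phi>" and fin: "finite E" and p: "prime p" and ord: "order H = p ^ k"
    and pE: "p dvd card E" and x0: "x0 \<in> E" "\<And>g. g \<in> carrier H \<Longrightarrow> \<phi> g x0 = x0"
  obtains y where "y \<in> E" "y \<noteq> x0" "\<And>g. g \<in> carrier H \<Longrightarrow> \<phi> g y = y"
proof (rule ccontr)
  assume contra: "\<not> thesis"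
  interpret group_action H E \<phi> by fact
  interpret H: group H using group_hom group_hom.axioms(1) by blast
  let ?O = "orbits H E \<phi>"
  have part: "partition E ?O" by (rule orbit_partition)
  have "?O = orbit H \<phi> ` E" by (auto simp: orbits_def)
  then have finO: "finite ?O" using fin by simp
  have orb0: "orbit H \<phi> x0 = {x0}"
    using x0 H.one_closed unfolding orbit_def by (auto intro: exI[of _ "\<one>\<^bsub>H\<^esub>"])
  have in0: "{x0} \<in> ?O" using x0(1) orb0 unfolding orbits_def by blast
  have "card E = (\<Sum>b\<in>?O. card b)"
    using disjoint_sum[OF fin, of "\<lambda>_. 1 :: nat"] by simp
  also have "\<dots> = 1 + (\<Sum>b\<in>?O - {{x0}}. card b)"
    using finO in0 by (simp add: sum.remove)
  finally have card_eq: "card E = 1 + (\<Sum>b\<in>?O - {{x0}}. card b)" .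
  have "p dvd (\<Sum>b\<in>?O - {{x0}}. card b)"
  proof (rule dvd_sum)
    fix b assume b: "b \<in> ?O - {{x0}}"
    then obtain y where y: "y \<in> E" "b = orbit H \<phi> y" by (auto simp: orbits_def)
    have "card b dvd p ^ k" using orbit_stabilizer_theorem[OF y(1)] y(2) ord by (metis dvd_triv_left)
    then obtain j where j: "card b = p ^ j" using p by (auto simp: divides_primepow_nat)
    have "j \<noteq> 0"
    proof
      assume "j = 0"
      then obtain c where "b = {c}" using j by (auto simp: card_1_singleton_iff)
      then have by': "b = {y}" using orbit_refl[OF y(1)] y(2) by auto
      then have "\<phi> g y = y" if "g \<in> carrier H" for g
        using that y(2) unfolding orbit_def by blast
      moreover have "y \<noteq> x0" using b by' by auto
      ultimately show False using contra that y(1) by blast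
    qed
    then show "p dvd card b" using j by (simp add: dvd_power)
  qed
  then have "p dvd 1" using pE card_eq by (metis dvd_add_left_iff)
  then show False using p by (simp add: prime_nat_iff)
qed

text \<open>\<open>H\<close> permutes the right cosets of \<open>W\<close>, whose number is a power
  of \<open>p\<close> other than 1, and fixes \<open>W\<close> itself. A second fixed coset is
  represented by the element sought.\<close>

lemma p_group_fixed_coset:
  fixes A (structure) and H :: "('h, 'n) monoid_scheme"
  assumes A: "finite_p_group p A" and H: "finite_p_group p H" and p: "prime p"
    and W: "subgroup W A" "W \<noteq> carrier A"
    and hom: "\<And>g. g \<in> carrier H \<Longrightarrow> act g \<in> hom A A"
    and mult: "\<And>g h a. g \<in> carrier H \<Longrightarrow> h \<in> carrier H \<Longrightarrow> a \<in> carrier A \<Longrightarrow> act (g \<otimes>\<^bsub>H\<^esub> h) a = act g (act h a)"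
    and one: "\<And>a. a \<in> carrier A \<Longrightarrow> act \<one>\<^bsub>H\<^esub> a = a"
    and inv_W: "\<And>g a. g \<in> carrier H \<Longrightarrow> a \<in> W \<Longrightarrow> act g a \<in> W"
  obtains a where "a \<in> carrier A" "a \<notin> W" "\<And>g. g \<in> carrier H \<Longrightarrow> act g a \<otimes> inv a \<in> W"
proof -
  interpret A: group A using A by (simp add: finite_p_group_def)
  interpret H: group H using H by (simp add: finite_p_group_def)
  interpret W: subgroup W A by fact
  have closed: "act g a \<in> carrier A" if "g \<in> carrier H" "a \<in> carrier A" for g a
    using hom that by (auto simp: hom_def)
  have inv1: "act g (act (inv\<^bsub>H\<^esub> g) a) = a" "act (inv\<^bsub>H\<^esub> g) (act g a) = a"
    if "g \<in> carrier H" "a \<in> carrier A" for g a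
    using mult[of g "inv\<^bsub>H\<^esub> g" a] mult[of "inv\<^bsub>H\<^esub> g" g a] one that by simp_all
  define E where "E = rcosets W"
  have coset: "act g ` (W #> a) = W #> act g a" if g: "g \<in> carrier H" and a: "a \<in> carrier A" for g a
  proof (intro equalityI subsetI)
    fix b assume "b \<in> act g ` (W #> a)"
    then obtain c where "c \<in> W" "b = act g (c \<otimes> a)" by (auto simp: r_coset_def)
    then show "b \<in> W #> act g a"
      using hom_mult[OF hom[OF g]] a inv_W[OF g] W.mem_carrier by (auto simp: r_coset_def)
  next
    fix b assume "b \<in> W #> act g a"
    then obtain c where c: "c \<in> W" "b = c \<otimes> act g a" by (auto simp: r_coset_def)
    let ?c = "act (inv\<^bsub>H\<^esub> g) c"
    have "?c \<in> W" using inv_W c g by simp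
    moreover have "act g (?c \<otimes> a) = b"
      using hom_mult[OF hom[OF g], of ?c a] closed[of "inv\<^bsub>H\<^esub> g" c] c g a inv1 W.mem_carrier by simp
    ultimately show "b \<in> act g ` (W #> a)" by (auto simp: r_coset_def)
  qed
  \<comment> \<open>Restricted to \<open>E\<close>, as \<open>Bij E\<close> consists of extensional
    functions.\<close>
  define \<phi> where "\<phi> g = (\<lambda>C\<in>E. act g ` C)" for g
  have E_sub: "C \<subseteq> carrier A" if "C \<in> E" for C
    using that W.subset A.r_coset_subset_G by (auto simp: E_def RCOSETS_def)
  have \<phi>E: "\<phi> g C \<in> E" if "g \<in> carrier H" "C \<in> E" for g C
    using that coset closed by (fastforce simp: E_def \<phi>_def RCOSETS_def)
  have comp: "\<phi> (g \<otimes>\<^bsub>H\<^esub> h) C = \<phi> g (\<phi> h C)" if "g \<in> carrier H" "h \<in> carrier H" "C \<in> E" for g h C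
  proof -
    have "act (g \<otimes>\<^bsub>H\<^esub> h) ` C = act g ` act h ` C"
      unfolding image_image using E_sub[OF that(3)] mult that by (intro image_cong) auto
    then show ?thesis using that \<phi>E[OF that(2,3)] by (simp add: \<phi>_def)
  qed
  have unit: "\<phi> \<one>\<^bsub>H\<^esub> C = C" if "C \<in> E" for C
    using E_sub[OF that] one that by (force simp: \<phi>_def)
  have bij: "\<phi> g \<in> Bij E" if g: "g \<in> carrier H" for g
  proof -
    have "\<phi> g (\<phi> (inv\<^bsub>H\<^esub> g) C) = C" "\<phi> (inv\<^bsub>H\<^esub> g) (\<phi> g C) = C" if "C \<in> E" for C
      using comp[of g "inv\<^bsub>H\<^esub> g" C] comp[of "inv\<^bsub>H\<^esub> g" g C] unit that g by simp_all
    then have "bij_betw (\<phi> g) E E"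
      using \<phi>E g by (intro bij_betw_byWitness[where f' = "\<phi> (inv\<^bsub>H\<^esub> g)"]) auto
    then show ?thesis by (auto simp: Bij_def \<phi>_def)
  qed
  have "\<phi> \<in> hom H (BijGroup E)"
  proof (rule homI)
    fix g h assume gh: "g \<in> carrier H" "h \<in> carrier H"
    have "\<phi> (g \<otimes>\<^bsub>H\<^esub> h) = compose E (\<phi> g) (\<phi> h)"
    proof
      fix C show "\<phi> (g \<otimes>\<^bsub>H\<^esub> h) C = compose E (\<phi> g) (\<phi> h) C"
        using comp[OF gh] by (cases "C \<in> E") (auto simp: compose_def \<phi>_def)
    qed
    then show "\<phi> (g \<otimes>\<^bsub>H\<^esub> h) = \<phi> g \<otimes>\<^bsub>BijGroup E\<^esub> \<phi> h" using bij gh by (simp add: BijGroup_def)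
  qed (simp add: BijGroup_def bij)
  then have act: "group_action H E \<phi>"
    by (simp add: group_action_def group_hom_def group_hom_axioms_def group_BijGroup H.group_axioms)
  have fin: "finite (carrier A)" using A by (simp add: finite_p_group_def)
  then have finE: "finite E" unfolding E_def RCOSETS_def by auto
  have lag: "card E * card W = order A" unfolding E_def using A.lagrange[OF W(1)] .
  obtain r where r: "order A = p ^ r" using A by (auto simp: finite_p_group_def order_def)
  have "card E dvd p ^ r" using lag r by (metis dvd_triv_left)
  then obtain j where j: "card E = p ^ j" using p by (auto simp: divides_primepow_nat)
  have "j \<noteq> 0"
  proof
    assume "j = 0"
    then have "card W = card (carrier A)" using lag j by (simp add: order_def)
    then show False using W fin W.subset by (metis card_subset_eq)
  qed
  then have pE: "p dvd card E" using j by (simp add: dvd_power)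
  have Wone: "W #> \<one> = W" using A.coset_mult_one[OF W.subset] .
  have WE: "W \<in> E" unfolding E_def using A.rcosetsI[OF W.subset A.one_closed] Wone by simp
  have Wfix: "\<phi> g W = W" if "g \<in> carrier H" for g
  proof -
    have "act g \<one> = \<one>"
      using hom[OF that] A.group_axioms by (simp add: hom_one)
    then show ?thesis using coset[OF that A.one_closed] Wone WE by (simp add: \<phi>_def)
  qed
  obtain k where k: "order H = p ^ k" using H by (auto simp: finite_p_group_def order_def)
  obtain C where C: "C \<in> E" "C \<noteq> W" "\<And>g. g \<in> carrier H \<Longrightarrow> \<phi> g C = C"
    using p_group_second_fixed_point[OF act finE p k pE WE Wfix] by blast
  then obtain a where a: "a \<in> carrier A" "C = W #> a" by (auto simp: E_def RCOSETS_def)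
  show ?thesis
  proof (rule that[OF a(1)])
    show "a \<notin> W" using C(2) a(2) A.coset_join2[OF a(1) W(1)] by auto
    fix g assume g: "g \<in> carrier H"
    have "W #> act g a = W #> a" using C(3)[OF g] C(1) a coset[OF g a(1)] by (simp add: \<phi>_def)
    then have "act g a \<in> W #> a" using A.rcos_self[OF closed[OF g a(1)] W(1)] by simp
    then show "act g a \<otimes> inv a \<in> W"
      using a(1) W.mem_carrier by (auto simp: r_coset_def A.m_assoc)
  qed
qed

text \<open>For the action on functions by right translation, under which \<open>g\<close> sends
  \<open>\<xi>\<close> to the function \<open>\<xi> (h g)\<close> of \<open>h\<close>, this is the
  operator \<open>g - 1\<close>. Composites of such operators are written \<open>rdiffs\<close>,
  with the head of the list outermost.\<close>

definition rdiff :: "('h, 'n) monoid_scheme \<Rightarrow> 'h \<Rightarrow> ('h \<Rightarrow> int) \<Rightarrow> 'h \<Rightarrow> int" where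
  "rdiff H g \<xi> = (\<lambda>h. \<xi> (h \<otimes>\<^bsub>H\<^esub> g) - \<xi> h)"

abbreviation rdiffs :: "('h, 'n) monoid_scheme \<Rightarrow> 'h list \<Rightarrow> ('h \<Rightarrow> int) \<Rightarrow> 'h \<Rightarrow> int" where
  "rdiffs H ws \<xi> \<equiv> foldr (rdiff H) ws \<xi>"

lemma rdiffs_add: "rdiffs H ws (\<lambda>h. \<xi> h + \<eta> h) = (\<lambda>h. rdiffs H ws \<xi> h + rdiffs H ws \<eta> h)"
  by (induction ws) (simp_all add: rdiff_def fun_eq_iff)

lemma rdiffs_minus: "rdiffs H ws (\<lambda>h. - \<xi> h) = (\<lambda>h. - rdiffs H ws \<xi> h)"
  by (induction ws) (simp_all add: rdiff_def fun_eq_iff)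

context group
begin

lemma rdiffs_dvd:
  assumes "\<forall>h\<in>carrier G. p dvd \<xi> h" "set ws \<subseteq> carrier G"
  shows "\<forall>h\<in>carrier G. p dvd rdiffs G ws \<xi> h"
  using assms by (induction ws) (auto simp: rdiff_def)

lemma rdiffs_cong_mod:
  assumes "\<forall>h\<in>carrier G. \<xi> h mod p = \<eta> h mod p" "set ws \<subseteq> carrier G"
  shows "\<forall>h\<in>carrier G. rdiffs G ws \<xi> h mod p = rdiffs G ws \<eta> h mod p"
  using assms
proof (induction ws)
  case (Cons a ws)
  then show ?case by (auto simp: rdiff_def intro!: mod_diff_cong)
qed simp

text \<open>The augmentation ideal over the field with \<open>p\<close> elements is nilpotent. Let
  \<open>W j\<close> consist of the functions modulo \<open>p\<close> killed by all products of
  \<open>j\<close> operators \<open>g - 1\<close>. While \<open>W j\<close> is proper, a further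
  fixed coset of it gives a function in \<open>W (Suc j)\<close> outside \<open>W j\<close>, so the
  chain grows until it fills the finite group of all functions.\<close>

lemma rdiffs_nilpotent:
  assumes G: "finite_p_group p G" and p: "prime p"
  obtains m where "\<And>ws \<xi> h. set ws \<subseteq> carrier G \<Longrightarrow> length ws \<ge> m \<Longrightarrow> h \<in> carrier G \<Longrightarrow> int p dvd rdiffs G ws \<xi> h"
proof -
  have p0: "p > 0" using p prime_gt_0_nat by blast
  have fin: "finite (carrier G)" using G by (simp add: finite_p_group_def)
  \<comment> \<open>Functions modulo \<open>p\<close> are represented by their least nonnegative
    residues, as extensional functions.\<close>
  define red :: "('a \<Rightarrow> int) \<Rightarrow> 'a \<Rightarrow> int" where "red \<xi> = (\<lambda>h\<in>carrier G. \<xi> h mod int p)" for \<xi>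
  define A where "A = \<lparr>carrier = carrier G \<rightarrow>\<^sub>E {0..<int p}, monoid.mult = (\<lambda>\<xi> \<eta>. red (\<lambda>h. \<xi> h + \<eta> h)), one = red (\<lambda>_. 0)\<rparr>"
  have red_in: "red \<xi> \<in> carrier A" for \<xi> using p0 by (auto simp: red_def A_def)
  have red_id: "red \<xi> = \<xi>" if "\<xi> \<in> carrier A" for \<xi>
    using that by (auto simp: red_def A_def PiE_def Pi_def extensional_def fun_eq_iff)
  have red_eq: "red \<xi> = red \<eta>" if "\<forall>h\<in>carrier G. \<xi> h mod int p = \<eta> h mod int p" for \<xi> \<eta>
    using that by (auto simp: red_def fun_eq_iff)
  have red_mod: "red \<xi> h mod int p = \<xi> h mod int p" if "h \<in> carrier G" for \<xi> h
    using that by (simp add: red_def)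
  have grpA: "group A"
  proof (rule groupI)
    fix \<xi> \<eta> \<zeta>
    show "\<one>\<^bsub>A\<^esub> \<in> carrier A" using red_in by (simp add: A_def)
    show "\<xi> \<otimes>\<^bsub>A\<^esub> \<eta> \<in> carrier A" using red_in by (simp add: A_def)
    show "\<xi> \<otimes>\<^bsub>A\<^esub> \<eta> \<otimes>\<^bsub>A\<^esub> \<zeta> = \<xi> \<otimes>\<^bsub>A\<^esub> (\<eta> \<otimes>\<^bsub>A\<^esub> \<zeta>)"
      by (auto simp: A_def red_def fun_eq_iff mod_simps algebra_simps)
    show "\<one>\<^bsub>A\<^esub> \<otimes>\<^bsub>A\<^esub> \<xi> = \<xi>" if "\<xi> \<in> carrier A"
    proof -
      have "\<one>\<^bsub>A\<^esub> \<otimes>\<^bsub>A\<^esub> \<xi> = red \<xi>" by (auto simp: A_def red_def fun_eq_iff)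
      then show ?thesis using red_id[OF that] by simp
    qed
    show "\<exists>\<eta>\<in>carrier A. \<eta> \<otimes>\<^bsub>A\<^esub> \<xi> = \<one>\<^bsub>A\<^esub>"
      by (rule bexI[of _ "red (\<lambda>h. - \<xi> h)"], rule) (auto simp: A_def red_def fun_eq_iff mod_simps red_in p0)
  qed
  interpret A: group A by fact
  have A_card: "card (carrier A) = p ^ card (carrier G)" using fin by (simp add: A_def card_PiE)
  have finA: "finite (carrier A)" using fin by (simp add: A_def finite_PiE)
  have Ap: "finite_p_group p A" using grpA finA A_card by (auto simp: finite_p_group_def)
  have A_mult: "(\<xi> \<otimes>\<^bsub>A\<^esub> \<eta>) h mod int p = (\<xi> h + \<eta> h) mod int p" if "h \<in> carrier G" for \<xi> \<eta> h
    using that by (simp add: A_def red_def)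
  have A_inv: "inv\<^bsub>A\<^esub> \<xi> = red (\<lambda>h. - \<xi> h)" if "\<xi> \<in> carrier A" for \<xi>
    using that red_in by (intro A.inv_equality) (auto simp: A_def red_def fun_eq_iff mod_simps)
  define W where "W j = {\<xi> \<in> carrier A. \<forall>ws. set ws \<subseteq> carrier G \<and> length ws = j \<longrightarrow> (\<forall>h\<in>carrier G. int p dvd rdiffs G ws \<xi> h)}" for j
  have W_longer: "int p dvd rdiffs G ws \<xi> h"
    if "\<xi> \<in> W j" "set ws \<subseteq> carrier G" "length ws \<ge> j" "h \<in> carrier G" for j ws \<xi> h
  proof -
    have "rdiffs G ws \<xi> = rdiffs G (take (length ws - j) ws) (rdiffs G (drop (length ws - j) ws) \<xi>)"
      by (metis append_take_drop_id foldr_append comp_apply)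
    moreover have "\<forall>h\<in>carrier G. int p dvd rdiffs G (drop (length ws - j) ws) \<xi> h"
      using that set_drop_subset[of "length ws - j" ws] by (auto simp: W_def)
    ultimately show ?thesis
      using rdiffs_dvd[of "int p" "rdiffs G (drop (length ws - j) ws) \<xi>" "take (length ws - j) ws"]
        that set_take_subset[of "length ws - j" ws] by auto
  qed
  have W_red: "red \<eta> \<in> W j \<longleftrightarrow> (\<forall>ws. set ws \<subseteq> carrier G \<and> length ws = j \<longrightarrow> (\<forall>h\<in>carrier G. int p dvd rdiffs G ws \<eta> h))" for \<eta> j
  proof -
    have "int p dvd rdiffs G ws (red \<eta>) h \<longleftrightarrow> int p dvd rdiffs G ws \<eta> h"
      if "set ws \<subseteq> carrier G" "h \<in> carrier G" for ws h
      using rdiffs_cong_mod[of "red \<eta>" "int p" \<eta> ws] red_mod that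
      by (metis dvd_eq_mod_eq_0)
    then show ?thesis unfolding W_def using red_in by auto
  qed
  have W_sub: "subgroup (W j) A" for j
  proof (rule A.subgroupI)
    show "W j \<subseteq> carrier A" by (auto simp: W_def)
    have "red (\<lambda>_. 0) \<in> W j"
      unfolding W_red using rdiffs_dvd[of "int p" "\<lambda>_. 0"] by auto
    then show "W j \<noteq> {}" by blast
    fix \<xi> assume x: "\<xi> \<in> W j"
    then have "\<xi> \<in> carrier A" by (simp add: W_def)
    then show "inv\<^bsub>A\<^esub> \<xi> \<in> W j"
      using x unfolding A_inv[OF \<open>\<xi> \<in> carrier A\<close>] W_red by (simp add: rdiffs_minus W_def)
    fix \<eta> assume "\<eta> \<in> W j"
    moreover have "\<xi> \<otimes>\<^bsub>A\<^esub> \<eta> = red (\<lambda>h. \<xi> h + \<eta> h)" by (simp add: A_def)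
    ultimately show "\<xi> \<otimes>\<^bsub>A\<^esub> \<eta> \<in> W j"
      using x W_red[of "\<lambda>h. \<xi> h + \<eta> h" j] by (simp add: rdiffs_add W_def)
  qed
  define act where "act g \<xi> = (\<lambda>h\<in>carrier G. \<xi> (h \<otimes> g))" for g and \<xi> :: "'a \<Rightarrow> int"
  have act_red: "act g \<xi> = red (\<lambda>h. \<xi> h + rdiff G g \<xi> h)" if "g \<in> carrier G" "\<xi> \<in> carrier A" for g \<xi>
    using that by (auto simp: act_def red_def rdiff_def A_def fun_eq_iff PiE_def Pi_def)
  have rdiffs_snoc: "rdiffs G ws (rdiff G g \<xi>) = rdiffs G (ws @ [g]) \<xi>" for ws g \<xi> by simp
  have step: "W j \<subset> W (Suc j)" if Wj: "W j \<noteq> carrier A" for j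
  proof -
    obtain \<xi> where \<xi>: "\<xi> \<in> carrier A" "\<xi> \<notin> W j" "\<And>g. g \<in> carrier G \<Longrightarrow> act g \<xi> \<otimes>\<^bsub>A\<^esub> inv\<^bsub>A\<^esub> \<xi> \<in> W j"
    proof (rule p_group_fixed_coset[OF Ap G p W_sub Wj, where act = act])
      show "act g \<in> hom A A" if "g \<in> carrier G" for g
        using that by (auto simp: hom_def A_def act_def red_def fun_eq_iff PiE_def Pi_def)
      show "act (g \<otimes> h) \<xi> = act g (act h \<xi>)" if "g \<in> carrier G" "h \<in> carrier G" "\<xi> \<in> carrier A" for g h \<xi>
        using that by (auto simp: act_def fun_eq_iff m_assoc)
      show "act \<one> \<xi> = \<xi>" if "\<xi> \<in> carrier A" for \<xi>
        using that by (auto simp: act_def fun_eq_iff A_def PiE_def extensional_def)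
      show "act g \<xi> \<in> W j" if g: "g \<in> carrier G" and x: "\<xi> \<in> W j" for g \<xi>
      proof -
        have "\<xi> \<in> carrier A" using x by (simp add: W_def)
        have "int p dvd rdiffs G ws (rdiff G g \<xi>) h"
          if "set ws \<subseteq> carrier G" "length ws = j" "h \<in> carrier G" for ws h
          unfolding rdiffs_snoc using W_longer[OF x, of "ws @ [g]" h] that g by simp
        then show ?thesis
          unfolding act_red[OF g \<open>\<xi> \<in> carrier A\<close>] W_red using x by (auto simp: rdiffs_add W_def)
      qed
    qed blast
    have "int p dvd rdiffs G ws \<xi> h" if ws: "set ws \<subseteq> carrier G" "length ws = Suc j" "h \<in> carrier G" for ws h
    proof -
      \<comment> \<open>The last entry of \<open>ws\<close> acts first and moves
        \<open>\<xi>\<close> into \<open>W j\<close>, where the remaining \<open>j\<close> operators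
        finish.\<close>
      obtain vs g where vs: "ws = vs @ [g]" using ws(2) by (metis append_butlast_last_id list.size(3) nat.distinct(1))
      have g: "g \<in> carrier G" using ws vs by simp
      have "act g \<xi> \<otimes>\<^bsub>A\<^esub> inv\<^bsub>A\<^esub> \<xi> = red (rdiff G g \<xi>)"
        unfolding A_inv[OF \<xi>(1)] by (auto simp: A_def act_def red_def rdiff_def fun_eq_iff mod_simps)
      then have "red (rdiff G g \<xi>) \<in> W j" using \<xi>(3)[OF g] by simp
      then show ?thesis using ws vs unfolding W_red by auto
    qed
    then have "\<xi> \<in> W (Suc j)" using \<xi>(1) by (simp add: W_def)
    moreover have "W j \<subseteq> W (Suc j)" using W_longer by (force simp: W_def)
    ultimately show ?thesis using \<xi>(2) by blast
  qed
  have "\<exists>j. W j = carrier A"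
  proof (rule ccontr)
    assume "\<nexists>j. W j = carrier A"
    then have lt: "card (W j) < card (W (Suc j))" for j
      using step finA by (intro psubset_card_mono finite_subset[of "W (Suc j)" "carrier A"]) (auto simp: W_def)
    \<comment> \<open>A strictly growing chain would have unbounded cardinality.\<close>
    have "j \<le> card (W j)" for j
    proof (induction j)
      case (Suc j)
      then show ?case using lt[of j] by simp
    qed simp
    moreover have "card (W j) \<le> card (carrier A)" for j
      using finA by (intro card_mono) (auto simp: W_def)
    ultimately show False by (metis not_less_eq_eq order_trans)
  qed
  then obtain m where m: "W m = carrier A" by blast
  show ?thesis
  proof (rule that[of m])
    fix ws \<xi> h assume ws: "set ws \<subseteq> carrier G" "m \<le> length ws" "h \<in> carrier G"
    have "int p dvd rdiffs G ws (red \<xi>) h"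
      using W_longer[of "red \<xi>" m] ws m red_in by simp
    then show "int p dvd rdiffs G ws \<xi> h"
      using rdiffs_cong_mod[of "red \<xi>" "int p" \<xi> ws] red_mod ws by (metis dvd_eq_mod_eq_0)
  qed
qed

end

section \<open>The Magnus groups\<close>

definition nunits :: "ncps monoid" where
  "nunits = \<lparr>carrier = {f. ncoeff f [] = 1}, monoid.mult = (*), one = 1\<rparr>"

lemma nunits_simps [simp]:
  "f \<in> carrier nunits \<longleftrightarrow> ncoeff f [] = 1" "f \<otimes>\<^bsub>nunits\<^esub> g = f * g" "\<one>\<^bsub>nunits\<^esub> = 1"
  by (simp_all add: nunits_def)

interpretation nunits: group nunits
proof (rule groupI)
  fix f assume "f \<in> carrier nunits"
  then show "\<exists>g\<in>carrier nunits. g \<otimes>\<^bsub>nunits\<^esub> f = \<one>\<^bsub>nunits\<^esub>"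
    using ncps_inverse[of f] by auto
qed (simp_all add: mult.assoc)

lemma nunits_inv:
  assumes "ncoeff f [] = 1"
  shows "ncoeff (inv\<^bsub>nunits\<^esub> f) [] = 1" "f * inv\<^bsub>nunits\<^esub> f = 1" "inv\<^bsub>nunits\<^esub> f * f = 1"
  using nunits.inv_closed[of f] nunits.r_inv[of f] nunits.l_inv[of f] assms by simp_all

text \<open>Words of length at least \<open>K\<close> carry no condition, so \<open>e = K\<close>
  already describes the full \<open>K\<close>-th power of the ideal.\<close>

lemma npow_ideal_full: "f \<in> npow_ideal p d K K \<Longrightarrow> f \<in> npow_ideal p d e K"
  by (rule npow_idealI) (metis diff_is_0_eq dvd_0_left_iff leI npow_idealD one_dvd order_refl power_0)

text \<open>The congruence subgroup modulo the \<open>K\<close>-th power of the ideal; the quotient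
  by it is the finite \<open>p\<close>-group to which the universal property is applied.\<close>

definition ncong :: "nat \<Rightarrow> nat \<Rightarrow> nat \<Rightarrow> ncps set" where
  "ncong p d K = {f. ncoeff f [] = 1 \<and> f - 1 \<in> npow_ideal p d K K}"

lemma ncong_normal: "ncong p d K \<lhd> nunits"
proof -
  have inv: "inv\<^bsub>nunits\<^esub> f \<in> ncong p d K" if "f \<in> ncong p d K" for f
  proof -
    have f: "ncoeff f [] = 1" "f - 1 \<in> npow_ideal p d K K" using that by (auto simp: ncong_def)
    have "inv\<^bsub>nunits\<^esub> f - 1 = 0 - inv\<^bsub>nunits\<^esub> f * (f - 1)"
      using nunits_inv[OF f(1)] by (simp add: algebra_simps)
    then have "inv\<^bsub>nunits\<^esub> f - 1 \<in> npow_ideal p d K K"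
      using f(2) by (metis npow_ideal_diff npow_ideal_mult_left npow_ideal_zero)
    then show ?thesis using nunits_inv(1)[OF f(1)] by (simp add: ncong_def)
  qed
  have mult: "f * g \<in> ncong p d K" if "f \<in> ncong p d K" "g \<in> ncong p d K" for f g
  proof -
    have "f * g - 1 = (f - 1) * g + (g - 1)" by (simp add: algebra_simps)
    then have "f * g - 1 \<in> npow_ideal p d K K"
      using that unfolding ncong_def mem_Collect_eq by (metis npow_ideal_add npow_ideal_mult_right)
    then show ?thesis using that by (simp add: ncong_def)
  qed
  have sub: "subgroup (ncong p d K) nunits"
  proof (rule nunits.subgroupI)
    have "1 \<in> ncong p d K" by (simp add: ncong_def)
    then show "ncong p d K \<noteq> {}" by blast
  qed (auto simp: mult inv, simp add: ncong_def)
  have conj: "f * g * inv\<^bsub>nunits\<^esub> f \<in> ncong p d K" if f: "ncoeff f [] = 1" and g: "g \<in> ncong p d K" for f g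
  proof -
    have "f * g * inv\<^bsub>nunits\<^esub> f - 1 = f * (g - 1) * inv\<^bsub>nunits\<^esub> f"
      using nunits_inv[OF f] by (simp add: algebra_simps)
    then have "f * g * inv\<^bsub>nunits\<^esub> f - 1 \<in> npow_ideal p d K K"
      using g by (simp add: ncong_def npow_ideal_mult_left npow_ideal_mult_right)
    then show ?thesis using f g nunits_inv(1)[OF f] by (simp add: ncong_def)
  qed
  show ?thesis using sub conj by (simp add: nunits.normal_inv_iff)
qed

definition magnus_class :: "nat \<Rightarrow> nat \<Rightarrow> nat \<Rightarrow> ncps \<Rightarrow> ncps set" where
  "magnus_class p d K f = ncong p d K #>\<^bsub>nunits\<^esub> f"

definition magnus_group :: "nat \<Rightarrow> nat \<Rightarrow> nat \<Rightarrow> ncps set monoid" where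
  "magnus_group p d K = nunits Mod ncong p d K"

text \<open>Since the ideal is two-sided and \<open>f\<close> is invertible, cosets of the
  congruence subgroup are congruence classes.\<close>

lemma magnus_class_iff:
  assumes f: "ncoeff f [] = 1"
  shows "g \<in> magnus_class p d K f \<longleftrightarrow> ncoeff g [] = 1 \<and> g - f \<in> npow_ideal p d K K"
proof
  assume "g \<in> magnus_class p d K f"
  then obtain n where n: "n \<in> ncong p d K" "g = n * f" by (auto simp: magnus_class_def r_coset_def)
  have "g - f = (n - 1) * f" using n by (simp add: algebra_simps)
  then show "ncoeff g [] = 1 \<and> g - f \<in> npow_ideal p d K K"
    using n f by (simp add: ncong_def npow_ideal_mult_right)
next
  assume g: "ncoeff g [] = 1 \<and> g - f \<in> npow_ideal p d K K"
  let ?n = "g * inv\<^bsub>nunits\<^esub> f"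
  have "?n - 1 = (g - f) * inv\<^bsub>nunits\<^esub> f" using nunits_inv[OF f] by (simp add: algebra_simps)
  then have "?n \<in> ncong p d K"
    using g nunits_inv(1)[OF f] by (simp add: ncong_def npow_ideal_mult_right)
  moreover have "?n * f = g" using nunits_inv[OF f] by (simp add: mult.assoc)
  ultimately show "g \<in> magnus_class p d K f" unfolding magnus_class_def r_coset_def by force
qed

lemma magnus_class_eq_iff:
  assumes "ncoeff f [] = 1" "ncoeff g [] = 1"
  shows "magnus_class p d K f = magnus_class p d K g \<longleftrightarrow> f - g \<in> npow_ideal p d K K"
proof
  assume "magnus_class p d K f = magnus_class p d K g"
  moreover have "f \<in> magnus_class p d K f" using assms by (simp add: magnus_class_iff)
  ultimately show "f - g \<in> npow_ideal p d K K" using assms by (simp add: magnus_class_iff)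
next
  assume fg: "f - g \<in> npow_ideal p d K K"
  have "h - f \<in> npow_ideal p d K K \<longleftrightarrow> h - g \<in> npow_ideal p d K K" for h
  proof
    assume "h - f \<in> npow_ideal p d K K"
    from npow_ideal_add[OF this fg] show "h - g \<in> npow_ideal p d K K" by simp
  next
    assume "h - g \<in> npow_ideal p d K K"
    from npow_ideal_diff[OF this fg] show "h - f \<in> npow_ideal p d K K" by simp
  qed
  then show "magnus_class p d K f = magnus_class p d K g" using assms by (auto simp: magnus_class_iff)
qed

lemma magnus_group: "group (magnus_group p d K)"
  unfolding magnus_group_def using ncong_normal normal.factorgroup_is_group by blast

lemma carrier_magnus_group: "carrier (magnus_group p d K) = magnus_class p d K ` {f. ncoeff f [] = 1}"
  by (auto simp: magnus_group_def FactGroup_def RCOSETS_def magnus_class_def nunits_def)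

lemma magnus_class_hom: "magnus_class p d K \<in> hom nunits (magnus_group p d K)"
  using normal.r_coset_hom_Mod[OF ncong_normal, of p d K]
  unfolding magnus_group_def magnus_class_def[abs_def] .

lemma magnus_class_mult:
  "ncoeff f [] = 1 \<Longrightarrow> ncoeff g [] = 1 \<Longrightarrow>
    magnus_class p d K f \<otimes>\<^bsub>magnus_group p d K\<^esub> magnus_class p d K g = magnus_class p d K (f * g)"
  using hom_mult[OF magnus_class_hom, of f g p d K] by simp

lemma magnus_class_one: "\<one>\<^bsub>magnus_group p d K\<^esub> = magnus_class p d K 1"
  using hom_one[OF magnus_class_hom nunits.group_axioms magnus_group] by simp

lemma magnus_class_pow:
  "ncoeff f [] = 1 \<Longrightarrow> magnus_class p d K f [^]\<^bsub>magnus_group p d K\<^esub> (k::nat) = magnus_class p d K (f ^ k)"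
  by (induction k) (simp_all add: magnus_class_one magnus_class_mult power_commutes)

lemma magnus_class_inv:
  assumes "ncoeff f [] = 1"
  shows "inv\<^bsub>magnus_group p d K\<^esub> (magnus_class p d K f) = magnus_class p d K (inv\<^bsub>nunits\<^esub> f)"
  using assms by (intro group.inv_equality[OF magnus_group])
    (auto simp: magnus_class_mult nunits_inv magnus_class_one carrier_magnus_group)

text \<open>A class is determined by the residues of its coefficients modulo
  \<open>p ^ (K - length w)\<close> at the nonempty words \<open>w\<close> over the first
  \<open>d\<close> variables that are shorter than \<open>K\<close>, and these residues are
  arbitrary.\<close>

lemma finite_p_group_magnus:
  assumes p: "p > 0"
  shows "finite_p_group p (magnus_group p d K)"
proof -
  define L where "L = {w \<in> lists {..<d}. 0 < length w \<and> length w < K}"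
  have "L \<subseteq> {w. set w \<subseteq> {..<d} \<and> length w \<le> K}" by (auto simp: L_def)
  then have finL: "finite L" by (rule finite_subset) (simp add: finite_lists_length_le)
  define P where "P = (\<Pi>\<^sub>E w\<in>L. {0..<int p ^ (K - length w)})"
  define lift where "lift \<phi> = Ncps (\<lambda>w. if w = [] then 1 else if w \<in> L then \<phi> w else 0)" for \<phi>
  have lift: "ncoeff (lift \<phi>) w = (if w = [] then 1 else if w \<in> L then \<phi> w else 0)" for \<phi> w
    by (simp add: lift_def Ncps_inverse)
  have bij: "bij_betw (\<lambda>\<phi>. magnus_class p d K (lift \<phi>)) P (carrier (magnus_group p d K))"
    unfolding bij_betw_def
  proof
    show "inj_on (\<lambda>\<phi>. magnus_class p d K (lift \<phi>)) P"
    proof (rule inj_onI)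
      fix \<phi> \<psi> assume P: "\<phi> \<in> P" "\<psi> \<in> P" and "magnus_class p d K (lift \<phi>) = magnus_class p d K (lift \<psi>)"
      then have I: "lift \<phi> - lift \<psi> \<in> npow_ideal p d K K" by (subst (asm) magnus_class_eq_iff) (simp_all add: lift)
      show "\<phi> = \<psi>"
      proof (rule PiE_ext[of \<phi> L "\<lambda>w. {0..<int p ^ (K - length w)}" \<psi>])
        fix w assume w: "w \<in> L"
        then have "int p ^ (K - length w) dvd \<phi> w - \<psi> w"
          using npow_idealD[OF I, of w "K - length w"] by (auto simp: lift L_def split: if_splits)
        moreover have "\<phi> w \<in> {0..<int p ^ (K - length w)}" "\<psi> w \<in> {0..<int p ^ (K - length w)}"
          using P w by (auto simp: P_def)
        ultimately show "\<phi> w = \<psi> w"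
          by (metis atLeastLessThan_iff mod_eq_dvd_iff mod_pos_pos_trivial)
      qed (use P in \<open>auto simp: P_def\<close>)
    qed
    show "(\<lambda>\<phi>. magnus_class p d K (lift \<phi>)) ` P = carrier (magnus_group p d K)"
    proof (intro equalityI subsetI)
      fix C assume "C \<in> carrier (magnus_group p d K)"
      then obtain f where f: "ncoeff f [] = 1" "C = magnus_class p d K f" by (auto simp: carrier_magnus_group)
      define \<phi> where "\<phi> = (\<lambda>w\<in>L. ncoeff f w mod int p ^ (K - length w))"
      have "\<phi> \<in> P" using p by (auto simp: P_def \<phi>_def)
      moreover have "f - lift \<phi> \<in> npow_ideal p d K K"
      proof (rule npow_idealI)
        fix w assume "w \<in> lists {..<d}" "length w < K"
        then show "int p ^ (K - length w) dvd ncoeff (f - lift \<phi>) w"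
          using f by (cases "w = []") (auto simp: lift \<phi>_def L_def)
      qed
      then have "magnus_class p d K (lift \<phi>) = C"
        using magnus_class_eq_iff[of "lift \<phi>" f] magnus_class_eq_iff[of f "lift \<phi>"] f
        by (metis lift)
      ultimately show "C \<in> (\<lambda>\<phi>. magnus_class p d K (lift \<phi>)) ` P" by blast
    qed (auto simp: carrier_magnus_group lift)
  qed
  have "card P = p ^ (\<Sum>w\<in>L. K - length w)"
    unfolding P_def using finL by (simp add: card_PiE nat_power_eq power_sum)
  moreover have "finite P" unfolding P_def using finL by (intro finite_PiE) auto
  ultimately show ?thesis
    using bij magnus_group bij_betw_finite[OF bij] bij_betw_same_card[OF bij]
    by (auto simp: finite_p_group_def)
qed

section \<open>Faithfulness of the Magnus representation\<close>

lemma rdiffs_sum: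
  assumes "finite I"
  shows "rdiffs H ws (\<lambda>h. \<Sum>i\<in>I. c i * \<xi> i h) = (\<lambda>h. \<Sum>i\<in>I. c i * rdiffs H ws (\<xi> i) h)"
  by (induction ws) (simp_all add: rdiff_def fun_eq_iff sum_subtractf right_diff_distrib)

text \<open>The truncation of \<open>f\<close> to the words in \<open>L\<close>, evaluated by
  letting each variable \<open>i\<close> act on functions as the operator
  \<open>y i - 1\<close>.\<close>

definition word_action ::
  "('h, 'n) monoid_scheme \<Rightarrow> nat list set \<Rightarrow> (nat \<Rightarrow> 'h) \<Rightarrow> ncps \<Rightarrow> ('h \<Rightarrow> int) \<Rightarrow> 'h \<Rightarrow> int" where
  "word_action H L y f \<xi> k = (\<Sum>w\<in>L. ncoeff f w * rdiffs H (map y w) \<xi> k)"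

lemma dvd_sum_diff:
  fixes f g :: "'b \<Rightarrow> int"
  assumes "\<And>i. i \<in> I \<Longrightarrow> p dvd f i - g i"
  shows "p dvd sum f I - sum g I"
  unfolding sum_subtractf[symmetric] using assms by (intro dvd_sum)

text \<open>The product of the truncations differs from the truncation of the product by pairs of
  words of total length at least \<open>m\<close>, whose operators vanish modulo
  \<open>p\<close>.\<close>

lemma (in group) word_action_mult:
  assumes y: "\<And>i. i < d \<Longrightarrow> y i \<in> carrier G" and k: "k \<in> carrier G"
    and nil: "\<And>ws \<xi> h. set ws \<subseteq> carrier G \<Longrightarrow> length ws \<ge> m \<Longrightarrow> h \<in> carrier G \<Longrightarrow> p dvd rdiffs G ws \<xi> h"
    and L: "L = {w \<in> lists {..<d}. length w < m}"
  shows "p dvd word_action G L y (f * g) \<xi> k - word_action G L y f (word_action G L y g \<xi>) k"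
proof -
  have "L \<subseteq> {w. set w \<subseteq> {..<d} \<and> length w \<le> m}" by (auto simp: L)
  then have finL: "finite L" by (rule finite_subset) (simp add: finite_lists_length_le)
  define h where "h u v = ncoeff f u * ncoeff g v * rdiffs G (map y (u @ v)) \<xi> k" for u v
  let ?S = "{(u, v) \<in> L \<times> L. length u + length v < m}"
  have "word_action G L y (f * g) \<xi> k
      = (\<Sum>w\<in>L. \<Sum>i\<le>length w. h (take i w) (drop i w))"
    unfolding word_action_def ncoeff_mult sum_distrib_right h_def append_take_drop_id ..
  also have "\<dots> = (\<Sum>(w, i)\<in>Sigma L (\<lambda>w. {..length w}). h (take i w) (drop i w))"
    using finL by (subst sum.Sigma) auto
  also have "\<dots> = (\<Sum>(u, v)\<in>?S. h u v)"
    by (rule sum.reindex_bij_witness[of _ "\<lambda>(u, v). (u @ v, length u)" "\<lambda>(w, i). (take i w, drop i w)"])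
       (auto simp: L dest: in_set_takeD in_set_dropD)
  finally have 1: "word_action G L y (f * g) \<xi> k = (\<Sum>(u, v)\<in>?S. h u v)" .
  have "word_action G L y f (word_action G L y g \<xi>) k = (\<Sum>u\<in>L. \<Sum>v\<in>L. h u v)"
  proof -
    have "word_action G L y g \<xi> = (\<lambda>k. \<Sum>v\<in>L. ncoeff g v * rdiffs G (map y v) \<xi> k)"
      by (simp add: word_action_def fun_eq_iff)
    then show ?thesis
      unfolding word_action_def[of G L y f] h_def
      by (simp add: rdiffs_sum[OF finL] sum_distrib_left mult.assoc)
  qed
  also have "\<dots> = (\<Sum>(u, v)\<in>L \<times> L. h u v)" by (rule sum.cartesian_product)
  also have "\<dots> = (\<Sum>(u, v)\<in>?S. h u v) + (\<Sum>(u, v)\<in>L \<times> L - ?S. h u v)"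
    using finL by (intro sum.subset_diff[THEN trans[OF _ add.commute]]) auto
  finally have 2: "word_action G L y f (word_action G L y g \<xi>) k
    = (\<Sum>(u, v)\<in>?S. h u v) + (\<Sum>(u, v)\<in>L \<times> L - ?S. h u v)" .
  have "p dvd (\<Sum>(u, v)\<in>L \<times> L - ?S. h u v)"
  proof (rule dvd_sum)
    fix z assume z: "z \<in> L \<times> L - ?S"
    obtain u v where uv: "z = (u, v)" by force
    then have "p dvd rdiffs G (map y (u @ v)) \<xi> k"
      using z y k by (intro nil) (auto simp: L)
    then show "p dvd (case z of (u, v) \<Rightarrow> h u v)" by (simp add: uv h_def)
  qed
  then show ?thesis using 1 2 by simp
qed

lemma (in group) word_action_cong:
  assumes y: "\<And>i. i < d \<Longrightarrow> y i \<in> carrier G" and k: "k \<in> carrier G"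
    and L: "L \<subseteq> lists {..<d}"
    and \<xi>: "\<forall>h\<in>carrier G. p dvd \<xi> h - \<eta> h"
  shows "p dvd word_action G L y f \<xi> k - word_action G L y f \<eta> k"
  unfolding word_action_def
proof (rule dvd_sum_diff)
  fix w assume w: "w \<in> L"
  have "set (map y w) \<subseteq> carrier G" using w L y by fastforce
  then have "rdiffs G (map y w) \<xi> k mod p = rdiffs G (map y w) \<eta> k mod p"
    using rdiffs_cong_mod[of \<xi> p \<eta> "map y w"] \<xi> k by (simp add: mod_eq_dvd_iff)
  then have "p dvd ncoeff f w * (rdiffs G (map y w) \<xi> k - rdiffs G (map y w) \<eta> k)"
    by (simp add: mod_eq_dvd_iff)
  then show "p dvd ncoeff f w * rdiffs G (map y w) \<xi> k - ncoeff f w * rdiffs G (map y w) \<eta> k"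
    by (simp add: right_diff_distrib)
qed

lemma word_action_nmod:
  assumes "f - g \<in> nmod p d m" "L \<subseteq> {w \<in> lists {..<d}. length w < m}"
  shows "int p dvd word_action G L y f \<xi> k - word_action G L y g \<xi> k"
  unfolding word_action_def
proof (rule dvd_sum_diff)
  fix w assume "w \<in> L"
  then have w: "w \<in> lists {..<d}" "length w < m" using assms(2) by blast+
  have "int p dvd (ncoeff f w - ncoeff g w) * rdiffs G (map y w) \<xi> k"
    using nmodD[OF assms(1) w] by simp
  then show "int p dvd ncoeff f w * rdiffs G (map y w) \<xi> k - ncoeff g w * rdiffs G (map y w) \<xi> k"
    by (simp add: left_diff_distrib)
qed

text \<open>\<open>H\<close> acts on the functions \<open>H \<rightarrow> \<int>/p\<close>, where products of \<open>m\<close> operators \<open>y\<^sub>i - 1\<close> vanish, and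
  \<open>X\<^sub>i \<mapsto> y\<^sub>i - 1\<close> extends to truncated power series. The pairs on which both actions agree form a
  subgroup containing the images of the generators.\<close>
lemma magnus_factor:
  assumes F: "free_pro_p_group p d F T x" and p: "prime p" and H: "finite_p_group p H"
    and q: "open_hom F T H q"
  obtains m where "\<And>K f V v. K \<ge> m \<Longrightarrow> open_hom F T (magnus_group p d K) f \<Longrightarrow>
    (\<And>i. i < d \<Longrightarrow> f (x i) = magnus_class p d K (1 + nvar i)) \<Longrightarrow> v \<in> carrier F \<Longrightarrow> V \<in> f v \<Longrightarrow>
    V - 1 \<in> nmod p d m \<Longrightarrow> q v = \<one>\<^bsub>H\<^esub>"
proof -
  interpret F: group F using free_pro_p_groupD(2)[OF F] .
  interpret H: group H using H by (simp add: finite_p_group_def)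
  have p1: "p > 1" using p prime_gt_1_nat by blast
  obtain m0 where m0: "\<And>ws \<xi> h. set ws \<subseteq> carrier H \<Longrightarrow> length ws \<ge> m0 \<Longrightarrow> h \<in> carrier H \<Longrightarrow> int p dvd rdiffs H ws \<xi> h"
    using H.rdiffs_nilpotent[OF H p] by metis
  \<comment> \<open>Adding 2 ensures that the empty word and the single letters belong to
    \<open>L\<close>.\<close>
  define m where "m = m0 + 2"
  have nil: "\<And>ws \<xi> h. set ws \<subseteq> carrier H \<Longrightarrow> length ws \<ge> m \<Longrightarrow> h \<in> carrier H \<Longrightarrow> int p dvd rdiffs H ws \<xi> h"
    using m0 by (simp add: m_def)
  define y where "y i = q (x i)" for i
  have y: "y i \<in> carrier H" if "i < d" for i
    using q free_pro_p_groupD(4)[OF F that] by (auto simp: y_def open_hom_def hom_def)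
  define L where "L = {w \<in> lists {..<d}. length w < m}"
  have "L \<subseteq> {w. set w \<subseteq> {..<d} \<and> length w \<le> m}" by (auto simp: L_def)
  then have finL: "finite L" by (rule finite_subset) (simp add: finite_lists_length_le)
  have LL: "L \<subseteq> lists {..<d}" by (auto simp: L_def)
  let ?\<rho> = "word_action H L y"
  \<comment> \<open>Modulo \<open>p\<close>, the series \<open>f\<close> acts on functions as right
    translation by \<open>h\<close>.\<close>
  define good where "good f h \<longleftrightarrow> (\<forall>\<xi>. \<forall>k\<in>carrier H. int p dvd \<xi> (k \<otimes>\<^bsub>H\<^esub> h) - ?\<rho> f \<xi> k)" for f h
  have \<rho>_one: "?\<rho> 1 \<xi> k = \<xi> k" for \<xi> k
  proof -
    have "?\<rho> 1 \<xi> k = (\<Sum>w\<in>L. if w = [] then \<xi> k else 0)"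
      unfolding word_action_def by (intro sum.cong) auto
    also have "\<dots> = \<xi> k" using finL by (simp add: L_def m_def)
    finally show ?thesis .
  qed
  have good_one: "good 1 \<one>\<^bsub>H\<^esub>" unfolding good_def by (simp add: \<rho>_one)
  have good_gen: "good (1 + nvar i) (y i)" if i: "i < d" for i
  proof -
    have "?\<rho> (1 + nvar i) \<xi> k = \<xi> (k \<otimes>\<^bsub>H\<^esub> y i)" for \<xi> k
    proof -
      have "?\<rho> (1 + nvar i) \<xi> k = (\<Sum>w\<in>L. (if w = [] then \<xi> k else 0) + (if w = [i] then rdiff H (y i) \<xi> k else 0))"
        unfolding word_action_def by (intro sum.cong) auto
      also have "\<dots> = \<xi> k + rdiff H (y i) \<xi> k"
        using finL i by (simp add: sum.distrib L_def m_def)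
      finally show ?thesis by (simp add: rdiff_def)
    qed
    then show ?thesis by (simp add: good_def)
  qed
  have good_mult: "good (f * g) (h \<otimes>\<^bsub>H\<^esub> h')"
    if f: "good f h" and g: "good g h'" and h: "h \<in> carrier H" "h' \<in> carrier H" for f g h h'
    unfolding good_def
  proof (intro allI ballI)
    fix \<xi> :: "_ \<Rightarrow> int" and k assume k: "k \<in> carrier H"
    have 1: "int p dvd \<xi> (k \<otimes>\<^bsub>H\<^esub> h \<otimes>\<^bsub>H\<^esub> h') - ?\<rho> g \<xi> (k \<otimes>\<^bsub>H\<^esub> h)" using g k h by (simp add: good_def)
    have 2: "int p dvd ?\<rho> g \<xi> (k \<otimes>\<^bsub>H\<^esub> h) - ?\<rho> f (?\<rho> g \<xi>) k" using f k by (simp add: good_def)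
    have 3: "int p dvd ?\<rho> (f * g) \<xi> k - ?\<rho> f (?\<rho> g \<xi>) k" by (rule H.word_action_mult[OF y k nil L_def])
    show "int p dvd \<xi> (k \<otimes>\<^bsub>H\<^esub> (h \<otimes>\<^bsub>H\<^esub> h')) - ?\<rho> (f * g) \<xi> k"
      using dvd_diff[OF dvd_add[OF 1 2] 3] k h by (simp add: H.m_assoc)
  qed
  have good_inv: "good g (inv\<^bsub>H\<^esub> h)" if f: "good f h" and gf: "g * f = 1" and h: "h \<in> carrier H" for f g h
    unfolding good_def
  proof (intro allI ballI)
    fix \<xi> :: "_ \<Rightarrow> int" and k assume k: "k \<in> carrier H"
    \<comment> \<open>\<open>f\<close> carries the translate \<open>\<zeta>\<close> back to
      \<open>\<xi>\<close>, and \<open>g\<close> undoes \<open>f\<close>; hence \<open>g\<close>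
      carries \<open>\<xi>\<close> to \<open>\<zeta>\<close>.\<close>
    define \<zeta> where "\<zeta> k = \<xi> (k \<otimes>\<^bsub>H\<^esub> inv\<^bsub>H\<^esub> h)" for k
    have "\<forall>k\<in>carrier H. int p dvd \<xi> k - ?\<rho> f \<zeta> k"
    proof
      fix k assume k: "k \<in> carrier H"
      then have "int p dvd \<zeta> (k \<otimes>\<^bsub>H\<^esub> h) - ?\<rho> f \<zeta> k" using f by (simp add: good_def)
      then show "int p dvd \<xi> k - ?\<rho> f \<zeta> k" using k h by (simp add: \<zeta>_def H.m_assoc)
    qed
    from H.word_action_cong[OF y k LL this]
    have 1: "int p dvd ?\<rho> g \<xi> k - ?\<rho> g (?\<rho> f \<zeta>) k" .
    have "int p dvd ?\<rho> (g * f) \<zeta> k - ?\<rho> g (?\<rho> f \<zeta>) k" by (rule H.word_action_mult[OF y k nil L_def])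
    then have "int p dvd \<zeta> k - ?\<rho> g (?\<rho> f \<zeta>) k" by (simp add: gf \<rho>_one)
    from dvd_diff[OF this 1] show "int p dvd \<xi> (k \<otimes>\<^bsub>H\<^esub> inv\<^bsub>H\<^esub> h) - ?\<rho> g \<xi> k" by (simp add: \<zeta>_def)
  qed
  have good_cong: "good g h" if f: "good f h" and fg: "f - g \<in> nmod p d m" for f g h
    unfolding good_def
  proof (intro allI ballI)
    fix \<xi> :: "_ \<Rightarrow> int" and k assume k: "k \<in> carrier H"
    have 1: "int p dvd \<xi> (k \<otimes>\<^bsub>H\<^esub> h) - ?\<rho> f \<xi> k" using f k by (simp add: good_def)
    have 2: "int p dvd ?\<rho> f \<xi> k - ?\<rho> g \<xi> k" using fg by (rule word_action_nmod) (simp add: L_def)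
    show "int p dvd \<xi> (k \<otimes>\<^bsub>H\<^esub> h) - ?\<rho> g \<xi> k" using dvd_add[OF 1 2] by simp
  qed
  show ?thesis
  proof (rule that[of m])
    fix K f V v
    assume K: "K \<ge> m" and f: "open_hom F T (magnus_group p d K) f"
      and fx: "\<And>i. i < d \<Longrightarrow> f (x i) = magnus_class p d K (1 + nvar i)"
      and v: "v \<in> carrier F" and V: "V \<in> f v" and V1: "V - 1 \<in> nmod p d m"
    let ?M = "magnus_group p d K"
    interpret M: group ?M by (rule magnus_group)
    have Mp: "finite_p_group p ?M" using p1 by (intro finite_p_group_magnus) simp
    \<comment> \<open>Classes modulo the ideal and elements of \<open>H\<close>, linked by a common
      series. The image of \<open>F\<close> under the pair of maps will lie in this
      subgroup.\<close>
    define B where "B = {(magnus_class p d K f, h) | f h. ncoeff f [] = 1 \<and> h \<in> carrier H \<and> good f h}"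
    obtain a b where "card (carrier ?M) = p ^ a" "card (carrier H) = p ^ b"
      using Mp H by (auto simp: finite_p_group_def)
    then have "card (carrier ?M \<times> carrier H) = p ^ (a + b)" by (simp add: card_cartesian_product power_add)
    then have Pp: "finite_p_group p (?M \<times>\<times> H)"
      using Mp H DirProd_group[OF M.group_axioms H.group_axioms] by (auto simp: finite_p_group_def DirProd_def)
    have B: "subgroup B (?M \<times>\<times> H)"
    proof (rule group.subgroupI)
      show "group (?M \<times>\<times> H)" using Pp by (simp add: finite_p_group_def)
      show "B \<subseteq> carrier (?M \<times>\<times> H)" by (auto simp: B_def carrier_magnus_group)
      have "(magnus_class p d K 1, \<one>\<^bsub>H\<^esub>) \<in> B" unfolding B_def using good_one by force
      then show "B \<noteq> {}" by blast
    next
      fix z assume "z \<in> B"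
      then obtain g h where g: "z = (magnus_class p d K g, h)" "ncoeff g [] = 1" "h \<in> carrier H" "good g h"
        by (auto simp: B_def)
      have "inv\<^bsub>?M \<times>\<times> H\<^esub> z = (magnus_class p d K (inv\<^bsub>nunits\<^esub> g), inv\<^bsub>H\<^esub> h)"
        using g by (simp add: inv_DirProd[OF M.group_axioms H.group_axioms] carrier_magnus_group magnus_class_inv)
      moreover have "good (inv\<^bsub>nunits\<^esub> g) (inv\<^bsub>H\<^esub> h)"
        using good_inv[OF g(4) nunits_inv(3)[OF g(2)] g(3)] .
      ultimately show "inv\<^bsub>?M \<times>\<times> H\<^esub> z \<in> B"
        unfolding B_def using g nunits_inv(1)[OF g(2)] by force
    next
      fix z z' assume "z \<in> B" "z' \<in> B"
      then obtain g h g' h' where g: "z = (magnus_class p d K g, h)" "ncoeff g [] = 1" "h \<in> carrier H" "good g h"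
        and g': "z' = (magnus_class p d K g', h')" "ncoeff g' [] = 1" "h' \<in> carrier H" "good g' h'"
        by (auto simp: B_def)
      have "z \<otimes>\<^bsub>?M \<times>\<times> H\<^esub> z' = (magnus_class p d K (g * g'), h \<otimes>\<^bsub>H\<^esub> h')"
        using g g' by (simp add: magnus_class_mult)
      moreover have "good (g * g') (h \<otimes>\<^bsub>H\<^esub> h')" using good_mult g g' by blast
      ultimately show "z \<otimes>\<^bsub>?M \<times>\<times> H\<^esub> z' \<in> B" unfolding B_def using g g' by force
    qed
    have fq: "open_hom F T (?M \<times>\<times> H) (\<lambda>a. (f a, q a))"
    proof -
      have "openin T {g \<in> carrier F. (f g, q g) = z}" if "z \<in> carrier (?M \<times>\<times> H)" for z
      proof -
        have "{g \<in> carrier F. (f g, q g) = z} = {g \<in> carrier F. f g = fst z} \<inter> {g \<in> carrier F. q g = snd z}" by auto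
        then show ?thesis using f q that by (auto simp: open_hom_def)
      qed
      moreover have "(\<lambda>a. (f a, q a)) \<in> hom F (?M \<times>\<times> H)"
        using f q by (auto simp: open_hom_def hom_def)
      ultimately show ?thesis by (simp add: open_hom_def)
    qed
    have "(f v, q v) \<in> B"
    proof (rule free_pro_p_image_in_subgroup[OF F p Pp fq B _ v])
      fix i assume i: "i < d"
      then have "good (1 + nvar i) (q (x i))" using good_gen by (simp add: y_def)
      moreover have "q (x i) \<in> carrier H" using y[OF i] by (simp add: y_def)
      ultimately show "(f (x i), q (x i)) \<in> B" unfolding B_def fx[OF i] by force
    qed
    then obtain g where g: "f v = magnus_class p d K g" "ncoeff g [] = 1" "q v \<in> carrier H" "good g (q v)"
      by (auto simp: B_def)
    have "V - g \<in> npow_ideal p d K K" using V g by (simp add: magnus_class_iff)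
    then have "V - g \<in> nmod p d m" by (rule npow_ideal_subset_nmod[OF K K])
    from nmod_diff[OF V1 this] have "g - 1 \<in> nmod p d m" by simp
    \<comment> \<open>\<open>g\<close> is congruent to 1 in all degrees that the action sees, so
      \<open>q v\<close> translates trivially; the indicator function of the identity then detects
      \<open>q v\<close>.\<close>
    then have "good 1 (q v)" using good_cong[OF g(4)] by blast
    then have "int p dvd \<xi> (\<one>\<^bsub>H\<^esub> \<otimes>\<^bsub>H\<^esub> q v) - ?\<rho> 1 \<xi> \<one>\<^bsub>H\<^esub>" for \<xi>
      unfolding good_def by blast
    from this[of "\<lambda>h. if h = \<one>\<^bsub>H\<^esub> then 1 else 0"]
    have "int p dvd (if q v = \<one>\<^bsub>H\<^esub> then 1 else 0) - 1" using g(3) by (simp add: \<rho>_one)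
    then show "q v = \<one>\<^bsub>H\<^esub>" using p1 by (auto split: if_splits)
  qed
qed

text \<open>The fibre over the coset of \<open>a\<close> is the preimage of \<open>N\<close> under
  right multiplication by the inverse of \<open>a\<close>.\<close>

lemma open_hom_quotient:
  assumes G: "topological_group G T" and N: "N \<lhd> G" "openin T N"
  shows "open_hom G T (G Mod N) (\<lambda>g. N #>\<^bsub>G\<^esub> g)"
proof -
  interpret N: normal N G by fact
  have ts: "topspace T = carrier G" using G by (simp add: topological_group_def)
  have "openin T {g \<in> carrier G. N #>\<^bsub>G\<^esub> g = C}" if "C \<in> carrier (G Mod N)" for C
  proof -
    have "C \<in> rcosets\<^bsub>G\<^esub> N" using that by (simp add: FactGroup_def)
    then obtain a where a: "a \<in> carrier G" "C = N #>\<^bsub>G\<^esub> a"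
      unfolding RCOSETS_def by blast
    have "continuous_map (prod_topology T T) T (\<lambda>(x, y). x \<otimes>\<^bsub>G\<^esub> y)"
      using G by (simp add: topological_group_def)
    moreover have "continuous_map T (prod_topology T T) (\<lambda>g. (g, inv\<^bsub>G\<^esub> a))"
      using a ts by (simp add: continuous_map_pairwise o_def)
    ultimately have "continuous_map T T ((\<lambda>(x, y). x \<otimes>\<^bsub>G\<^esub> y) \<circ> (\<lambda>g. (g, inv\<^bsub>G\<^esub> a)))"
      using continuous_map_compose by blast
    then have "openin T {g \<in> topspace T. g \<otimes>\<^bsub>G\<^esub> inv\<^bsub>G\<^esub> a \<in> N}"
      using N(2) openin_continuous_map_preimage by (fastforce simp: o_def)
    moreover have "g \<otimes>\<^bsub>G\<^esub> inv\<^bsub>G\<^esub> a \<in> N \<longleftrightarrow> N #>\<^bsub>G\<^esub> g = C" if g: "g \<in> carrier G" for g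
    proof
      assume "g \<otimes>\<^bsub>G\<^esub> inv\<^bsub>G\<^esub> a \<in> N"
      then have "g \<otimes>\<^bsub>G\<^esub> inv\<^bsub>G\<^esub> a \<otimes>\<^bsub>G\<^esub> a \<in> N #>\<^bsub>G\<^esub> a" by (auto simp: r_coset_def)
      then have "g \<in> N #>\<^bsub>G\<^esub> a" using g a by (simp add: N.m_assoc)
      then show "N #>\<^bsub>G\<^esub> g = C" using N.repr_independence[OF _ a(1) N.subgroup_axioms] a by simp
    next
      assume "N #>\<^bsub>G\<^esub> g = C"
      then have "g \<in> N #>\<^bsub>G\<^esub> a" using N.rcos_self[OF g N.subgroup_axioms] a by simp
      then show "g \<otimes>\<^bsub>G\<^esub> inv\<^bsub>G\<^esub> a \<in> N"
        using a N.mem_carrier by (auto simp: r_coset_def N.m_assoc)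
    qed
    ultimately show ?thesis unfolding ts by (simp cong: conj_cong)
  qed
  then show ?thesis using N.r_coset_hom_Mod by (simp add: open_hom_def)
qed

text \<open>An open normal subgroup that misses \<open>v\<close> has a finite \<open>p\<close>-group
  as quotient, and \<open>magnus_factor\<close> for this quotient bounds the degree. The same
  \<open>m\<close> serves all \<open>K\<close> from \<open>m\<close> on and all choices of
  \<open>f\<close> and \<open>V\<close>.\<close>

lemma magnus_detects:
  assumes F: "free_pro_p_group p d F T x" and p: "prime p" and v: "v \<in> carrier F" "v \<noteq> \<one>\<^bsub>F\<^esub>"
  obtains m where "\<And>K f V. K \<ge> m \<Longrightarrow> open_hom F T (magnus_group p d K) f \<Longrightarrow>
    (\<And>i. i < d \<Longrightarrow> f (x i) = magnus_class p d K (1 + nvar i)) \<Longrightarrow> V \<in> f v \<Longrightarrow> V - 1 \<notin> nmod p d m"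
proof -
  interpret F: group F using free_pro_p_groupD(2)[OF F] .
  have pro: "pro_p_group p F T" using free_pro_p_groupD(1)[OF F] .
  obtain N where N: "N \<lhd> F" "openin T N" "v \<notin> N" using pro_p_group_separation[OF pro v] by blast
  interpret N: normal N F by (rule N(1))
  obtain k where k: "card (rcosets\<^bsub>F\<^esub> N) = p ^ k" using pro N unfolding pro_p_group_def by blast
  \<comment> \<open>An infinite set has \<open>card\<close> 0, so a positive value proves the index
    finite.\<close>
  have "p ^ k > 0" using p prime_gt_0_nat by simp
  then have "finite (rcosets\<^bsub>F\<^esub> N)" using k by (metis card.infinite less_numeral_extra(3))
  then have H: "finite_p_group p (F Mod N)"
    using k N.factorgroup_is_group by (auto simp: finite_p_group_def FactGroup_def)
  have q: "open_hom F T (F Mod N) (\<lambda>g. N #>\<^bsub>F\<^esub> g)"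
    using pro N by (intro open_hom_quotient) (auto simp: pro_p_group_def)
  have "N #>\<^bsub>F\<^esub> v \<noteq> \<one>\<^bsub>F Mod N\<^esub>"
    using N(3) F.rcos_self[OF v(1) N.subgroup_axioms] by (auto simp: FactGroup_def)
  then show ?thesis using magnus_factor[OF F p H q] that v(1) by metis
qed

section \<open>The p-adic numbers form a ring\<close>

text \<open>Cross-multiplication shows that the valuation may be read off from any fraction, reduced
  or not.\<close>

lemma padic_val_rat_fraction:
  assumes p: "prime p" and "a \<noteq> 0" "b \<noteq> 0"
  shows "padic_val_rat p (of_int a / of_int b)
    = int (multiplicity (int p) a) - int (multiplicity (int p) b)"
proof -
  obtain c e where ce: "quotient_of (of_int a / of_int b) = (c, e)" by force
  have e: "e > 0" using quotient_of_denom_pos[OF ce] .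
  have eq: "(of_int a / of_int b :: rat) = of_int c / of_int e" using quotient_of_div[OF ce] .
  have c: "c \<noteq> 0" using eq assms e by auto
  have "(of_int a * of_int e :: rat) = of_int c * of_int b" using eq assms e by (simp add: field_simps)
  then have "a * e = c * b" by (metis of_int_eq_iff of_int_mult)
  then have "multiplicity (int p) a + multiplicity (int p) e = multiplicity (int p) c + multiplicity (int p) b"
    using p assms c e
    by (metis prime_elem_multiplicity_mult_distrib prime_imp_prime_elem prime_nat_int_transfer order_less_irrefl)
  then show ?thesis unfolding padic_val_rat_def ce by simp
qed

lemma rat_fraction_cases:
  obtains a b where "q = of_int a / (of_int b :: rat)" "b \<noteq> 0"
  using quotient_of_div quotient_of_denom_pos by (metis less_irrefl surj_pair)

lemma padic_abs_fraction:
  assumes "prime p" "a \<noteq> 0" "b \<noteq> 0"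
  shows "padic_abs p (of_int a / of_int b)
    = real p powr (real (multiplicity (int p) b) - real (multiplicity (int p) a))"
  using padic_val_rat_fraction[OF assms] assms by (simp add: padic_abs_def)

lemma padic_abs_zero [simp]: "padic_abs p 0 = 0"
  by (simp add: padic_abs_def)

lemma padic_abs_nonneg [simp]: "padic_abs p q \<ge> 0"
  by (simp add: padic_abs_def)

lemma padic_abs_mult:
  assumes p: "prime p"
  shows "padic_abs p (q * r) = padic_abs p q * padic_abs p r"
proof (cases "q = 0 \<or> r = 0")
  case False
  obtain a b where q: "q = of_int a / of_int b" "b \<noteq> 0" by (rule rat_fraction_cases)
  obtain c e where r: "r = of_int c / of_int e" "e \<noteq> 0" by (rule rat_fraction_cases)
  have ac: "a \<noteq> 0" "c \<noteq> 0" using False q r by auto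
  have pe: "prime_elem (int p)" using p by simp
  have "q * r = of_int (a * c) / of_int (b * e)" using q r by simp
  then have "padic_abs p (q * r) = real p powr (real (multiplicity (int p) (b * e)) - real (multiplicity (int p) (a * c)))"
    using padic_abs_fraction[OF p, of "a * c" "b * e"] ac q r by simp
  also have "\<dots> = padic_abs p q * padic_abs p r"
    using ac q r padic_abs_fraction[OF p]
    by (simp add: prime_elem_multiplicity_mult_distrib[OF pe] powr_add[symmetric] algebra_simps)
  finally show ?thesis .
qed auto

lemma padic_abs_uminus: "prime p \<Longrightarrow> padic_abs p (- q) = padic_abs p q"
proof (cases "q = 0")
  case False
  assume p: "prime p"
  obtain a b where q: "q = of_int a / of_int b" "b \<noteq> 0" by (rule rat_fraction_cases)
  then have "- q = of_int (- a) / of_int b" by simp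
  then show ?thesis using padic_abs_fraction[OF p, of a b] padic_abs_fraction[OF p, of "- a" b] q False
    by simp
qed simp

text \<open>Over a common denominator the ultrametric inequality follows from the one for
  multiplicities; the triangle inequality is retained from it.\<close>

lemma padic_abs_add_le:
  assumes p: "prime p"
  shows "padic_abs p (q + r) \<le> padic_abs p q + padic_abs p r"
proof (cases "q = 0 \<or> r = 0 \<or> q + r = 0")
  case False
  obtain a b where q: "q = of_int a / of_int b" "b \<noteq> 0" by (rule rat_fraction_cases)
  obtain c e where r: "r = of_int c / of_int e" "e \<noteq> 0" by (rule rat_fraction_cases)
  have q': "q = of_int (a * e) / of_int (b * e)" and r': "r = of_int (c * b) / of_int (b * e)"
    using q r by auto
  have qr: "q + r = of_int (a * e + c * b) / of_int (b * e)"
    unfolding q' r' by (simp add: add_divide_distrib)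
  have nz: "a * e \<noteq> 0" "c * b \<noteq> 0" "b * e \<noteq> 0" "a * e + c * b \<noteq> 0"
    using False q r qr by (fastforce, fastforce, fastforce, metis div_0 of_int_0)
  have nu: "\<not> is_unit (int p)" using p not_prime_unit by (metis prime_nat_int_transfer)
  have "min (multiplicity (int p) (a * e)) (multiplicity (int p) (c * b)) \<le> multiplicity (int p) (a * e + c * b)"
    using nz nu by (intro multiplicity_geI dvd_add) (auto intro: multiplicity_dvd')
  moreover note abs_eqs = padic_abs_fraction[OF p nz(4,3), folded qr]
    padic_abs_fraction[OF p nz(1,3), folded q'] padic_abs_fraction[OF p nz(2,3), folded r']
  ultimately have "padic_abs p (q + r) \<le> max (padic_abs p q) (padic_abs p r)"
    unfolding abs_eqs using prime_gt_1_nat[OF p] by (auto simp: max_def min_def split: if_splits intro: powr_mono)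
  also have "\<dots> \<le> padic_abs p q + padic_abs p r" by simp
  finally show ?thesis .
qed auto

lemma padic_abs_minus_commute: "prime p \<Longrightarrow> padic_abs p (q - r) = padic_abs p (r - q)"
  using padic_abs_uminus[of p "q - r"] by simp

context
  fixes p :: nat
  assumes p: "prime p"
begin

section \<open>Cauchy sequences for the p-adic absolute value\<close>

lemma padic_cauchy_const: "padic_cauchy p (\<lambda>_. c)"
  by (simp add: padic_cauchy_def)

lemma padic_cauchy_bounded:
  assumes "padic_cauchy p X"
  obtains B where "B > 0" "\<And>n. padic_abs p (X n) \<le> B"
proof -
  obtain N where N: "\<And>m k. m \<ge> N \<Longrightarrow> k \<ge> N \<Longrightarrow> padic_abs p (X m - X k) < 1"
    using assms unfolding padic_cauchy_def by (metis zero_less_one)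
  define B where "B = (\<Sum>i\<le>N. padic_abs p (X i)) + 1"
  have small: "padic_abs p (X n) \<le> (\<Sum>i\<le>N. padic_abs p (X i))" if "n \<le> N" for n
    using that by (intro member_le_sum) auto
  have "padic_abs p (X n) \<le> B" for n
  proof (cases "n \<le> N")
    case False
    have "padic_abs p (X n) \<le> padic_abs p (X n - X N) + padic_abs p (X N)"
      using padic_abs_add_le[OF p, of "X n - X N" "X N"] by simp
    also have "\<dots> \<le> B" using N[of n N] False small[of N] unfolding B_def by simp
    finally show ?thesis .
  qed (use small in \<open>fastforce simp: B_def\<close>)
  moreover have "B > 0" unfolding B_def by (smt (verit) padic_abs_nonneg sum_nonneg)
  ultimately show ?thesis using that by blast
qed

lemma padic_cauchy_add:
  assumes "padic_cauchy p X" "padic_cauchy p Y"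
  shows "padic_cauchy p (\<lambda>n. X n + Y n)"
  unfolding padic_cauchy_def
proof (intro allI impI)
  fix e :: real assume "e > 0"
  then have e: "e / 2 > 0" by simp
  obtain N where N: "\<And>m k. m \<ge> N \<Longrightarrow> k \<ge> N \<Longrightarrow> padic_abs p (X m - X k) < e / 2"
    using assms(1) e unfolding padic_cauchy_def by metis
  obtain M where M: "\<And>m k. m \<ge> M \<Longrightarrow> k \<ge> M \<Longrightarrow> padic_abs p (Y m - Y k) < e / 2"
    using assms(2) e unfolding padic_cauchy_def by metis
  have "padic_abs p (X m + Y m - (X k + Y k)) < e" if "m \<ge> max N M" "k \<ge> max N M" for m k
  proof -
    have "X m + Y m - (X k + Y k) = (X m - X k) + (Y m - Y k)" by simp
    then have "padic_abs p (X m + Y m - (X k + Y k)) \<le> padic_abs p (X m - X k) + padic_abs p (Y m - Y k)"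
      using padic_abs_add_le[OF p] by metis
    then show ?thesis using N[of m k] M[of m k] that by simp
  qed
  then show "\<exists>N. \<forall>m\<ge>N. \<forall>k\<ge>N. padic_abs p (X m + Y m - (X k + Y k)) < e" by blast
qed

lemma padic_cauchy_uminus: "padic_cauchy p X \<Longrightarrow> padic_cauchy p (\<lambda>n. - X n)"
  unfolding padic_cauchy_def using padic_abs_minus_commute[OF p] by (simp add: add.commute)

lemma padic_cauchy_mult:
  assumes X: "padic_cauchy p X" and Y: "padic_cauchy p Y"
  shows "padic_cauchy p (\<lambda>n. X n * Y n)"
  unfolding padic_cauchy_def
proof (intro allI impI)
  fix e :: real assume e: "e > 0"
  obtain B where B: "B > 0" "\<And>n. padic_abs p (X n) \<le> B" using padic_cauchy_bounded[OF X] by blast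
  obtain C where C: "C > 0" "\<And>n. padic_abs p (Y n) \<le> C" using padic_cauchy_bounded[OF Y] by blast
  have e1: "e / (2 * C) > 0" "e / (2 * B) > 0" using e B C by simp_all
  obtain N where N: "\<And>m k. m \<ge> N \<Longrightarrow> k \<ge> N \<Longrightarrow> padic_abs p (X m - X k) < e / (2 * C)"
    using X e1 unfolding padic_cauchy_def by metis
  obtain M where M: "\<And>m k. m \<ge> M \<Longrightarrow> k \<ge> M \<Longrightarrow> padic_abs p (Y m - Y k) < e / (2 * B)"
    using Y e1 unfolding padic_cauchy_def by metis
  have "padic_abs p (X m * Y m - X k * Y k) < e" if "m \<ge> max N M" "k \<ge> max N M" for m k
  proof -
    have "X m * Y m - X k * Y k = (X m - X k) * Y m + X k * (Y m - Y k)" by (simp add: algebra_simps)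
    then have "padic_abs p (X m * Y m - X k * Y k)
        \<le> padic_abs p (X m - X k) * padic_abs p (Y m) + padic_abs p (X k) * padic_abs p (Y m - Y k)"
      using padic_abs_add_le[OF p, of "(X m - X k) * Y m" "X k * (Y m - Y k)"] by (simp add: padic_abs_mult[OF p])
    also have "\<dots> \<le> padic_abs p (X m - X k) * C + B * padic_abs p (Y m - Y k)"
      using B C by (intro add_mono mult_left_mono mult_right_mono) auto
    also have "\<dots> < e / (2 * C) * C + B * (e / (2 * B))"
      using N[of m k] M[of m k] that B C by (intro add_strict_mono mult_strict_right_mono mult_strict_left_mono) auto
    also have "\<dots> = e" using B C by simp
    finally show ?thesis .
  qed
  then show "\<exists>N. \<forall>m\<ge>N. \<forall>k\<ge>N. padic_abs p (X m * Y m - X k * Y k) < e" by blast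
qed

lemma padic_equiv_refl: "padic_cauchy p X \<Longrightarrow> padic_equiv p X X"
  by (simp add: padic_equiv_def)

lemma padic_equiv_sym: "padic_equiv p X Y \<Longrightarrow> padic_equiv p Y X"
  unfolding padic_equiv_def by (simp add: padic_abs_minus_commute[OF p])

lemma padic_null_le:
  assumes "(\<lambda>n. f n) \<longlonglongrightarrow> 0" "\<And>n. padic_abs p (Z n) \<le> f n"
  shows "(\<lambda>n. padic_abs p (Z n)) \<longlonglongrightarrow> 0"
  by (rule tendsto_sandwich[OF _ _ tendsto_const assms(1)]) (use assms(2) in auto)

lemma padic_equiv_trans:
  assumes "padic_equiv p X Y" "padic_equiv p Y Z"
  shows "padic_equiv p X Z"
proof -
  have "(\<lambda>n. padic_abs p (X n - Y n) + padic_abs p (Y n - Z n)) \<longlonglongrightarrow> 0"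
    using assms tendsto_add[of _ "0::real" _ _ 0] by (auto simp: padic_equiv_def)
  then have "(\<lambda>n. padic_abs p (X n - Z n)) \<longlonglongrightarrow> 0"
  proof (rule padic_null_le)
    fix n show "padic_abs p (X n - Z n) \<le> padic_abs p (X n - Y n) + padic_abs p (Y n - Z n)"
      using padic_abs_add_le[OF p, of "X n - Y n" "Y n - Z n"] by simp
  qed
  then show ?thesis using assms by (simp add: padic_equiv_def)
qed

lemma padic_equiv_add:
  assumes "padic_equiv p X X'" "padic_equiv p Y Y'"
  shows "padic_equiv p (\<lambda>n. X n + Y n) (\<lambda>n. X' n + Y' n)"
proof -
  have "(\<lambda>n. padic_abs p (X n - X' n) + padic_abs p (Y n - Y' n)) \<longlonglongrightarrow> 0"
    using assms tendsto_add[of _ "0::real" _ _ 0] by (auto simp: padic_equiv_def)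
  then have "(\<lambda>n. padic_abs p (X n + Y n - (X' n + Y' n))) \<longlonglongrightarrow> 0"
  proof (rule padic_null_le)
    fix n show "padic_abs p (X n + Y n - (X' n + Y' n)) \<le> padic_abs p (X n - X' n) + padic_abs p (Y n - Y' n)"
      using padic_abs_add_le[OF p, of "X n - X' n" "Y n - Y' n"] by (simp add: algebra_simps)
  qed
  then show ?thesis using assms padic_cauchy_add by (simp add: padic_equiv_def)
qed

lemma padic_equiv_mult:
  assumes "padic_equiv p X X'" "padic_equiv p Y Y'"
  shows "padic_equiv p (\<lambda>n. X n * Y n) (\<lambda>n. X' n * Y' n)"
proof -
  have c: "padic_cauchy p X" "padic_cauchy p X'" "padic_cauchy p Y" "padic_cauchy p Y'"
    and l: "(\<lambda>n. padic_abs p (X n - X' n)) \<longlonglongrightarrow> 0" "(\<lambda>n. padic_abs p (Y n - Y' n)) \<longlonglongrightarrow> 0"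
    using assms by (auto simp: padic_equiv_def)
  obtain B where B: "B > 0" "\<And>n. padic_abs p (X' n) \<le> B" using padic_cauchy_bounded[OF c(2)] by blast
  obtain C where C: "C > 0" "\<And>n. padic_abs p (Y n) \<le> C" using padic_cauchy_bounded[OF c(3)] by blast
  have "(\<lambda>n. padic_abs p (X n - X' n) * C + B * padic_abs p (Y n - Y' n)) \<longlonglongrightarrow> 0 * C + B * 0"
    by (intro tendsto_intros l)
  then have lim: "(\<lambda>n. padic_abs p (X n - X' n) * C + B * padic_abs p (Y n - Y' n)) \<longlonglongrightarrow> 0" by simp
  have "(\<lambda>n. padic_abs p (X n * Y n - X' n * Y' n)) \<longlonglongrightarrow> 0"
  proof (rule padic_null_le[OF lim])
    fix n
    have "X n * Y n - X' n * Y' n = (X n - X' n) * Y n + X' n * (Y n - Y' n)" by (simp add: algebra_simps)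
    then have "padic_abs p (X n * Y n - X' n * Y' n)
        \<le> padic_abs p (X n - X' n) * padic_abs p (Y n) + padic_abs p (X' n) * padic_abs p (Y n - Y' n)"
      using padic_abs_add_le[OF p, of "(X n - X' n) * Y n" "X' n * (Y n - Y' n)"] by (simp add: padic_abs_mult[OF p])
    also have "\<dots> \<le> padic_abs p (X n - X' n) * C + B * padic_abs p (Y n - Y' n)"
      using B C by (intro add_mono mult_left_mono mult_right_mono) auto
    finally show "padic_abs p (X n * Y n - X' n * Y' n) \<le> padic_abs p (X n - X' n) * C + B * padic_abs p (Y n - Y' n)" .
  qed
  then show ?thesis using c padic_cauchy_mult by (simp add: padic_equiv_def)
qed

section \<open>Arithmetic of classes of Cauchy sequences\<close>

lemma qp_class_eq: "padic_equiv p X Y \<Longrightarrow> qp_class p X = qp_class p Y"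
  unfolding qp_class_def using padic_equiv_sym padic_equiv_trans by blast

text \<open>\<open>Qp\<close> computes with chosen representatives; this equivalence lets its
  operations be evaluated on arbitrary ones.\<close>

lemma qp_rep_class: "padic_cauchy p X \<Longrightarrow> padic_equiv p (qp_rep (qp_class p X)) X"
  unfolding qp_rep_def qp_class_def
  using someI[of "\<lambda>Y. Y \<in> {Y. padic_equiv p X Y}" X] padic_equiv_refl padic_equiv_sym by auto

lemma Qp_add:
  "padic_cauchy p X \<Longrightarrow> padic_cauchy p Y \<Longrightarrow>
    qp_class p X \<oplus>\<^bsub>Qp p\<^esub> qp_class p Y = qp_class p (\<lambda>n. X n + Y n)"
  unfolding Qp_def by (simp add: qp_class_eq padic_equiv_add qp_rep_class)

lemma Qp_mult:
  "padic_cauchy p X \<Longrightarrow> padic_cauchy p Y \<Longrightarrow>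
    qp_class p X \<otimes>\<^bsub>Qp p\<^esub> qp_class p Y = qp_class p (\<lambda>n. X n * Y n)"
  unfolding Qp_def by (simp add: qp_class_eq padic_equiv_mult qp_rep_class)

lemma Qp_carrierE:
  assumes "A \<in> carrier (Qp p)"
  obtains X where "padic_cauchy p X" "A = qp_class p X"
  using assms by (auto simp: Qp_def)

lemma Qp_class_in: "padic_cauchy p X \<Longrightarrow> qp_class p X \<in> carrier (Qp p)"
  by (simp add: Qp_def)

lemma Qp_one: "\<one>\<^bsub>Qp p\<^esub> = qp_class p (\<lambda>_. 1)" and Qp_zero: "\<zero>\<^bsub>Qp p\<^esub> = qp_class p (\<lambda>_. 0)"
  by (simp_all add: Qp_def)

lemmas Qp_ops = Qp_add Qp_mult Qp_one Qp_zero padic_cauchy_add padic_cauchy_mult padic_cauchy_const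
  padic_cauchy_uminus Qp_class_in

lemma cring_Qp: "cring (Qp p)"
proof (rule cringI)
  show "abelian_group (Qp p)"
  proof (rule abelian_groupI)
    fix A assume "A \<in> carrier (Qp p)"
    then obtain X where X: "padic_cauchy p X" "A = qp_class p X" by (rule Qp_carrierE)
    have "qp_class p (\<lambda>n. - X n) \<oplus>\<^bsub>Qp p\<^esub> A = \<zero>\<^bsub>Qp p\<^esub>"
      using X by (simp add: Qp_ops)
    then show "\<exists>B\<in>carrier (Qp p). B \<oplus>\<^bsub>Qp p\<^esub> A = \<zero>\<^bsub>Qp p\<^esub>"
      using X by (intro bexI[of _ "qp_class p (\<lambda>n. - X n)"]) (simp_all add: Qp_ops)
  qed (auto elim!: Qp_carrierE simp: Qp_ops add_ac)
  show "comm_monoid (Qp p)"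
    by (rule comm_monoidI) (auto elim!: Qp_carrierE simp: Qp_ops mult_ac)
qed (auto elim!: Qp_carrierE simp: Qp_ops distrib_right)

end

lemma cring_Fp: "prime p \<Longrightarrow> cring (Fp p)"
  using residues.cring[of "int p"] prime_gt_1_nat[of p] by (simp add: Fp_def residues_def)

section \<open>Unitriangular matrices\<close>

lemma mat_eq_refl [simp]: "mat_eq n A A"
  by (simp add: mat_eq_def)

lemma mat_eq_sym: "mat_eq n A B \<Longrightarrow> mat_eq n B A"
  by (simp add: mat_eq_def)

lemma mat_eq_trans [trans]: "mat_eq n A B \<Longrightarrow> mat_eq n B C \<Longrightarrow> mat_eq n A C"
  by (simp add: mat_eq_def)

lemma mat_mul_cong:
  assumes "mat_eq n A A'" "mat_eq n B B'"
  shows "mat_eq n (mat_mul R n A B) (mat_mul R n A' B')"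
  unfolding mat_eq_def mat_mul_def
proof (intro allI impI)
  fix i j assume ij: "i < n" "j < n"
  show "foldr (\<lambda>k acc. (A i k \<otimes>\<^bsub>R\<^esub> B k j) \<oplus>\<^bsub>R\<^esub> acc) [0..<n] \<zero>\<^bsub>R\<^esub>
      = foldr (\<lambda>k acc. (A' i k \<otimes>\<^bsub>R\<^esub> B' k j) \<oplus>\<^bsub>R\<^esub> acc) [0..<n] \<zero>\<^bsub>R\<^esub>"
    using assms ij by (intro foldr_cong) (auto simp: mat_eq_def)
qed

context ring
begin

text \<open>Replaces the fold in \<open>mat_mul\<close> by a finite sum, for which distributivity
  and exchange of summation are available.\<close>

lemma foldr_add_eq_finsum:
  assumes "\<And>k. k < n \<Longrightarrow> f k \<in> carrier R"
  shows "foldr (\<lambda>k acc. f k \<oplus> acc) [0..<n] \<zero> = (\<Oplus>k\<in>{..<n}. f k)"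
proof -
  \<comment> \<open>Generalised over the start value, since the fold over \<open>[0..<Suc m]\<close>
    adds \<open>f m\<close> to it first.\<close>
  have gen: "foldr (\<lambda>k acc. f k \<oplus> acc) [0..<m] a = (\<Oplus>k\<in>{..<m}. f k) \<oplus> a"
    if "a \<in> carrier R" "m \<le> n" for m a
    using that
  proof (induction m arbitrary: a)
    case (Suc m)
    have fm: "f m \<in> carrier R" "f \<in> {..<m} \<rightarrow> carrier R" using assms Suc by auto
    have "foldr (\<lambda>k acc. f k \<oplus> acc) [0..<Suc m] a = (\<Oplus>k\<in>{..<m}. f k) \<oplus> (f m \<oplus> a)"
      using Suc fm by simp
    also have "\<dots> = (\<Oplus>k\<in>{..<Suc m}. f k) \<oplus> a"
      using fm Suc by (simp add: lessThan_Suc finsum_insert finsum_closed a_ac)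
    finally show ?case .
  qed simp
  show ?thesis
    using gen[of \<zero> n] assms by (simp add: finsum_closed Pi_def)
qed

lemma mat_mul_finsum:
  assumes "in_mat R n A" "in_mat R n B" "i < n" "j < n"
  shows "mat_mul R n A B i j = (\<Oplus>k\<in>{..<n}. A i k \<otimes> B k j)"
  unfolding mat_mul_def using assms by (intro foldr_add_eq_finsum) (auto simp: in_mat_def)

lemma in_mat_mul: "in_mat R n A \<Longrightarrow> in_mat R n B \<Longrightarrow> in_mat R n (mat_mul R n A B)"
  unfolding in_mat_def[of R n "mat_mul R n A B"]
  by (auto simp: mat_mul_finsum in_mat_def intro!: finsum_closed)

lemma in_mat_one: "in_mat R n (mat_one R)"
  by (simp add: in_mat_def mat_one_def)

lemma finsum_swap:
  assumes "finite A" "finite B" "\<And>i j. i \<in> A \<Longrightarrow> j \<in> B \<Longrightarrow> f i j \<in> carrier R"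
  shows "(\<Oplus>i\<in>A. \<Oplus>j\<in>B. f i j) = (\<Oplus>j\<in>B. \<Oplus>i\<in>A. f i j)"
  using assms(1,3)
proof (induction A)
  case empty
  then show ?case by (simp add: finsum_zero)
next
  case (insert a A)
  have "(\<Oplus>i\<in>insert a A. \<Oplus>j\<in>B. f i j) = (\<Oplus>j\<in>B. f a j) \<oplus> (\<Oplus>i\<in>A. \<Oplus>j\<in>B. f i j)"
    using insert by (intro finsum_insert) (auto intro!: finsum_closed)
  also have "\<dots> = (\<Oplus>j\<in>B. f a j) \<oplus> (\<Oplus>j\<in>B. \<Oplus>i\<in>A. f i j)" using insert by simp
  also have "\<dots> = (\<Oplus>j\<in>B. f a j \<oplus> (\<Oplus>i\<in>A. f i j))"
    using insert by (intro finsum_addf[symmetric]) (auto intro!: finsum_closed)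
  also have "\<dots> = (\<Oplus>j\<in>B. \<Oplus>i\<in>insert a A. f i j)"
  proof (rule finsum_cong')
    show "(\<lambda>j. \<Oplus>i\<in>insert a A. f i j) \<in> B \<rightarrow> carrier R"
      using insert by (auto intro!: finsum_closed)
    show "f a j \<oplus> (\<Oplus>i\<in>A. f i j) = (\<Oplus>i\<in>insert a A. f i j)" if "j \<in> B" for j
      using insert that by (intro finsum_insert[symmetric]) auto
  qed simp
  finally show ?case .
qed

lemma mat_mul_assoc:
  assumes A: "in_mat R n A" and B: "in_mat R n B" and C: "in_mat R n C"
  shows "mat_eq n (mat_mul R n (mat_mul R n A B) C) (mat_mul R n A (mat_mul R n B C))"
  unfolding mat_eq_def
proof (intro allI impI)
  fix i j assume ij: "i < n" "j < n"
  have c: "A i k \<in> carrier R" "B k l \<in> carrier R" "C l j \<in> carrier R" if "k < n" "l < n" for k l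
    using A B C ij that by (auto simp: in_mat_def)
  have "mat_mul R n (mat_mul R n A B) C i j = (\<Oplus>l\<in>{..<n}. mat_mul R n A B i l \<otimes> C l j)"
    using ij assms by (intro mat_mul_finsum in_mat_mul)
  also have "\<dots> = (\<Oplus>l\<in>{..<n}. \<Oplus>k\<in>{..<n}. A i k \<otimes> (B k l \<otimes> C l j))"
  proof (rule finsum_cong')
    fix l assume l: "l \<in> {..<n}"
    have "mat_mul R n A B i l \<otimes> C l j = (\<Oplus>k\<in>{..<n}. A i k \<otimes> B k l) \<otimes> C l j"
      using ij l assms by (simp add: mat_mul_finsum)
    also have "\<dots> = (\<Oplus>k\<in>{..<n}. A i k \<otimes> B k l \<otimes> C l j)"
      using c l by (intro finsum_ldistr) auto
    also have "\<dots> = (\<Oplus>k\<in>{..<n}. A i k \<otimes> (B k l \<otimes> C l j))"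
      using c l by (intro finsum_cong') (auto simp: m_assoc)
    finally show "mat_mul R n A B i l \<otimes> C l j = (\<Oplus>k\<in>{..<n}. A i k \<otimes> (B k l \<otimes> C l j))" .
  qed (use c in \<open>auto intro!: finsum_closed\<close>)
  also have "\<dots> = (\<Oplus>k\<in>{..<n}. \<Oplus>l\<in>{..<n}. A i k \<otimes> (B k l \<otimes> C l j))"
    using c by (intro finsum_swap) auto
  also have "\<dots> = (\<Oplus>k\<in>{..<n}. A i k \<otimes> mat_mul R n B C k j)"
  proof (rule finsum_cong')
    fix k assume k: "k \<in> {..<n}"
    have "A i k \<otimes> mat_mul R n B C k j = A i k \<otimes> (\<Oplus>l\<in>{..<n}. B k l \<otimes> C l j)"
      using ij k assms by (simp add: mat_mul_finsum)
    also have "\<dots> = (\<Oplus>l\<in>{..<n}. A i k \<otimes> (B k l \<otimes> C l j))"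
      using c k by (intro finsum_rdistr) auto
    finally show "(\<Oplus>l\<in>{..<n}. A i k \<otimes> (B k l \<otimes> C l j)) = A i k \<otimes> mat_mul R n B C k j" by simp
  qed (use c ij in_mat_mul[OF B C] in \<open>auto simp: in_mat_def\<close>)
  also have "\<dots> = mat_mul R n A (mat_mul R n B C) i j"
    using ij assms by (intro mat_mul_finsum[symmetric] in_mat_mul)
  finally show "mat_mul R n (mat_mul R n A B) C i j = mat_mul R n A (mat_mul R n B C) i j" .
qed

lemma finsum_single:
  assumes "i < n" "a \<in> carrier R" "\<And>k. k < n \<Longrightarrow> f k = (if k = i then a else \<zero>)"
  shows "(\<Oplus>k\<in>{..<n::nat}. f k) = a"
proof -
  have "(\<Oplus>k\<in>{..<n}. f k) = (\<Oplus>k\<in>{..<n}. if i = k then (\<lambda>_. a) k else \<zero>)"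
    using assms by (intro finsum_cong') auto
  also have "\<dots> = a" using assms by (subst finsum_singleton) auto
  finally show ?thesis .
qed

lemma mat_mul_one_left:
  assumes "in_mat R n A"
  shows "mat_eq n (mat_mul R n (mat_one R) A) A"
  unfolding mat_eq_def
proof (intro allI impI)
  fix i j assume "i < n" "j < n"
  then show "mat_mul R n (mat_one R) A i j = A i j"
    using assms by (subst mat_mul_finsum) (auto simp: in_mat_one mat_one_def in_mat_def intro!: finsum_single[of i])
qed

lemma mat_mul_one_right:
  assumes "in_mat R n A"
  shows "mat_eq n (mat_mul R n A (mat_one R)) A"
  unfolding mat_eq_def
proof (intro allI impI)
  fix i j assume "i < n" "j < n"
  then show "mat_mul R n A (mat_one R) i j = A i j"
    using assms by (subst mat_mul_finsum) (auto simp: in_mat_one mat_one_def in_mat_def intro!: finsum_single[of j])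
qed

lemma finsum_pair:
  assumes "i < n" "k < n" "i \<noteq> k" "f i \<in> carrier R" "f k \<in> carrier R"
    and "\<And>l. l < n \<Longrightarrow> l \<noteq> i \<Longrightarrow> l \<noteq> k \<Longrightarrow> f l = \<zero>"
  shows "(\<Oplus>l\<in>{..<n::nat}. f l) = f i \<oplus> f k"
proof -
  have "(\<Oplus>l\<in>{..<n}. f l) = (\<Oplus>l\<in>{..<n}. (if l = i then f i else \<zero>) \<oplus> (if l = k then f k else \<zero>))"
    using assms by (intro finsum_cong') auto
  also have "\<dots> = (\<Oplus>l\<in>{..<n}. if l = i then f i else \<zero>) \<oplus> (\<Oplus>l\<in>{..<n}. if l = k then f k else \<zero>)"
    using assms by (intro finsum_addf) auto
  also have "\<dots> = f i \<oplus> f k"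
    using assms finsum_single[of i n "f i"] finsum_single[of k n "f k"] by simp
  finally show ?thesis .
qed

text \<open>\<open>A\<close> agrees with the identity on the first \<open>j - 1\<close>
  superdiagonals. Above the diagonal and up to the \<open>j\<close>-th superdiagonal, only the
  summands \<open>l = i\<close> and \<open>l = k\<close> survive in either product, and the diagonal
  entries are 1.\<close>

lemma unitriangular_commute_mod_band:
  assumes A: "upper_unitriangular R n A" and B: "upper_unitriangular R n B"
    and band: "\<And>i k. i < k \<Longrightarrow> k < n \<Longrightarrow> k < i + j \<Longrightarrow> A i k = \<zero>"
    and ik: "i < n" "k < n" "k \<le> i + j" and j: "j > 0"
  shows "mat_mul R n A B i k = mat_mul R n B A i k"
proof -
  have cA: "A a b \<in> carrier R" and cB: "B a b \<in> carrier R" if "a < n" "b < n" for a b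
    using A B that by (auto simp: upper_unitriangular_def in_mat_def)
  have low: "A a b = \<zero>" "B a b = \<zero>" if "a < n" "b < a" for a b
    using A B that by (auto simp: upper_unitriangular_def)
  have diag: "A a a = \<one>" "B a a = \<one>" if "a < n" for a
    using A B that by (auto simp: upper_unitriangular_def)
  have AB: "mat_mul R n A B i k = (\<Oplus>l\<in>{..<n}. A i l \<otimes> B l k)"
    and BA: "mat_mul R n B A i k = (\<Oplus>l\<in>{..<n}. B i l \<otimes> A l k)"
    using A B ik by (auto simp: upper_unitriangular_def mat_mul_finsum)
  consider "k < i" | "k = i" | "i < k" by linarith
  then show ?thesis
  proof cases
    case 1
    have "A i l \<otimes> B l k = \<zero>" "B i l \<otimes> A l k = \<zero>" if "l < n" for l
      using 1 ik that low cA cB by (cases "l < i"; simp)+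
    then have "(\<Oplus>l\<in>{..<n}. A i l \<otimes> B l k) = (\<Oplus>l\<in>{..<n}. \<zero>)" "(\<Oplus>l\<in>{..<n}. B i l \<otimes> A l k) = (\<Oplus>l\<in>{..<n}. \<zero>)"
      by (intro finsum_cong'; simp)+
    then show ?thesis by (simp add: AB BA)
  next
    case 2
    have "(\<Oplus>l\<in>{..<n}. A i l \<otimes> B l k) = \<one>" "(\<Oplus>l\<in>{..<n}. B i l \<otimes> A l k) = \<one>"
      using 2 ik low cA cB diag by (auto intro!: finsum_single[of i] simp: linorder_neq_iff)
    then show ?thesis by (simp add: AB BA)
  next
    case 3
    have "(\<Oplus>l\<in>{..<n}. A i l \<otimes> B l k) = A i i \<otimes> B i k \<oplus> A i k \<otimes> B k k"
    proof (rule finsum_pair)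
      fix l assume l: "l < n" "l \<noteq> i" "l \<noteq> k"
      then consider "l < i" | "k < l" | "i < l" "l < k" by linarith
      then show "A i l \<otimes> B l k = \<zero>"
        using l ik low cA cB band[of i l] by cases auto
    qed (use 3 ik cA cB in auto)
    moreover have "(\<Oplus>l\<in>{..<n}. B i l \<otimes> A l k) = B i i \<otimes> A i k \<oplus> B i k \<otimes> A k k"
    proof (rule finsum_pair)
      fix l assume l: "l < n" "l \<noteq> i" "l \<noteq> k"
      then consider "l < i" | "k < l" | "i < l" "l < k" by linarith
      then show "B i l \<otimes> A l k = \<zero>"
        using l ik low cA cB band[of l k] by cases auto
    qed (use 3 ik cA cB in auto)
    ultimately show ?thesis using AB BA ik diag cA cB by (simp add: a_comm)
  qed
qed

text \<open>As \<open>N\<close> is upper triangular, the entry at \<open>(i, k)\<close> sees only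
  the columns of \<open>M\<close> up to \<open>k\<close>.\<close>

lemma mat_mul_cong_band:
  assumes M: "in_mat R n M" "in_mat R n M'" and N: "upper_unitriangular R n N"
    and eq: "\<And>i k. i < n \<Longrightarrow> k < n \<Longrightarrow> k \<le> i + j \<Longrightarrow> M i k = M' i k"
    and ik: "i < n" "k < n" "k \<le> i + j"
  shows "mat_mul R n M N i k = mat_mul R n M' N i k"
proof -
  have N': "in_mat R n N" using N by (simp add: upper_unitriangular_def)
  have "(\<Oplus>l\<in>{..<n}. M i l \<otimes> N l k) = (\<Oplus>l\<in>{..<n}. M' i l \<otimes> N l k)"
  proof (rule finsum_cong')
    fix l assume l: "l \<in> {..<n}"
    show "M i l \<otimes> N l k = M' i l \<otimes> N l k"
    proof (cases "l \<le> k")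
      case False
      then have "N l k = \<zero>" using N l by (simp add: upper_unitriangular_def)
      then show ?thesis using M l ik by (simp add: in_mat_def)
    qed (use eq l ik in auto)
  qed (use M N' ik in \<open>auto simp: in_mat_def\<close>)
  then show ?thesis using mat_mul_finsum[OF M(1) N' ik(1,2)] mat_mul_finsum[OF M(2) N' ik(1,2)] by simp
qed

end

text \<open>The left-normed commutator with \<open>k\<close> entries \<open>b\<close>, where the
  commutator of \<open>g\<close> and \<open>h\<close> is \<open>g h g^-1 h^-1\<close>. Written as a
  quotient of \<open>g h\<close> by \<open>h g\<close>, it lets the two products be compared before
  the inverse is multiplied on.\<close>

fun iter_comm :: "('a, 'm) monoid_scheme \<Rightarrow> 'a \<Rightarrow> 'a \<Rightarrow> nat \<Rightarrow> 'a" where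
  "iter_comm G a b 0 = a"
| "iter_comm G a b (Suc k) =
     (iter_comm G a b k \<otimes>\<^bsub>G\<^esub> b) \<otimes>\<^bsub>G\<^esub> inv\<^bsub>G\<^esub> (b \<otimes>\<^bsub>G\<^esub> iter_comm G a b k)"

lemma (in group) iter_comm_closed: "a \<in> carrier G \<Longrightarrow> b \<in> carrier G \<Longrightarrow> iter_comm G a b k \<in> carrier G"
  by (induction k) auto

text \<open>The image of the neutral element is idempotent and invertible, hence the identity
  matrix.\<close>

lemma representation_one:
  assumes G: "group G" and R: "ring R" and rep: "representation G T R D n \<phi>"
  shows "mat_eq n (\<phi> \<one>\<^bsub>G\<^esub>) (mat_one R)"
proof -
  interpret G: group G by fact
  interpret ring R by fact
  obtain B where B: "mat_inverse_pair R n (\<phi> \<one>\<^bsub>G\<^esub>) B"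
    using rep G.one_closed unfolding representation_def in_GL_def by blast
  have c: "in_mat R n (\<phi> \<one>\<^bsub>G\<^esub>)" "in_mat R n B" using B by (auto simp: mat_inverse_pair_def)
  have sq: "mat_eq n (\<phi> \<one>\<^bsub>G\<^esub>) (mat_mul R n (\<phi> \<one>\<^bsub>G\<^esub>) (\<phi> \<one>\<^bsub>G\<^esub>))"
    using rep G.one_closed G.l_one unfolding representation_def by metis
  have inv: "mat_eq n (mat_mul R n (\<phi> \<one>\<^bsub>G\<^esub>) B) (mat_one R)" using B by (simp add: mat_inverse_pair_def)
  have "mat_eq n (mat_one R) (mat_mul R n (\<phi> \<one>\<^bsub>G\<^esub>) B)" using inv by (rule mat_eq_sym)
  also have "mat_eq n \<dots> (mat_mul R n (mat_mul R n (\<phi> \<one>\<^bsub>G\<^esub>) (\<phi> \<one>\<^bsub>G\<^esub>)) B)"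
    using sq by (rule mat_mul_cong) simp
  also have "mat_eq n \<dots> (mat_mul R n (\<phi> \<one>\<^bsub>G\<^esub>) (mat_mul R n (\<phi> \<one>\<^bsub>G\<^esub>) B))"
    by (rule mat_mul_assoc[OF c(1) c(1) c(2)])
  also have "mat_eq n \<dots> (mat_mul R n (\<phi> \<one>\<^bsub>G\<^esub>) (mat_one R))"
    using mat_mul_cong[OF mat_eq_refl inv] .
  also have "mat_eq n \<dots> (\<phi> \<one>\<^bsub>G\<^esub>)" by (rule mat_mul_one_right[OF c(1)])
  finally show ?thesis by (rule mat_eq_sym)
qed

text \<open>Each commutator with \<open>b\<close> clears one more superdiagonal of the conjugated
  matrix, so after \<open>n - 1\<close> of them the identity remains.\<close>

lemma unipotent_kills_iter_comm:
  assumes G: "group G" and R: "ring R" and rep: "unipotent_representation G T R D n \<phi>"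
    and ab: "a \<in> carrier G" "b \<in> carrier G" and k: "n \<le> Suc k"
  shows "mat_eq n (\<phi> (iter_comm G a b k)) (mat_one R)"
proof -
  interpret G: group G by fact
  interpret ring R by fact
  let ?m = "mat_mul R n"
  obtain P Q where PQ: "mat_inverse_pair R n P Q"
    and uni: "\<And>g. g \<in> carrier G \<Longrightarrow> upper_unitriangular R n (?m (?m P (\<phi> g)) Q)"
    and rep': "representation G T R D n \<phi>"
    using rep by (auto simp: unipotent_representation_def)
  have P: "in_mat R n P" and Q: "in_mat R n Q" and PQ1: "mat_eq n (?m P Q) (mat_one R)"
    and QP1: "mat_eq n (?m Q P) (mat_one R)" using PQ by (auto simp: mat_inverse_pair_def)
  have \<phi>: "in_mat R n (\<phi> g)" if "g \<in> carrier G" for g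
    using rep' that by (auto simp: representation_def in_GL_def mat_inverse_pair_def)
  have \<phi>_mult: "mat_eq n (\<phi> (g \<otimes>\<^bsub>G\<^esub> h)) (?m (\<phi> g) (\<phi> h))" if "g \<in> carrier G" "h \<in> carrier G" for g h
    using rep' that by (auto simp: representation_def)
  define A where "A g = ?m (?m P (\<phi> g)) Q" for g
  have uA: "upper_unitriangular R n (A g)" and cA: "in_mat R n (A g)" if "g \<in> carrier G" for g
    using uni that by (auto simp: A_def upper_unitriangular_def)
  have A_mult: "mat_eq n (A (g \<otimes>\<^bsub>G\<^esub> h)) (?m (A g) (A h))" if gh: "g \<in> carrier G" "h \<in> carrier G" for g h
  proof -
    let ?X = "\<phi> g" and ?Y = "\<phi> h"
    note c = P Q \<phi>[OF gh(1)] \<phi>[OF gh(2)] in_mat_mul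
    have 1: "mat_eq n (?m Q (?m (?m P ?Y) Q)) (?m ?Y Q)"
    proof -
      have "mat_eq n (?m Q (?m (?m P ?Y) Q)) (?m (?m Q (?m P ?Y)) Q)"
        by (intro mat_eq_sym[OF mat_mul_assoc] c)
      also have "mat_eq n \<dots> (?m (?m (?m Q P) ?Y) Q)"
        by (intro mat_mul_cong mat_eq_refl mat_eq_sym[OF mat_mul_assoc] c)
      also have "mat_eq n \<dots> (?m (?m (mat_one R) ?Y) Q)"
        by (intro mat_mul_cong mat_eq_refl QP1)
      also have "mat_eq n \<dots> (?m ?Y Q)"
        by (intro mat_mul_cong mat_eq_refl mat_mul_one_left c)
      finally show ?thesis .
    qed
    have "mat_eq n (?m (A g) (A h)) (?m (?m P ?X) (?m Q (?m (?m P ?Y) Q)))"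
      unfolding A_def by (intro mat_mul_assoc c)
    also have "mat_eq n \<dots> (?m (?m P ?X) (?m ?Y Q))"
      by (intro mat_mul_cong mat_eq_refl 1)
    also have "mat_eq n \<dots> (?m (?m (?m P ?X) ?Y) Q)"
      by (intro mat_eq_sym[OF mat_mul_assoc] c)
    also have "mat_eq n \<dots> (?m (?m P (?m ?X ?Y)) Q)"
      by (intro mat_mul_cong mat_eq_refl mat_mul_assoc c)
    also have "mat_eq n \<dots> (A (g \<otimes>\<^bsub>G\<^esub> h))"
      unfolding A_def by (intro mat_mul_cong mat_eq_refl mat_eq_sym[OF \<phi>_mult] gh)
    finally show ?thesis by (rule mat_eq_sym)
  qed
  have A_one: "mat_eq n (A \<one>\<^bsub>G\<^esub>) (mat_one R)"
  proof -
    have "mat_eq n (A \<one>\<^bsub>G\<^esub>) (?m (?m P (mat_one R)) Q)"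
      unfolding A_def by (intro mat_mul_cong mat_eq_refl representation_one[OF G R rep'])
    also have "mat_eq n \<dots> (?m P Q)" by (intro mat_mul_cong mat_eq_refl mat_mul_one_right P)
    also have "mat_eq n \<dots> (mat_one R)" by (rule PQ1)
    finally show ?thesis .
  qed
  let ?z = "iter_comm G a b"
  have zc: "?z j \<in> carrier G" for j using ab by (rule G.iter_comm_closed)
  have band: "A (?z j) i l = \<zero>\<^bsub>R\<^esub>" if "i < l" "l < n" "l < i + Suc j" for i l j
    using that
  proof (induction j arbitrary: i l)
    case (Suc j)
    let ?y = "?z j"
    \<comment> \<open>The matrices of \<open>y b\<close> and \<open>b y\<close> agree up to
      superdiagonal \<open>Suc j\<close>, and right multiplication by the unitriangular
      \<open>N\<close> preserves this; \<open>M\<close> times \<open>N\<close> is the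
      identity.\<close>
    define M M' N where "M = A (b \<otimes>\<^bsub>G\<^esub> ?y)" and "M' = A (?y \<otimes>\<^bsub>G\<^esub> b)" and "N = A (inv\<^bsub>G\<^esub> (b \<otimes>\<^bsub>G\<^esub> ?y))"
    have c: "b \<otimes>\<^bsub>G\<^esub> ?y \<in> carrier G" "?y \<otimes>\<^bsub>G\<^esub> b \<in> carrier G" "inv\<^bsub>G\<^esub> (b \<otimes>\<^bsub>G\<^esub> ?y) \<in> carrier G"
      using zc ab by auto
    have MM': "M' s t = M s t" if "s < n" "t < n" "t \<le> s + Suc j" for s t
    proof -
      have "M' s t = ?m (A ?y) (A b) s t" "M s t = ?m (A b) (A ?y) s t"
        using A_mult[OF zc ab(2)] A_mult[OF ab(2) zc] that by (auto simp: M_def M'_def mat_eq_def)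
      moreover have "?m (A ?y) (A b) s t = ?m (A b) (A ?y) s t"
        using that Suc.IH by (intro unitriangular_commute_mod_band[where j = "Suc j"] uA zc ab) auto
      ultimately show ?thesis by simp
    qed
    have "A (?z (Suc j)) i l = ?m M' N i l"
      using A_mult[OF c(2,3)] Suc.prems by (simp add: M'_def N_def mat_eq_def)
    also have "\<dots> = ?m M N i l"
      using MM' Suc.prems c by (intro mat_mul_cong_band[where j = "Suc j"]) (auto simp: M_def M'_def N_def cA uA)
    also have "\<dots> = A \<one>\<^bsub>G\<^esub> i l"
      using A_mult[OF c(1,3)] Suc.prems c by (simp add: M_def N_def mat_eq_def)
    also have "\<dots> = \<zero>\<^bsub>R\<^esub>"
      using A_one Suc.prems by (simp add: mat_eq_def mat_one_def)
    finally show ?case .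
  qed simp
  have A1: "mat_eq n (A (?z k)) (mat_one R)"
    unfolding mat_eq_def
  proof (intro allI impI)
    fix i l assume il: "i < n" "l < n"
    consider "i < l" | "i = l" | "l < i" by linarith
    then show "A (?z k) i l = mat_one R i l"
    proof cases
      case 1
      then show ?thesis using band[of i l k] il k by (simp add: mat_one_def)
    qed (use uA[OF zc, of k] il in \<open>auto simp: mat_one_def upper_unitriangular_def\<close>)
  qed
  let ?X = "\<phi> (?z k)"
  note c = P Q \<phi>[OF zc] in_mat_mul
  \<comment> \<open>It remains to undo the conjugation by \<open>P\<close> and
    \<open>Q\<close>.\<close>
  have "mat_eq n (?m (?m Q (A (?z k))) P) (?m (?m Q (mat_one R)) P)"
    by (intro mat_mul_cong mat_eq_refl A1)
  also have "mat_eq n \<dots> (?m Q P)" by (intro mat_mul_cong mat_eq_refl mat_mul_one_right Q)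
  also have "mat_eq n \<dots> (mat_one R)" by (rule QP1)
  finally have 1: "mat_eq n (?m (?m Q (A (?z k))) P) (mat_one R)" .
  have "mat_eq n (?m (?m Q (A (?z k))) P) (?m (?m (?m Q (?m P ?X)) Q) P)"
    unfolding A_def by (intro mat_mul_cong mat_eq_refl mat_eq_sym[OF mat_mul_assoc] c)
  also have "mat_eq n \<dots> (?m (?m Q (?m P ?X)) (?m Q P))" by (intro mat_mul_assoc c)
  also have "mat_eq n \<dots> (?m (?m (?m Q P) ?X) (?m Q P))"
    by (intro mat_mul_cong mat_eq_refl mat_eq_sym[OF mat_mul_assoc] c)
  also have "mat_eq n \<dots> (?m (?m (mat_one R) ?X) (mat_one R))" by (intro mat_mul_cong mat_eq_refl QP1)
  also have "mat_eq n \<dots> (?m (mat_one R) ?X)" by (intro mat_mul_one_right in_mat_mul in_mat_one c)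
  also have "mat_eq n \<dots> ?X" by (intro mat_mul_one_left c)
  finally show ?thesis using 1 mat_eq_sym mat_eq_trans by blast
qed

section \<open>Conjurings\<close>

lemma iter_comm_nunits:
  "ncoeff (iter_comm nunits (1 + nvar 0) (1 + nvar 1) k) [] = 1"
  using group.iter_comm_closed[OF nunits.group_axioms, of "1 + nvar 0" "1 + nvar 1" k] by simp

text \<open>With \<open>b = Z - 1\<close> and \<open>X\<close> the variable 1, the next commutator
  minus 1 is \<open>(b * X - X * b) * I\<close>, where \<open>I\<close> is the inverse of
  \<open>(1 + X) * Z\<close>. The first factor has lowest form \<open>lie_word (Suc k)\<close>, and
  \<open>I\<close> is 1 up to terms of positive degree. All this holds at every precision
  \<open>L\<close>.\<close>

lemma iter_comm_lowest_form:
  "iter_comm nunits (1 + nvar 0) (1 + nvar 1) k - 1 - lie_word k \<in> npow_ideal p d (Suc (Suc k)) L"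
proof (induction k arbitrary: L)
  case (Suc k)
  define Z where "Z = iter_comm nunits (1 + nvar 0) (1 + nvar 1) k"
  define b where "b = Z - 1"
  define I where "I = inv\<^bsub>nunits\<^esub> ((1 + nvar 1) * Z)"
  let ?X = "nvar 1" and ?\<beta> = "lie_word k"
  have Z1: "ncoeff ((1 + ?X) * Z) [] = 1" using iter_comm_nunits by (simp add: Z_def)
  have I: "ncoeff I [] = 1" "(1 + ?X) * Z * I = 1" using nunits_inv[OF Z1] by (simp_all add: I_def)
  have b: "b - ?\<beta> \<in> npow_ideal p d (Suc (Suc k)) L" for L
    using Suc.IH by (simp add: b_def Z_def)
  have b1: "b \<in> npow_ideal p d (Suc k) L" for L
    using npow_ideal_add[OF npow_ideal_mono[OF b[of L], of "Suc k" L] lie_word_in_npow_ideal] by simp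
  define c where "c = b * ?X - ?X * b"
  have up: "f \<in> npow_ideal p d e L" if "f \<in> npow_ideal p d e (Suc L)" for f e L
    using that by (rule npow_ideal_mono) auto
  have c_in: "c \<in> npow_ideal p d (Suc (Suc k)) L" for L
    unfolding c_def by (rule up) (intro npow_ideal_diff npow_ideal_aug_mult_left npow_ideal_aug_mult_right b1; simp)
  have "iter_comm nunits (1 + nvar 0) (1 + ?X) (Suc k) = Z * (1 + ?X) * I"
    by (simp add: Z_def I_def)
  then have "iter_comm nunits (1 + nvar 0) (1 + ?X) (Suc k) - 1 = Z * (1 + ?X) * I - (1 + ?X) * Z * I"
    by (simp only: I(2))
  also have "\<dots> = c * I" by (simp add: c_def b_def algebra_simps)
  finally have "iter_comm nunits (1 + nvar 0) (1 + ?X) (Suc k) - 1 - lie_word (Suc k)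
      = c * (I - 1) + ((b - ?\<beta>) * ?X - ?X * (b - ?\<beta>))"
    by (simp add: c_def algebra_simps)
  moreover have "c * (I - 1) \<in> npow_ideal p d (Suc (Suc (Suc k))) L"
    by (rule up) (intro npow_ideal_aug_mult_right c_in; simp add: I)
  moreover have "(b - ?\<beta>) * ?X - ?X * (b - ?\<beta>) \<in> npow_ideal p d (Suc (Suc (Suc k))) L"
    by (rule up) (intro npow_ideal_diff npow_ideal_aug_mult_left npow_ideal_aug_mult_right b; simp)
  ultimately show ?case by (metis npow_ideal_add)
qed simp

lemma hom_iter_comm:
  assumes G: "group G" and H: "group H" and f: "f \<in> hom G H" and ab: "a \<in> carrier G" "b \<in> carrier G"
  shows "f (iter_comm G a b k) = iter_comm H (f a) (f b) k"
proof -
  interpret group_hom G H f using G H f by (simp add: group_hom_def group_hom_axioms_def)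
  show ?thesis using ab by (induction k) (simp_all add: G.iter_comm_closed)
qed

section \<open>Magnus homomorphisms and torsion-freeness\<close>

lemma magnus_hom_exists:
  assumes F: "free_pro_p_group p d F T x" and p: "prime p"
  obtains f where "open_hom F T (magnus_group p d K) f"
    "\<And>i. i < d \<Longrightarrow> f (x i) = magnus_class p d K (1 + nvar i)"
proof (rule free_pro_p_ex[OF F, of "magnus_group p d K" "\<lambda>i. magnus_class p d K (1 + nvar i)"])
  show "finite_p_group p (magnus_group p d K)"
    using p prime_gt_0_nat by (intro finite_p_group_magnus) blast
  show "magnus_class p d K (1 + nvar i) \<in> carrier (magnus_group p d K)" for i
    by (auto simp: carrier_magnus_group)
qed (use that in blast)

lemma magnus_hom_lift:
  assumes f: "open_hom F T (magnus_group p d K) f" and a: "a \<in> carrier F"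
  obtains V where "ncoeff V [] = 1" "f a = magnus_class p d K V" "V \<in> f a"
proof -
  have "f a \<in> carrier (magnus_group p d K)" using f a by (auto simp: open_hom_def hom_def)
  then show ?thesis using that by (auto simp: carrier_magnus_group magnus_class_iff)
qed

text \<open>In the Magnus group of precision \<open>p * m\<close> the class of \<open>V ^ p\<close>
  would be trivial, but modulo \<open>p\<close> the series \<open>V ^ p - 1\<close> has a nonzero
  term of degree below \<open>p * m\<close>.\<close>

lemma free_pro_p_pth_power_nontrivial:
  assumes F: "free_pro_p_group p d F T x" and p: "prime p" and v: "v \<in> carrier F" "v \<noteq> \<one>\<^bsub>F\<^esub>"
  shows "v [^]\<^bsub>F\<^esub> p \<noteq> \<one>\<^bsub>F\<^esub>"
proof
  assume eq: "v [^]\<^bsub>F\<^esub> p = \<one>\<^bsub>F\<^esub>"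
  interpret F: group F using free_pro_p_groupD(2)[OF F] .
  obtain m where m: "\<And>K f V. K \<ge> m \<Longrightarrow> open_hom F T (magnus_group p d K) f \<Longrightarrow>
    (\<And>i. i < d \<Longrightarrow> f (x i) = magnus_class p d K (1 + nvar i)) \<Longrightarrow> V \<in> f v \<Longrightarrow> V - 1 \<notin> nmod p d m"
    using magnus_detects[OF F p v] by metis
  let ?K = "p * m" and ?M = "magnus_group p d (p * m)"
  obtain f where f: "open_hom F T ?M f" "\<And>i. i < d \<Longrightarrow> f (x i) = magnus_class p d ?K (1 + nvar i)"
    using magnus_hom_exists[OF F p, where K = "p * m"] by metis
  interpret f: group_hom F ?M f
    using f(1) by (simp add: group_hom_def group_hom_axioms_def magnus_group F.group_axioms open_hom_def)
  obtain V where V: "ncoeff V [] = 1" "f v = magnus_class p d ?K V" "V \<in> f v"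
    by (rule magnus_hom_lift[OF f(1) v(1)])
  have "V - 1 \<notin> nmod p d m"
    using m[OF _ f V(3)] prime_gt_0_nat[OF p] by simp
  then have "V ^ p - 1 \<notin> nmod p d ?K" by (rule pth_power_nontrivial[OF p])
  moreover have "magnus_class p d ?K (V ^ p) = magnus_class p d ?K 1"
    using f.hom_nat_pow[OF v(1), of p] eq V by (simp add: magnus_class_pow magnus_class_one)
  ultimately show False
    using V(1) npow_ideal_subset_nmod[OF order_refl order_refl] by (simp add: magnus_class_eq_iff)
qed

lemma free_pro_p_torsion_free:
  assumes F: "free_pro_p_group p d F T x" and p: "prime p" and v: "v \<in> carrier F" "v \<noteq> \<one>\<^bsub>F\<^esub>"
  shows "v [^]\<^bsub>F\<^esub> (p ^ l) \<noteq> \<one>\<^bsub>F\<^esub>"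
proof -
  interpret F: group F using free_pro_p_groupD(2)[OF F] .
  show ?thesis
  proof (induction l)
    case (Suc l)
    have "v [^]\<^bsub>F\<^esub> (p ^ Suc l) = (v [^]\<^bsub>F\<^esub> (p ^ l)) [^]\<^bsub>F\<^esub> p"
      using v by (simp add: F.nat_pow_pow mult.commute)
    then show ?case
      using free_pro_p_pth_power_nontrivial[OF F p _ Suc] v by simp
  qed (use v in simp)
qed

theorem theorem2:
  fixes p d l n :: nat and F :: "('a, 'm) monoid_scheme" and T :: "'a topology"
    and x :: "nat \<Rightarrow> 'a" and w :: 'a
  assumes "prime p" and "d \<ge> 2"
    and "free_pro_p_group p d F T x"
    and "w \<in> carrier F" and "w \<noteq> \<one>\<^bsub>F\<^esub>"
  shows "\<exists>z\<in>carrier F.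
     (\<forall>\<phi>. unipotent_representation F T (Qp p) (qp_dist p) n \<phi> \<longrightarrow> mat_eq n (\<phi> z) (mat_one (Qp p))) \<and>
     (\<forall>\<psi>. unipotent_representation F T (Fp p) discrete_dist n \<psi> \<longrightarrow> mat_eq n (\<psi> z) (mat_one (Fp p))) \<and>
     \<not> (\<exists>y\<in>carrier F. (w [^]\<^bsub>F\<^esub> (p ^ l)) \<otimes>\<^bsub>F\<^esub> (z [^]\<^bsub>F\<^esub> p) = y [^]\<^bsub>F\<^esub> p)"
proof -
  note p = assms(1) and d = assms(2) and F = assms(3) and w = assms(4,5)
  interpret F: group F using free_pro_p_groupD(2)[OF F] .
  have Q: "ring (Qp p)" and P: "ring (Fp p)"
    using cring_Qp[OF p] cring_Fp[OF p] by (auto intro: cring.axioms)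
  define r where "r = w [^]\<^bsub>F\<^esub> (p ^ l)"
  show ?thesis
  proof (cases "\<exists>v\<in>carrier F. r = v [^]\<^bsub>F\<^esub> p")
    case False
    \<comment> \<open>With \<open>z = 1\<close>, a \<open>p\<close>-th root of the product would be
      one of \<open>r\<close>.\<close>
    then show ?thesis
      using representation_one[OF F.group_axioms Q] representation_one[OF F.group_axioms P] w(1)
      by (intro bexI[of _ "\<one>\<^bsub>F\<^esub>"]) (auto simp: unipotent_representation_def r_def)
  next
    case True
    then obtain v where v: "v \<in> carrier F" "r = v [^]\<^bsub>F\<^esub> p" by blast
    \<comment> \<open>If \<open>v\<close> were 1, then \<open>w\<close> would be a nontrivial
      element of order dividing \<open>p ^ l\<close>, contrary to torsion-freeness.\<close>
    have "v \<noteq> \<one>\<^bsub>F\<^esub>" using free_pro_p_torsion_free[OF F p w, of l] v by (auto simp: r_def)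
    then obtain m where m: "\<And>K f V. K \<ge> m \<Longrightarrow> open_hom F T (magnus_group p d K) f \<Longrightarrow>
        (\<And>i. i < d \<Longrightarrow> f (x i) = magnus_class p d K (1 + nvar i)) \<Longrightarrow> V \<in> f v \<Longrightarrow> V - 1 \<notin> nmod p d m"
      using magnus_detects[OF F p v(1)] by metis
    \<comment> \<open>The bound \<open>n\<close> makes the commutator die in all unipotent
      representations of size \<open>n\<close>; the bound \<open>p * m\<close> puts its weight
      beyond the lowest degree of the \<open>p\<close>-th power of \<open>V - 1\<close>.\<close>
    define k where "k = max n (p * m)"
    \<comment> \<open>This precision keeps all terms of degree below \<open>2 * Suc k\<close>
      visible modulo \<open>p\<close>.\<close>
    define K where "K = 2 * Suc k"
    have k: "n \<le> Suc k" "p * m \<le> k" by (auto simp: k_def)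
    have "m \<le> p * m" using prime_gt_0_nat[OF p] by simp
    then have "m \<le> k" using k(2) by (rule order_trans)
    then have Km: "m \<le> K" by (simp add: K_def)
    obtain f where f: "open_hom F T (magnus_group p d K) f"
      "\<And>i. i < d \<Longrightarrow> f (x i) = magnus_class p d K (1 + nvar i)"
      using magnus_hom_exists[OF F p, where K = K] by metis
    interpret f: group_hom F "magnus_group p d K" f
      using f(1) by (simp add: group_hom_def group_hom_axioms_def magnus_group F.group_axioms open_hom_def)
    have x01: "x 0 \<in> carrier F" "x 1 \<in> carrier F" using d by (auto intro: free_pro_p_groupD(4)[OF F])
    define z where "z = iter_comm F (x 0) (x 1) k"
    define Z where "Z = iter_comm nunits (1 + nvar 0) (1 + nvar 1) k"
    have zc: "z \<in> carrier F" unfolding z_def by (rule F.iter_comm_closed[OF x01])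
    have Z1: "ncoeff Z [] = 1" unfolding Z_def by (rule iter_comm_nunits)
    \<comment> \<open>\<open>z\<close> and \<open>Z\<close> are the same commutator expression, in
      the generators and in the series \<open>1 + nvar i\<close>, and homomorphisms preserve
      it.\<close>
    have fz: "f z = magnus_class p d K Z"
      unfolding z_def Z_def using d f(2)[of 0] f(2)[of 1]
        hom_iter_comm[OF F.group_axioms magnus_group f.homh x01]
        hom_iter_comm[OF nunits.group_axioms magnus_group magnus_class_hom, of "1 + nvar 0" "1 + nvar 1"]
      by simp
    have "r \<otimes>\<^bsub>F\<^esub> (z [^]\<^bsub>F\<^esub> p) \<noteq> y [^]\<^bsub>F\<^esub> p" if y: "y \<in> carrier F" for y
    proof
      assume eq: "r \<otimes>\<^bsub>F\<^esub> (z [^]\<^bsub>F\<^esub> p) = y [^]\<^bsub>F\<^esub> p"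
      obtain V where V: "ncoeff V [] = 1" "f v = magnus_class p d K V" "V \<in> f v"
        by (rule magnus_hom_lift[OF f(1) v(1)])
      obtain Y where Y: "ncoeff Y [] = 1" "f y = magnus_class p d K Y"
        by (rule magnus_hom_lift[OF f(1) y])
      have "f (y [^]\<^bsub>F\<^esub> p) = magnus_class p d K (Y ^ p)"
        using Y y by (simp add: f.hom_nat_pow magnus_class_pow)
      moreover have "f (r \<otimes>\<^bsub>F\<^esub> (z [^]\<^bsub>F\<^esub> p)) = magnus_class p d K (V ^ p * Z ^ p)"
        using V Z1 fz v zc by (simp add: f.hom_nat_pow magnus_class_pow magnus_class_mult)
      ultimately have "Y ^ p - V ^ p * Z ^ p \<in> npow_ideal p d K K"
        using eq V Y Z1 by (simp add: magnus_class_eq_iff[symmetric])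
      \<comment> \<open>At precision \<open>K\<close> the congruence holds with every degree bound
        \<open>e\<close>, which contradicts the \<open>e\<close> provided by
        \<open>no_pth_root\<close>.\<close>
      then have "Y ^ p - V ^ p * Z ^ p \<in> npow_ideal p d e K" for e by (rule npow_ideal_full)
      moreover have "V - 1 \<notin> nmod p d m" by (rule m[OF Km f V(3)])
      ultimately show False
        using no_pth_root[OF p d V(1) Y(1) Z1 _ k(2) iter_comm_lowest_form[of k p d K, folded Z_def]]
        by (auto simp: K_def)
    qed
    then show ?thesis
      using unipotent_kills_iter_comm[OF F.group_axioms Q _ x01 k(1)]
        unipotent_kills_iter_comm[OF F.group_axioms P _ x01 k(1)] zc
      by (intro bexI[of _ z]) (auto simp: r_def z_def)
  qed
qed

end
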